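(* Let $t_0\le t_-<t_+\le T$, $r>0$, $N\in\mathbb N$, and $w_i\in W(r,N)$ with $z_i=w_i(0)$, $i=1,2$. Let $\alpha\in\operatorname{Lip}([t_-,t_+];A)$ and $x_i(\cdot):=x(\cdot\,|\,t_-,w_i,\alpha)$, $i=1,2$. 1. There exists $C(r)>0$ (depending only on $r$ and the fixed data of the problem) such that $$\|x_1(s)-x_2(s)\|\le C(r)\bigl(\|z_1-z_2\|+\|w_1-w_2\|_1\bigr),\qquad s\in[t_-,t_+].$$ 2. Let $w_3:=\frac{w_1+w_2}2$, $z_3:=w_3(0)=\frac{z_1+z_2}2$, and $x_3(\cdot):=x(\cdot\,|\,t_-,w_3,\alpha)$. Then there exists $C=C(r,N,\operatorname{Lip}(\alpha))>0$ (depending only on $r$, $N$, $\operatorname{Lip}(\alpha)$ and the fixed data of the problem) such that $$\|x_1(s)+x_2(s)-2x_3(s)\|\le C\|w_1-w_2\|_{H^1}^2$$ for all $s\in[t_-,t_+]$. In particular, this estimate holds for $\alpha\in\operatorname{Lip}((t_-,t_+];A)$.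
   Context: Setting. Let $t_0<T$, $I=[t_0,T]$, $n,m\ge 1$; $A\subset\mathbb R^m$ is nonempty, convex and compact. $\|\cdot\|$ is the Euclidean norm on $\mathbb R^n$; $\|\cdot\|_m$ that on $\mathbb R^m$; $\|\cdot\|_1,\|\cdot\|_2,\|\cdot\|_\infty,\|\cdot\|_{H^1}$ are the usual $L^1,L^2,L^\infty,H^1$ norms for functions on $[-\bar\tau,0]$ (with $\bar\tau$ introduced in (7) below). $\operatorname{Lip}(v)$ is the Lipschitz constant of $v$. $\mathbb G:=I\times\operatorname{Lip}([-\bar\tau,0];\mathbb R^n)$. For $t_0\le t<s\le T$, $\mathcal A_{t,s}$ is the set of measurable functions $\alpha:(t,s)\to A$. For $R>0$: $P(R)=\{w\in\operatorname{Lip}([-\bar\tau,0];\mathbb R^n):\|w\|_\infty\le R\}$, $V(R)=\{w\in P(R):\|\dot w\|_\infty\le R\}$, $B_R=\{x\in\mathbb R^n:\|x\|\le R\}$. $\mathcal X=\{(z,w):w\in\operatorname{Lip}([-\bar\tau,0];\mathbb R^n),\ z=w(0)\}$ with norm $\|(z,w)\|_{\mathcal X}=\|z\|+\|w\|_1$. Standing assumptions. (1) $f:I\times\mathbb R^n\times\mathbb R^n\times A\to\mathbb R^n$ and $L:I\times\mathbb R^n\times\mathbb R^n\times A\to\mathbb R$ are continuous. (2) There is $\lambda_f>0$ with $\|f(t,z,y,a)-f(t,z',y',a)\|\le\lambda_f(\|z-z'\|+\|y-y'\|)$ for all arguments, and hence $\|f(t,z,y,a)\|\le C_f(1+\|z\|+\|y\|)$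 for some $C_f>0$. (3) For every $(t,z,y)$ the set $\{(f(t,z,y,a),\ell)\in\mathbb R^n\times\mathbb R:a\in A,\ \ell\ge L(t,z,y,a)\}$ is convex. (4) For every $R>0$ there is $\lambda_L(R)>0$ with $|L(t,z,y,a)-L(t,z',y',a)|\le\lambda_L(R)(\|z-z'\|+\|y-y'\|)$ for $t\in I$, $a\in A$, $z,y,z',y'\in B_R$. (5) There is $C_L>0$ with $|L(t,z,y,a)|\le C_L(1+\|z\|+\|y\|)$ for all arguments. (6) $g:\mathcal X\to\mathbb R$ and for every $R>0$ there is $\lambda_g(R)>0$ with $|g(z_1,w_1)-g(z_2,w_2)|\le\lambda_g(R)\|(z_1,w_1)-(z_2,w_2)\|_{\mathcal X}$ for all $(z_i,w_i)\in\mathcal X$ with $w_i\in P(R)$. (7) $\tau:I\times\mathbb R^n\to[0,\infty)$ is $C^1$ with supremum $\bar\tau<\infty$, and there is $\lambda_\tau>0$ with $|\tau(t,z)-\tau(t,y)|\le\lambda_\tau\|z-y\|$ for all $t\in I$, $z,y\in\mathbb R^n$. State equation. For $(t,w)\in\mathbb G$ and $\alpha\in\mathcal A_{t,T}$, $x(\cdot\,|\,t,w,\alpha)$ denotes the unique Lipschitz $x:[t-\bar\tau,T]\to\mathbb R^n$ with $\dot x(s)=f(s,x(s),x(s-\tau(s,x(s))),\alpha(s))$ for a.e. $s\in(t,T)$ and $x(t+\theta)=w(\theta)$ for $\theta\in[-\bar\tau,0]$ (it exists and is unique under (1)-(7)); for a control defined only on $[t_-,t_+]$, $x(\cdot\,|\,t_-,w,\alpha)$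 is the solution on $[t_--\bar\tau,t_+]$. Write $x_s(\theta)=x(s+\theta)$, $\theta\in[-\bar\tau,0]$. (8) (Monotone delay) For every $r>0$ there is $d(r)>0$ such that for every solution on $[t,T]$ with $t\in I$, $w\in P(r)$, $\alpha\in\mathcal A_{t,T}$: $1-\tau_t(s,x(s))-\tau_z(s,x(s))\cdot\dot x(s)\ge d(r)$ for a.e. $s\in[t,T]$. Additional assumptions. With $\mathcal H(t,z,y,p,a)=f(t,z,y,a)\cdot p+L(t,z,y,a)$: (S1) $f,L\in C^1(I\times\mathbb R^n\times\mathbb R^n\times A)$. (S2) There are $\mu,\lambda_{\mathcal H}>0$ with $(\mathcal H_a(t,z,y,p,a_1)-\mathcal H_a(t,z,y,p,a_2))\cdot(a_1-a_2)\ge\mu\|a_1-a_2\|_m^2$ and $\|\mathcal H_a(t_1,z_1,y_1,p_1,a)-\mathcal H_a(t_2,z_2,y_2,p_2,a)\|\le\lambda_{\mathcal H}(|t_1-t_2|+\|z_1-z_2\|+\|y_1-y_2\|+\|p_1-p_2\|)$ for all $(t,z,y,p),(t_i,z_i,y_i,p_i)\in I\times(\mathbb R^n)^3$, $a,a_1,a_2\in A$. (S3) For every $r>0$ there are $\gamma_f(r),\gamma_L(r)>0$ with $\|f(t,z_1,y_1,a)+f(t,z_2,y_2,a)-2f(t,\frac{z_1+z_2}2,\frac{y_1+y_2}2,a)\|\le\gamma_f(r)(\|z_1-z_2\|^2+\|y_1-y_2\|^2)$ and $|L(t,z_1,y_1,a)+L(t,z_2,y_2,a)-2L(t,\frac{z_1+z_2}2,\frac{y_1+y_2}2,a)|\le\gamma_L(r)(\|z_1-z_2\|^2+\|y_1-y_2\|^2)$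 for $t\in I$, $a\in A$, $z_i,y_i\in B_r$. (S4) For every $r>0$ there is $\gamma_\tau(r)>0$ with $|\tau(t,z_1)+\tau(t,z_2)-2\tau(t,\frac{z_1+z_2}2)|\le\gamma_\tau(r)\|z_1-z_2\|^2$ for $t\in I$, $z_1,z_2\in B_r$. (S5) For any $(t,w)\in\mathbb G$, $\alpha\in\mathcal A_{t,T}$ and $x=x(\cdot\,|\,t,w,\alpha)$, $g$ is Fr\'echet differentiable at $(x(T),x_T)$; and for every $r>0$ there is $\gamma_g(r)>0$ with $\|g_w(x(T),x_T)\|_\infty\le\gamma_g(r)$ for all $t\in I$, $w\in V(r)$, $\alpha\in\mathcal A_{t,T}$. Here $g$ is Fr\'echet differentiable at $(z,w)\in\mathcal X$ if there are $g_z(z,w)\in\mathbb R^n$, $g_w(z,w)\in L^\infty([-\bar\tau,0];\mathbb R^n)$ with $g(z+\delta z,w+\delta w)-g(z,w)=g_z(z,w)\cdot\delta z+\int_{-\bar\tau}^0g_w(z,w)(\theta)\cdot\delta w(\theta)\,d\theta+o(\|(\delta z,\delta w)\|_{\mathcal X})$ for $(\delta z,\delta w)\in\mathcal X$. Classes of histories. $W(r)$ is the set of all piecewise $C^{1,1}$ functions $w\in V(r)$ (finitely many breakpoints) such that $\operatorname{Lip}(\dot w|_{(\theta_{j-1},\theta_j)})\le r$ on every subinterval $(\theta_{j-1},\theta_j)$ on which $w$ is $C^{1,1}$; $W(r,N)$ is the set of $w\in W(r)$ having at most $N$ nonsmooth points. "Fixed data of the problem" means $t_0,T,n,m,A,f,L,g,\tau$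 and the constants in the assumptions. *)

theory Defs
  imports "HOL-Analysis.Analysis" "HOL-Probability.Essential_Supremum"
begin

section \<open>Functions on the history interval\<close>

text \<open>
  Histories, i.e. functions on [-tb, 0] (tb is the maximal delay), are total functions on the
  reals.  Every notion below depends only on their values on [-tb, 0].
\<close>

definition lip_const :: "'a::metric_space set \<Rightarrow> ('a \<Rightarrow> 'b::metric_space) \<Rightarrow> real" where
  "lip_const S v = Inf {K. K-lipschitz_on S v}"

definition hist_deriv :: "real \<Rightarrow> (real \<Rightarrow> 'b::real_normed_vector) \<Rightarrow> real \<Rightarrow> 'b" where
  "hist_deriv tb w \<theta> = vector_derivative w (at \<theta> within {-tb..0})"

definition L1_norm :: "real \<Rightarrow> (real \<Rightarrow> 'b::euclidean_space) \<Rightarrow> real" where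
  "L1_norm tb w = integral\<^sup>L (lebesgue_on {-tb..0}) (\<lambda>\<theta>. norm (w \<theta>))"

definition L2_norm :: "real \<Rightarrow> (real \<Rightarrow> 'b::euclidean_space) \<Rightarrow> real" where
  "L2_norm tb w = sqrt (integral\<^sup>L (lebesgue_on {-tb..0}) (\<lambda>\<theta>. (norm (w \<theta>))\<^sup>2))"

definition H1_norm :: "real \<Rightarrow> (real \<Rightarrow> 'b::euclidean_space) \<Rightarrow> real" where
  "H1_norm tb w = sqrt ((L2_norm tb w)\<^sup>2 + (L2_norm tb (hist_deriv tb w))\<^sup>2)"

definition Linf_norm :: "real \<Rightarrow> (real \<Rightarrow> 'b::euclidean_space) \<Rightarrow> ereal" where
  "Linf_norm tb w = esssup (lebesgue_on {-tb..0}) (\<lambda>\<theta>. ereal (norm (w \<theta>)))"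

definition Lip_hist :: "real \<Rightarrow> (real \<Rightarrow> 'b::euclidean_space) set" where
  "Lip_hist tb = {w. \<exists>K. K-lipschitz_on {-tb..0} w}"

definition P_hist :: "real \<Rightarrow> real \<Rightarrow> (real \<Rightarrow> 'b::euclidean_space) set" where
  "P_hist tb R = {w \<in> Lip_hist tb. Linf_norm tb w \<le> ereal R}"

definition V_hist :: "real \<Rightarrow> real \<Rightarrow> (real \<Rightarrow> 'b::euclidean_space) set" where
  "V_hist tb R = {w \<in> P_hist tb R. Linf_norm tb (hist_deriv tb w) \<le> ereal R}"

definition C11_with :: "real \<Rightarrow> real \<Rightarrow> real set \<Rightarrow> (real \<Rightarrow> 'b::euclidean_space) \<Rightarrow> bool" where
  "C11_with tb K U w \<longleftrightarrow>
     (\<forall>\<theta>\<in>U. w differentiable (at \<theta>)) \<and> K-lipschitz_on U (hist_deriv tb w)"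

definition W_hist :: "real \<Rightarrow> real \<Rightarrow> (real \<Rightarrow> 'b::euclidean_space) set" where
  "W_hist tb r = {w \<in> V_hist tb r.
     \<exists>k (\<theta> :: nat \<Rightarrow> real). \<theta> 0 = -tb \<and> \<theta> k = 0 \<and>
       (\<forall>j<k. \<theta> j < \<theta> (Suc j) \<and> C11_with tb r {\<theta> j<..<\<theta> (Suc j)} w)}"

definition nonsmooth_points :: "real \<Rightarrow> (real \<Rightarrow> 'b::euclidean_space) \<Rightarrow> real set" where
  "nonsmooth_points tb w = {\<theta> \<in> {-tb<..<0}.
     \<not> (\<exists>e>0. \<exists>K. {\<theta> - e<..<\<theta> + e} \<subseteq> {-tb<..<0} \<and> C11_with tb K {\<theta> - e<..<\<theta> + e} w)}"

text \<open>For members of \<open>W_hist tb r\<close> the set of nonsmooth points is finite, so \<open>card\<close> is meaningful.\<close>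

definition WN_hist :: "real \<Rightarrow> real \<Rightarrow> nat \<Rightarrow> (real \<Rightarrow> 'b::euclidean_space) set" where
  "WN_hist tb r N = {w \<in> W_hist tb r. card (nonsmooth_points tb w) \<le> N}"

definition X_space :: "real \<Rightarrow> ('b::euclidean_space \<times> (real \<Rightarrow> 'b)) set" where
  "X_space tb = {(z, w). w \<in> Lip_hist tb \<and> z = w 0}"

definition X_norm :: "real \<Rightarrow> ('b::euclidean_space \<times> (real \<Rightarrow> 'b)) \<Rightarrow> real" where
  "X_norm tb = (\<lambda>(z, w). norm z + L1_norm tb w)"

section \<open>Differentiability\<close>

text \<open>
  \<open>C\<^sup>1\<close> on a set that need not be open: derivatives relative to the set, depending continuously
  on the point.
\<close>

definition has_C1_derivative_on ::
  "('a::real_normed_vector \<Rightarrow> 'b::real_normed_vector) \<Rightarrow> ('a \<Rightarrow> 'a \<Rightarrow>\<^sub>L 'b) \<Rightarrow> 'a set \<Rightarrow> bool" where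
  "has_C1_derivative_on f f' S \<longleftrightarrow>
     (\<forall>x\<in>S. (f has_derivative blinfun_apply (f' x)) (at x within S)) \<and> continuous_on S f'"

definition C1_on :: "'a::real_normed_vector set \<Rightarrow> ('a \<Rightarrow> 'b::real_normed_vector) \<Rightarrow> bool" where
  "C1_on S f \<longleftrightarrow> (\<exists>f'. has_C1_derivative_on f f' S)"

text \<open>
  \<open>gz\<close> and \<open>gw\<close> are the Frechet derivatives of \<open>g\<close> with respect to the two components at the given
  point of \<open>X_space tb\<close>; they are uniquely determined (\<open>gw\<close> up to null sets) because \<open>X_space tb\<close> is
  dense in the product of the Euclidean space and the space of integrable functions.
\<close>

definition has_X_derivative ::
  "real \<Rightarrow> ('b::euclidean_space \<times> (real \<Rightarrow> 'b) \<Rightarrow> real) \<Rightarrow> 'b \<Rightarrow> (real \<Rightarrow> 'b) \<Rightarrow> 'b \<times> (real \<Rightarrow> 'b) \<Rightarrow> bool"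
where
  "has_X_derivative tb g gz gw = (\<lambda>(z, w).
     gw \<in> borel_measurable (lebesgue_on {-tb..0}) \<and> Linf_norm tb gw < \<infinity> \<and>
     (\<forall>\<epsilon>>0. \<exists>\<delta>>0. \<forall>dz dw. (dz, dw) \<in> X_space tb \<and> X_norm tb (dz, dw) < \<delta> \<longrightarrow>
        \<bar>g (z + dz, \<lambda>\<theta>. w \<theta> + dw \<theta>) - g (z, w)
           - (gz \<bullet> dz + integral\<^sup>L (lebesgue_on {-tb..0}) (\<lambda>\<theta>. gw \<theta> \<bullet> dw \<theta>))\<bar>
          \<le> \<epsilon> * X_norm tb (dz, dw)))"

section \<open>Controls and trajectories\<close>

definition controls :: "'c::euclidean_space set \<Rightarrow> real \<Rightarrow> real \<Rightarrow> (real \<Rightarrow> 'c) set" where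
  "controls A t s =
     {\<alpha> \<in> borel_measurable (lebesgue_on {t<..<s}). \<forall>\<sigma>\<in>{t<..<s}. \<alpha> \<sigma> \<in> A}"

definition Lip_controls :: "real set \<Rightarrow> 'c::euclidean_space set \<Rightarrow> (real \<Rightarrow> 'c) set" where
  "Lip_controls J A = {\<alpha>. (\<exists>K. K-lipschitz_on J \<alpha>) \<and> (\<forall>s\<in>J. \<alpha> s \<in> A)}"

text \<open>
  \<open>is_trajectory f tau tb t te w \<alpha> x\<close>: the restriction of \<open>x\<close> to [t - tb, te] is the (unique)
  Lipschitz solution of the state equation on [t, te] with initial history \<open>w\<close> and control \<open>\<alpha>\<close>.
\<close>

definition is_trajectory ::
  "(real \<times> 'b \<times> 'b \<times> 'c \<Rightarrow> 'b::euclidean_space) \<Rightarrow> (real \<times> 'b \<Rightarrow> real) \<Rightarrow> real \<Rightarrow> real \<Rightarrow> real \<Rightarrow>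
   (real \<Rightarrow> 'b) \<Rightarrow> (real \<Rightarrow> 'c) \<Rightarrow> (real \<Rightarrow> 'b) \<Rightarrow> bool"
where
  "is_trajectory f tau tb t te w \<alpha> x \<longleftrightarrow>
     (\<exists>K. K-lipschitz_on {t - tb..te} x) \<and>
     (AE s in lebesgue_on {t<..<te}.
        (x has_vector_derivative f (s, x s, x (s - tau (s, x s)), \<alpha> s)) (at s)) \<and>
     (\<forall>\<theta>\<in>{-tb..0}. x (t + \<theta>) = w \<theta>)"

definition hamiltonian ::
  "(real \<times> 'b \<times> 'b \<times> 'c \<Rightarrow> 'b::euclidean_space) \<Rightarrow> (real \<times> 'b \<times> 'b \<times> 'c \<Rightarrow> real) \<Rightarrow>
   real \<Rightarrow> 'b \<Rightarrow> 'b \<Rightarrow> 'b \<Rightarrow> 'c \<Rightarrow> real"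
where
  "hamiltonian f L t z y p a = f (t, z, y, a) \<bullet> p + L (t, z, y, a)"

section \<open>The control problem with state-dependent delay\<close>

locale delay_control_problem =
  fixes t0 T :: real
    and A :: "(real^'m) set"
    and f :: "real \<times> (real^'n) \<times> (real^'n) \<times> (real^'m) \<Rightarrow> real^'n"
    and L :: "real \<times> (real^'n) \<times> (real^'n) \<times> (real^'m) \<Rightarrow> real"
    and g :: "(real^'n) \<times> (real \<Rightarrow> real^'n) \<Rightarrow> real"
    and tau :: "real \<times> (real^'n) \<Rightarrow> real"
    and Dtau :: "real \<times> (real^'n) \<Rightarrow> (real \<times> (real^'n)) \<Rightarrow>\<^sub>L real"
    and tb :: real
  assumes horizon: "t0 < T"
    and A_set: "A \<noteq> {}" "convex A" "compact A"
    and f_cont: "continuous_on ({t0..T} \<times> UNIV \<times> UNIV \<times> A) f"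
    and L_cont: "continuous_on ({t0..T} \<times> UNIV \<times> UNIV \<times> A) L"
    and f_lipschitz: "\<exists>lf>0. \<forall>t\<in>{t0..T}. \<forall>z y z' y'. \<forall>a\<in>A.
      norm (f (t, z, y, a) - f (t, z', y', a)) \<le> lf * (norm (z - z') + norm (y - y'))"
    and epigraph_convex: "\<forall>t\<in>{t0..T}. \<forall>z y.
      convex {(f (t, z, y, a), l) | a l. a \<in> A \<and> L (t, z, y, a) \<le> l}"
    and L_loc_lipschitz: "\<forall>R>0. \<exists>lL>0. \<forall>t\<in>{t0..T}. \<forall>a\<in>A.
      \<forall>z\<in>cball 0 R. \<forall>y\<in>cball 0 R. \<forall>z'\<in>cball 0 R. \<forall>y'\<in>cball 0 R.
      \<bar>L (t, z, y, a) - L (t, z', y', a)\<bar> \<le> lL * (norm (z - z') + norm (y - y'))"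
    and L_growth: "\<exists>CL>0. \<forall>t\<in>{t0..T}. \<forall>z y. \<forall>a\<in>A.
      \<bar>L (t, z, y, a)\<bar> \<le> CL * (1 + norm z + norm y)"
    and g_loc_lipschitz: "\<forall>R>0. \<exists>lg>0. \<forall>z1 w1 z2 w2.
      (z1, w1) \<in> X_space tb \<and> (z2, w2) \<in> X_space tb \<and> w1 \<in> P_hist tb R \<and> w2 \<in> P_hist tb R \<longrightarrow>
      \<bar>g (z1, w1) - g (z2, w2)\<bar> \<le> lg * X_norm tb (z1 - z2, \<lambda>\<theta>. w1 \<theta> - w2 \<theta>)"
    and tau_nonneg: "\<forall>t\<in>{t0..T}. \<forall>z. 0 \<le> tau (t, z)"
    and tau_C1: "has_C1_derivative_on tau Dtau ({t0..T} \<times> UNIV)"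
    and tau_bdd: "bdd_above (tau ` ({t0..T} \<times> UNIV))"
    and tb_sup: "tb = (SUP p\<in>{t0..T} \<times> UNIV. tau p)"
    \<comment> \<open>for \<open>tb = 0\<close> the history interval is a point and all the integral norms degenerate to 0\<close>
    and tb_pos: "0 < tb"
    and tau_lipschitz: "\<exists>lt>0. \<forall>t\<in>{t0..T}. \<forall>z y. \<bar>tau (t, z) - tau (t, y)\<bar> \<le> lt * norm (z - y)"
    and monotone_delay: "\<forall>r>0. \<exists>d>0. \<forall>t\<in>{t0..T}. \<forall>w\<in>P_hist tb r. \<forall>\<alpha>\<in>controls A t T. \<forall>x.
      is_trajectory f tau tb t T w \<alpha> x \<longrightarrow>
      (AE s in lebesgue_on {t..T}.
         d \<le> 1 - blinfun_apply (Dtau (s, x s)) (1, 0)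
               - blinfun_apply (Dtau (s, x s)) (0, vector_derivative x (at s)))"
    and f_C1: "C1_on ({t0..T} \<times> UNIV \<times> UNIV \<times> A) f"
    and L_C1: "C1_on ({t0..T} \<times> UNIV \<times> UNIV \<times> A) L"
    \<comment> \<open>\<open>Ha\<close> is the gradient of the Hamiltonian in the control variable; it is unique
        if \<open>A\<close> has interior points, and otherwise some choice of gradient relative to \<open>A\<close>\<close>
    and Ha_monotone_lipschitz: "\<exists>Ha :: real \<Rightarrow> real^'n \<Rightarrow> real^'n \<Rightarrow> real^'n \<Rightarrow> real^'m \<Rightarrow> real^'m.
      (\<forall>t\<in>{t0..T}. \<forall>z y p. \<forall>a\<in>A.
         ((\<lambda>b. hamiltonian f L t z y p b) has_derivative (\<lambda>h. Ha t z y p a \<bullet> h)) (at a within A)) \<and>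
      (\<exists>\<mu>>0. \<forall>t\<in>{t0..T}. \<forall>z y p. \<forall>a1\<in>A. \<forall>a2\<in>A.
         \<mu> * (norm (a1 - a2))\<^sup>2 \<le> (Ha t z y p a1 - Ha t z y p a2) \<bullet> (a1 - a2)) \<and>
      (\<exists>lH>0. \<forall>t1\<in>{t0..T}. \<forall>t2\<in>{t0..T}. \<forall>z1 y1 p1 z2 y2 p2. \<forall>a\<in>A.
         norm (Ha t1 z1 y1 p1 a - Ha t2 z2 y2 p2 a)
           \<le> lH * (\<bar>t1 - t2\<bar> + norm (z1 - z2) + norm (y1 - y2) + norm (p1 - p2)))"
    and f_second_diff: "\<forall>r>0. \<exists>\<gamma>>0. \<forall>t\<in>{t0..T}. \<forall>a\<in>A.
      \<forall>z1\<in>cball 0 r. \<forall>y1\<in>cball 0 r. \<forall>z2\<in>cball 0 r. \<forall>y2\<in>cball 0 r.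
      norm (f (t, z1, y1, a) + f (t, z2, y2, a)
            - 2 *\<^sub>R f (t, (1/2) *\<^sub>R (z1 + z2), (1/2) *\<^sub>R (y1 + y2), a))
        \<le> \<gamma> * ((norm (z1 - z2))\<^sup>2 + (norm (y1 - y2))\<^sup>2)"
    and L_second_diff: "\<forall>r>0. \<exists>\<gamma>>0. \<forall>t\<in>{t0..T}. \<forall>a\<in>A.
      \<forall>z1\<in>cball 0 r. \<forall>y1\<in>cball 0 r. \<forall>z2\<in>cball 0 r. \<forall>y2\<in>cball 0 r.
      \<bar>L (t, z1, y1, a) + L (t, z2, y2, a)
            - 2 * L (t, (1/2) *\<^sub>R (z1 + z2), (1/2) *\<^sub>R (y1 + y2), a)\<bar>
        \<le> \<gamma> * ((norm (z1 - z2))\<^sup>2 + (norm (y1 - y2))\<^sup>2)"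
    and tau_second_diff: "\<forall>r>0. \<exists>\<gamma>>0. \<forall>t\<in>{t0..T}. \<forall>z1\<in>cball 0 r. \<forall>z2\<in>cball 0 r.
      \<bar>tau (t, z1) + tau (t, z2) - 2 * tau (t, (1/2) *\<^sub>R (z1 + z2))\<bar> \<le> \<gamma> * (norm (z1 - z2))\<^sup>2"
    and g_differentiable: "\<forall>t\<in>{t0..T}. \<forall>w\<in>Lip_hist tb. \<forall>\<alpha>\<in>controls A t T. \<forall>x.
      is_trajectory f tau tb t T w \<alpha> x \<longrightarrow>
      (\<exists>gz gw. has_X_derivative tb g gz gw (x T, \<lambda>\<theta>. x (T + \<theta>)))"
    and gw_bounded: "\<forall>r>0. \<exists>\<gamma>>0. \<forall>t\<in>{t0..T}. \<forall>w\<in>V_hist tb r. \<forall>\<alpha>\<in>controls A t T. \<forall>x gz gw.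
      is_trajectory f tau tb t T w \<alpha> x \<and> has_X_derivative tb g gz gw (x T, \<lambda>\<theta>. x (T + \<theta>)) \<longrightarrow>
      Linf_norm tb gw \<le> ereal \<gamma>"

end

theory Submission
  imports Defs
begin

text \<open>
  Write \<open>\<eta>\<^sub>i s = s - \<tau>(s, x\<^sub>i s)\<close> for the delayed times and \<open>\<eta> = (\<eta>\<^sub>1 + \<eta>\<^sub>2) / 2\<close>. The monotone delay condition
  gives \<open>\<eta>' \<ge> d > 0\<close> almost everywhere, so a term \<open>\<phi>(\<eta> s)\<close> in a differential inequality contributes
  only \<open>(\<integral> \<phi>) / d\<close>, and the weighted maximum of \<open>exp(-4 B s) |u s|\<close> yields a Gronwall inequality in
  which the delayed values of \<open>u\<close> do no harm. For \<open>u = x\<^sub>1 - x\<^sub>2\<close> and \<open>\<phi> = |w\<^sub>1 - w\<^sub>2|\<close> this is the first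
  estimate.

  For the second one put \<open>u = x\<^sub>1 + x\<^sub>2 - 2 x\<^sub>3\<close> and \<open>D = x\<^sub>1 - x\<^sub>2\<close>. Then
  \<open>x\<^sub>1(\<eta>\<^sub>1) + x\<^sub>2(\<eta>\<^sub>2) - 2 x\<^sub>3(\<eta>\<^sub>3)\<close> is the sum of \<open>u(\<eta>)\<close>, \<open>2 (x\<^sub>3(\<eta>) - x\<^sub>3(\<eta>\<^sub>3))\<close>, \<open>D(\<eta>\<^sub>1) - D(\<eta>)\<close> and the
  second difference \<open>x\<^sub>2(\<eta>\<^sub>1) + x\<^sub>2(\<eta>\<^sub>2) - 2 x\<^sub>2(\<eta>)\<close>, where \<open>|\<eta>\<^sub>1 - \<eta>\<^sub>2| \<le> h\<close> with \<open>h\<close> of the order of the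
  \<open>H\<^sup>1\<close> norm. The third summand is at most \<open>V(\<eta> + h) - V(\<eta> - h)\<close> up to \<open>O(h\<^sup>2)\<close>, with \<open>V\<close> the variation of
  \<open>w\<^sub>1 - w\<^sub>2\<close>, and its integral is of order \<open>h V(0)\<close>. The last summand is \<open>O(h\<^sup>2)\<close> except at times when
  \<open>\<eta>\<close> is within \<open>h\<close> of a kink of \<open>x\<^sub>2\<close>, where it is \<open>O(h)\<close>; there are at most \<open>N + 1\<close> kinks, so these times
  have measure \<open>O(h)\<close>. The indicator function of \<open>|v - p| \<le> h\<close> is replaced by the smooth majorant
  \<open>2 / (1 + ((v - p) / h)\<^sup>2)\<close>.
\<close>

section \<open>Lipschitz functions and differential inequalities\<close>

text \<open>The state equation holds only almost everywhere, so comparisons are made between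
  Lipschitz functions with almost everywhere derivatives. No substitution
  \<open>v = \<eta> s\<close> is performed: an antiderivative \<open>\<Phi>\<close> of
  \<open>\<phi>\<close> is composed with \<open>\<eta>\<close>, and the chain rule bounds the
  derivative of the composition below by \<open>d * \<phi> (\<eta> s)\<close>. For this
  \<open>\<Phi>\<close> must be differentiable at every point that \<open>\<eta>\<close> can reach,
  which an indicator function \<open>\<phi>\<close> would not allow; the smooth majorant has an
  arctangent as antiderivative.

  The obstacle in the second estimate is that the H^1 norm controls the derivative of
  \<open>w1 - w2\<close> only in square mean. An increment of \<open>D\<close> over a length
  \<open>h\<close> inside the history is therefore not pointwise of second order; it becomes so only
  after integration along \<open>\<eta>\<close>. Past the initial time the state equation itself
  makes \<open>D\<close> Lipschitz with a constant of the order of the norm.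

  Kinks are counted for \<open>x2\<close> alone. The averaged history may have more of them, but
  \<open>x3\<close> enters only through its Lipschitz constant. The additional kink is the initial
  time, where history and state equation need not join smoothly.\<close>

lemma right_increasing_imp_le:
  fixes G :: "real \<Rightarrow> real"
  assumes "a \<le> b" and cont: "continuous_on {a..b} G"
    and inc: "\<And>x. \<lbrakk>a \<le> x; x < b\<rbrakk> \<Longrightarrow> \<exists>y\<in>{x<..b}. G x \<le> G y"
  shows "G a \<le> G b"
proof -
  define E where "E = {x\<in>{a..b}. G a \<le> G x}"
  have "closed E"
    unfolding E_def by (intro continuous_closed_preimage_constant continuous_on_closed_Collect_le
        continuous_intros cont)
  moreover have "bounded E" unfolding E_def by (rule bounded_subset[of "{a..b}"]) auto
  ultimately have "compact E" by (simp add: compact_eq_bounded_closed)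
  moreover have "E \<noteq> {}" using \<open>a \<le> b\<close> by (auto simp: E_def)
  ultimately obtain s where s: "s \<in> E" "\<And>x. x \<in> E \<Longrightarrow> x \<le> s"
    using compact_attains_sup[of E] by metis
  \<comment> \<open>\<open>s\<close> is the largest point of the compact set \<open>E\<close>; if it
    lay before \<open>b\<close>, \<open>inc\<close> would supply a larger one.\<close>
  have "s = b"
  proof (rule ccontr)
    assume "s \<noteq> b"
    then obtain y where "y \<in> {s<..b}" "G s \<le> G y" using inc[of s] s(1) by (auto simp: E_def)
    then show False using s(1) s(2)[of y] by (auto simp: E_def)
  qed
  then show ?thesis using s by (simp add: E_def)
qed

text \<open>
  The exceptional null set is covered by an open set \<open>U\<close> of small measure; adding
  \<open>K\<close> times the measure of \<open>U \<inter> [a, x]\<close> makes \<open>g\<close> increase to the right of the points of \<open>U\<close>.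
\<close>

lemma AE_nonneg_derivative_imp_le:
  fixes g :: "real \<Rightarrow> real"
  assumes ab: "a \<le> b" and cont: "continuous_on {a..b} g" and K: "0 \<le> K"
    and low: "\<And>x y. \<lbrakk>a \<le> x; x \<le> y; y \<le> b\<rbrakk> \<Longrightarrow> g x \<le> g y + K * (y - x)"
    and deriv: "AE x in lebesgue. x \<in> {a<..<b} \<longrightarrow> (\<exists>D\<ge>0. (g has_real_derivative D) (at x))"
  shows "g a \<le> g b"
proof (rule field_le_epsilon)
  fix e :: real assume "0 < e"
  \<comment> \<open>The total correction is at most
    \<open>K * \<epsilon> + \<epsilon> * (b - a)\<close>. The added 1 keeps the denominator positive
    when \<open>K = 0\<close> and \<open>a = b\<close>.\<close>
  define \<epsilon> where "\<epsilon> = e / (K + 1 + (b - a))"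
  have \<epsilon>: "0 < \<epsilon>" using \<open>0 < e\<close> K ab by (simp add: \<epsilon>_def)
  obtain N where N: "N \<in> null_sets lebesgue"
    and good: "\<And>x. \<lbrakk>a < x; x < b; x \<notin> N\<rbrakk> \<Longrightarrow> \<exists>D\<ge>0. (g has_real_derivative D) (at x)"
  proof -
    obtain N where N: "{x \<in> space lebesgue. \<not> (x \<in> {a<..<b} \<longrightarrow> (\<exists>D\<ge>0. (g has_real_derivative D) (at x)))} \<subseteq> N"
        "emeasure lebesgue N = 0" "N \<in> sets lebesgue"
      using AE_E[OF deriv] by blast
    show thesis
    proof (rule that[of N])
      show "N \<in> null_sets lebesgue" using N by (intro null_setsI)
      show "\<exists>D\<ge>0. (g has_real_derivative D) (at x)" if "a < x" "x < b" "x \<notin> N" for x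
        using N(1) that by auto
    qed
  qed
  \<comment> \<open>The left end joins the exceptional set, since a derivative is assumed only at
    interior points.\<close>
  have "insert a N \<in> null_sets lebesgue"
    using N by (metis insert_is_Un null_sets.Un negligible_iff_null_sets negligible_sing)
  then obtain U where U: "open U" "insert a N \<subseteq> U" "U - insert a N \<in> lmeasurable"
      "emeasure lebesgue (U - insert a N) < ennreal \<epsilon>"
    using sets_lebesgue_outer_open[of "insert a N" \<epsilon>] \<epsilon> by (metis null_setsD2)
  have Um: "U \<in> sets lebesgue" using U(1) by (simp add: borel_open)
  have UM: "emeasure lebesgue U < ennreal \<epsilon>"
    using U(4) \<open>insert a N \<in> null_sets lebesgue\<close> Um by (simp add: emeasure_Diff_null_set)
  have Ul: "U \<in> lmeasurable" using UM Um by (simp add: fmeasurable_def less_trans[OF _ ennreal_less_top])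
  have Ue: "measure lebesgue U < \<epsilon>"
    using UM Ul \<epsilon> by (simp add: emeasure_eq_measure2 ennreal_less_iff)
  define m where "m x = measure lebesgue (U \<inter> {a..x})" for x
  have mdiff: "m y - m x = measure lebesgue (U \<inter> {x<..y})" if "a \<le> x" "x \<le> y" for x y
  proof -
    have "U \<inter> {a..y} = (U \<inter> {a..x}) \<union> (U \<inter> {x<..y})" using that by auto
    moreover have "measure lebesgue ((U \<inter> {a..x}) \<union> (U \<inter> {x<..y}))
        = measure lebesgue (U \<inter> {a..x}) + measure lebesgue (U \<inter> {x<..y})"
    proof (rule measure_Union)
      have *: "emeasure lebesgue (U \<inter> S) \<noteq> \<infinity>" if "S \<in> sets lebesgue" for S
        using fmeasurableD2[OF fmeasurable_Int_fmeasurable[OF Ul that]] by (metis infinity_ennreal_def)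
      show "emeasure lebesgue (U \<inter> {a..x}) \<noteq> \<infinity>" "emeasure lebesgue (U \<inter> {x<..y}) \<noteq> \<infinity>"
        by (simp_all add: * del: infinity_ennreal_def)
      show "U \<inter> {a..x} \<in> sets lebesgue" "U \<inter> {x<..y} \<in> sets lebesgue"
        by (auto intro!: sets.Int[OF Um])
    qed auto
    ultimately show ?thesis by (simp add: m_def)
  qed
  have m_nonneg: "0 \<le> m y - m x" if "a \<le> x" "x \<le> y" for x y
    using mdiff[OF that] by simp
  have m_le: "m y - m x \<le> y - x" if "a \<le> x" "x \<le> y" for x y
  proof -
    have "measure lebesgue (U \<inter> {x<..y}) \<le> measure lebesgue {x<..y}"
    proof (rule measure_mono_fmeasurable)
      show "{x<..y} \<in> lmeasurable"
        by (rule bounded_set_imp_lmeasurable[OF bounded_subset[of "{x..y}"]]) auto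
    qed (use Um in auto)
    then show ?thesis using mdiff[OF that] that by simp
  qed
  have m_eq: "m y - m x = y - x" if "a \<le> x" "x \<le> y" "{x<..y} \<subseteq> U" for x y
  proof -
    have "U \<inter> {x<..y} = {x<..y}" using that by auto
    then show ?thesis using mdiff[OF that(1,2)] that by simp
  qed
  have "1-lipschitz_on {a..b} m"
  proof (rule lipschitz_on_leI)
    show "dist (m x) (m y) \<le> 1 * dist x y" if "x \<in> {a..b}" "x \<le> y" for x y
      using m_nonneg[of x y] m_le[of x y] that by (simp add: dist_real_def)
  qed simp
  then have mc: "continuous_on {a..b} m" by (rule lipschitz_on_continuous_on)
  \<comment> \<open>Off \<open>U\<close> the derivative \<open>D\<close> of \<open>g\<close> may
    vanish, which says nothing about the sign of increments; the term
    \<open>\<epsilon> * (x - a)\<close> makes the slope strictly positive there.\<close>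
  define G where "G x = g x + K * m x + \<epsilon> * (x - a)" for x
  have "G a \<le> G b"
  proof (rule right_increasing_imp_le[OF ab])
    show "continuous_on {a..b} G" unfolding G_def by (intro continuous_intros cont mc)
  next
    fix x assume x: "a \<le> x" "x < b"
    show "\<exists>y\<in>{x<..b}. G x \<le> G y"
    proof (cases "x \<in> U")
      case True
      then obtain \<delta> where d: "\<delta> > 0" "ball x \<delta> \<subseteq> U" using \<open>open U\<close> openE by blast
      define y where "y = min b (x + \<delta> / 2)"
      have y: "x < y" "y \<le> b" "{x<..y} \<subseteq> U"
        using d x by (auto simp: y_def dist_real_def subset_iff)
      have "G y - G x = g y - g x + K * (m y - m x) + \<epsilon> * (y - x)"
        by (simp add: G_def algebra_simps)
      also have "\<dots> = g y - g x + K * (y - x) + \<epsilon> * (y - x)"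
        using m_eq[of x y] x y by simp
      also have "\<dots> \<ge> 0"
        using low[of x y] x y mult_pos_pos[OF \<epsilon>, of "y - x"] by simp
      finally have "G x \<le> G y" by simp
      then show ?thesis using y by auto
    next
      case False
      then have "x \<notin> N" "x \<noteq> a" using U(2) by auto
      then obtain D where D: "D \<ge> 0" "(g has_real_derivative D) (at x)" using good[of x] x by force
      define h where "h t = g t + \<epsilon> * (t - a)" for t
      have "(h has_real_derivative (D + \<epsilon>)) (at x)"
        unfolding h_def by (auto intro!: derivative_eq_intros D)
      then obtain \<delta> where d: "\<delta> > 0" "\<And>s. \<lbrakk>0 < s; s < \<delta>\<rbrakk> \<Longrightarrow> h x < h (x + s)"
        using DERIV_pos_inc_right[of h "D + \<epsilon>" x] D \<epsilon> by auto
      define y where "y = min b (x + \<delta> / 2)"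
      have y: "x < y" "y \<le> b" using d x by (auto simp: y_def)
      have "h x < h y" using d(2)[of "y - x"] y d(1) by (auto simp: y_def)
      moreover have "K * m x \<le> K * m y"
        using m_nonneg[of x y] x y K by (intro mult_left_mono) auto
      ultimately have "G x \<le> G y" by (simp add: G_def h_def)
      then show ?thesis using y by auto
    qed
  qed
  moreover have "m b \<le> \<epsilon>"
    using measure_mono_fmeasurable[of "U \<inter> {a..b}" U lebesgue] sets.Int[OF Um, of "{a..b}"] Ul Ue
    by (simp add: m_def)
  moreover have "0 \<le> K * m a" using K by (simp add: m_def)
  ultimately have "g a \<le> g b + K * \<epsilon> + \<epsilon> * (b - a)"
    using mult_left_mono[of "m b" \<epsilon> K] K by (simp add: G_def)
  also have "\<dots> \<le> g b + e"
  proof -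
    have "K * \<epsilon> + \<epsilon> * (b - a) \<le> (K + 1 + (b - a)) * \<epsilon>" using \<epsilon> by (simp add: algebra_simps)
    also have "\<dots> = e" using K ab by (simp add: \<epsilon>_def)
    finally show ?thesis by simp
  qed
  finally show "g a \<le> g b + e" .
qed

section \<open>Increments controlled by almost everywhere derivatives\<close>

text \<open>Pairing \<open>u\<close> with the unit vector \<open>e\<close> of its total increment
  makes the problem scalar: \<open>G - e \<bullet> u\<close> has a nonnegative derivative almost
  everywhere. Only a bound on its rate of decrease is required, so monotonicity of \<open>G\<close>
  suffices in place of a Lipschitz condition.\<close>

lemma AE_norm_increment_le:
  fixes u :: "real \<Rightarrow> 'b::euclidean_space"
  assumes ab: "a \<le> b" and u: "K-lipschitz_on {a..b} u"
    and G: "continuous_on {a..b} G" "mono_on {a..b} G"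
    and deriv: "AE x in lebesgue. x \<in> {a<..<b} \<longrightarrow>
      (\<exists>u' G'. (u has_vector_derivative u') (at x) \<and> (G has_real_derivative G') (at x) \<and> norm u' \<le> G')"
  shows "norm (u b - u a) \<le> G b - G a"
proof -
  define e where "e = sgn (u b - u a)"
  have e: "norm e \<le> 1" by (simp add: e_def norm_sgn)
  have K: "0 \<le> K" using u by (rule lipschitz_on_nonneg)
  define g where "g x = G x - e \<bullet> u x" for x
  have "g a \<le> g b"
  proof (rule AE_nonneg_derivative_imp_le[OF ab _ K])
    show "continuous_on {a..b} g"
      unfolding g_def by (intro continuous_intros G lipschitz_on_continuous_on[OF u])
    show "g x \<le> g y + K * (y - x)" if "a \<le> x" "x \<le> y" "y \<le> b" for x y
    proof -
      have "e \<bullet> (u y - u x) \<le> norm e * norm (u y - u x)" by (rule norm_cauchy_schwarz)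
      also have "\<dots> \<le> 1 * norm (u y - u x)" by (rule mult_right_mono[OF e]) simp
      also have "\<dots> \<le> K * (y - x)" using lipschitz_on_normD[OF u, of y x] that by auto
      finally have "e \<bullet> (u y - u x) \<le> K * (y - x)" .
      moreover have "G x \<le> G y" using G(2) that by (auto simp: mono_on_def)
      ultimately show ?thesis by (simp add: g_def inner_diff_right)
    qed
    show "AE x in lebesgue. x \<in> {a<..<b} \<longrightarrow> (\<exists>D\<ge>0. (g has_real_derivative D) (at x))"
      using deriv
    proof (rule AE_mp, intro AE_I2 impI)
      fix x assume *: "x \<in> {a<..<b} \<longrightarrow> (\<exists>u' G'. (u has_vector_derivative u') (at x) \<and>
          (G has_real_derivative G') (at x) \<and> norm u' \<le> G')" and "x \<in> {a<..<b}"
      then obtain u' G' where D: "(u has_vector_derivative u') (at x)"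
          "(G has_real_derivative G') (at x)" "norm u' \<le> G'" by auto
      have "((\<lambda>x. e \<bullet> u x) has_real_derivative e \<bullet> u') (at x)"
        unfolding has_real_derivative_iff_has_vector_derivative
        by (rule bounded_linear.has_vector_derivative[OF bounded_linear_inner_right D(1)])
      then have "(g has_real_derivative G' - e \<bullet> u') (at x)"
        unfolding g_def using D(2) by (rule DERIV_diff[rotated])
      moreover have "e \<bullet> u' \<le> G'"
      proof -
        have "e \<bullet> u' \<le> norm e * norm u'" by (rule norm_cauchy_schwarz)
        also have "\<dots> \<le> 1 * norm u'" by (rule mult_right_mono[OF e]) simp
        finally show ?thesis using D(3) by simp
      qed
      ultimately show "\<exists>D\<ge>0. (g has_real_derivative D) (at x)"
        by (intro exI[of _ "G' - e \<bullet> u'"]) simp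
    qed
  qed
  moreover have "e \<bullet> (u b - u a) = norm (u b - u a)"
    by (cases "u b = u a") (simp_all add: e_def sgn_div_norm dot_square_norm power2_eq_square)
  ultimately show ?thesis by (simp add: g_def inner_diff_right)
qed

text \<open>The constant \<open>K\<close> is qualitative: it guarantees that increments are
  determined by the derivative almost everywhere. The new constant \<open>M\<close> depends only on
  that derivative, which is what makes constants uniform over all trajectories.\<close>

lemma AE_norm_derivative_le_imp_lipschitz:
  fixes u :: "real \<Rightarrow> 'b::euclidean_space"
  assumes u: "K-lipschitz_on {a..b} u" and M: "0 \<le> M"
    and deriv: "AE x in lebesgue. x \<in> {a<..<b} \<longrightarrow>
      (\<exists>u'. (u has_vector_derivative u') (at x) \<and> norm u' \<le> M)"
  shows "M-lipschitz_on {a..b} u"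
proof (rule lipschitz_on_leI[OF _ M])
  fix x y assume xy: "x \<in> {a..b}" "y \<in> {a..b}" "x \<le> y"
  have "norm (u y - u x) \<le> M * y - M * x"
  proof (rule AE_norm_increment_le[OF xy(3), where G="\<lambda>t. M * t"])
    show "K-lipschitz_on {x..y} u" by (rule lipschitz_on_subset[OF u]) (use xy in auto)
    show "continuous_on {x..y} ((*) M)" by (intro continuous_intros)
    show "mono_on {x..y} ((*) M)" using M by (auto intro!: mono_onI mult_left_mono)
    show "AE t in lebesgue. t \<in> {x<..<y} \<longrightarrow> (\<exists>u' G'. (u has_vector_derivative u') (at t) \<and>
        ((*) M has_real_derivative G') (at t) \<and> norm u' \<le> G')"
      using deriv
    proof (rule AE_mp, intro AE_I2 impI)
      fix t assume *: "t \<in> {a<..<b} \<longrightarrow> (\<exists>u'. (u has_vector_derivative u') (at t) \<and> norm u' \<le> M)"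
        and "t \<in> {x<..<y}"
      then obtain u' where "(u has_vector_derivative u') (at t)" "norm u' \<le> M" using xy by auto
      moreover have "((*) M has_real_derivative M) (at t)" by (auto intro!: derivative_eq_intros)
      ultimately show "\<exists>u' G'. (u has_vector_derivative u') (at t) \<and>
        ((*) M has_real_derivative G') (at t) \<and> norm u' \<le> G'" by blast
    qed
  qed
  then show "dist (u x) (u y) \<le> M * dist x y"
    using xy by (simp add: dist_norm norm_minus_commute algebra_simps abs_if)
qed

text \<open>The difference between \<open>u\<close> and a primitive of \<open>q\<close> is Lipschitz
  with zero derivative almost everywhere, hence constant. This turns the almost everywhere state
  equation into a classical one when its right-hand side is continuous.\<close>

lemma AE_derivative_continuous_imp_derivative:
  fixes u :: "real \<Rightarrow> 'b::euclidean_space"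
  assumes u: "K-lipschitz_on {a..b} u" and q: "continuous_on {a<..<b} q"
    and deriv: "AE x in lebesgue. x \<in> {a<..<b} \<longrightarrow> (u has_vector_derivative q x) (at x)"
    and s: "s \<in> {a<..<b}"
  shows "(u has_vector_derivative q s) (at s)"
proof -
  \<comment> \<open>\<open>q\<close> may be unbounded near the ends of the open interval, so the
    primitive is taken on a compact interval around \<open>s\<close>.\<close>
  define c where "c = (a + s) / 2"
  define d where "d = (s + b) / 2"
  have cd: "a < c" "c < s" "s < d" "d < b" using s by (auto simp: c_def d_def)
  have qc: "continuous_on {c..d} q" by (rule continuous_on_subset[OF q]) (use cd in auto)
  define X where "X t = integral {c..t} q" for t
  have Xd: "(X has_vector_derivative q t) (at t within {c..d})" if "t \<in> {c..d}" for t
    unfolding X_def by (rule integral_has_vector_derivative[OF qc that])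
  have Xd': "(X has_vector_derivative q t) (at t)" if "t \<in> {c<..<d}" for t
    using Xd[of t] that at_within_interior[of t "{c..d}"] by (simp add: interior_atLeastAtMost_real)
  obtain M where M: "\<And>t. t \<in> {c..d} \<Longrightarrow> norm (q t) \<le> M"
    using compact_imp_bounded[OF compact_continuous_image[OF qc compact_Icc]]
    unfolding bounded_iff by (metis imageI)
  have "s \<in> {c..d}" using cd by simp
  then have M0: "0 \<le> M" using M norm_ge_zero order_trans by blast
  have Xl: "M-lipschitz_on {c..d} X"
  proof (rule lipschitz_onI[OF _ M0])
    fix x y assume "x \<in> {c..d}" "y \<in> {c..d}"
    then have "norm (X x - X y) \<le> M * norm (x - y)"
      using Xd M by (intro differentiable_bound[of "{c..d}" X "\<lambda>t h. h *\<^sub>R q t"])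
        (auto simp: has_vector_derivative_def intro!: onorm_le simp: mult.commute[of M] mult_left_mono)
    then show "dist (X x) (X y) \<le> M * dist x y" by (simp add: dist_norm)
  qed
  have "(K + M)-lipschitz_on {c..d} (\<lambda>t. u t - X t)"
  proof (rule lipschitz_on_diff[OF _ Xl])
    show "K-lipschitz_on {c..d} u" by (rule lipschitz_on_subset[OF u]) (use cd in auto)
  qed
  then have "0-lipschitz_on {c..d} (\<lambda>t. u t - X t)"
  proof (rule AE_norm_derivative_le_imp_lipschitz)
    show "AE x in lebesgue. x \<in> {c<..<d} \<longrightarrow>
        (\<exists>u'. ((\<lambda>t. u t - X t) has_vector_derivative u') (at x) \<and> norm u' \<le> 0)"
      using deriv
    proof (rule AE_mp, intro AE_I2 impI)
      fix x assume *: "x \<in> {a<..<b} \<longrightarrow> (u has_vector_derivative q x) (at x)" "x \<in> {c<..<d}"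
      then have "((\<lambda>t. u t - X t) has_vector_derivative q x - q x) (at x)"
        using cd by (intro has_vector_derivative_diff Xd') auto
      then show "\<exists>u'. ((\<lambda>t. u t - X t) has_vector_derivative u') (at x) \<and> norm u' \<le> 0" by force
    qed
  qed simp
  then have eq: "u t = X t + (u c - X c)" if "t \<in> {c..d}" for t
    using lipschitz_onD[of 0 "{c..d}" "\<lambda>t. u t - X t" t c] that cd by (simp add: algebra_simps)
  have "((\<lambda>t. X t + (u c - X c)) has_vector_derivative q s) (at s)"
    using has_vector_derivative_add[OF Xd'[of s] has_vector_derivative_const[of "u c - X c"]] cd by simp
  then show ?thesis
  proof (rule has_vector_derivative_transform_within_open)
    show "open {c<..<d}" "s \<in> {c<..<d}" using cd by simp_all
    show "X t + (u c - X c) = u t" if "t \<in> {c<..<d}" for t using eq[of t] that by auto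
  qed
qed

section \<open>Gronwall inequality with delayed values\<close>

text \<open>The earlier time \<open>\<sigma>\<close> is arbitrary: with \<open>S\<close> the maximum
  of the weighted norm, both \<open>u s\<close> and \<open>u \<sigma>\<close> are bounded by
  \<open>S * exp (k * (s - a))\<close>, since the weight increases. Integrating this bound returns
  only half of the maximum, which is absorbed on the left; this is the origin of the factor 2 in the
  conclusion. As \<open>\<Phi>\<close> is evaluated only along \<open>\<eta>\<close>, its
  oscillation \<open>I\<close> is all that remains of \<open>\<phi>\<close>.\<close>

lemma delayed_gronwall:
  fixes u :: "real \<Rightarrow> 'b::euclidean_space" and \<eta> \<phi> \<Phi> :: "real \<Rightarrow> real"
  assumes u: "K-lipschitz_on {a..b} u" and \<eta>: "K'-lipschitz_on {a..b} \<eta>"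
    and B: "0 < B" and c: "0 \<le> c" and d: "0 < d"
    and rng: "\<And>s. s \<in> {a..b} \<Longrightarrow> \<eta> s \<in> {\<alpha>..\<beta>}"
    and \<Phi>: "\<And>v. v \<in> {\<alpha>..\<beta>} \<Longrightarrow> (\<Phi> has_real_derivative \<phi> v) (at v)"
    and \<phi>: "\<And>v. v \<in> {\<alpha>..\<beta>} \<Longrightarrow> 0 \<le> \<phi> v"
    and osc: "\<And>v v'. \<lbrakk>v \<in> {\<alpha>..\<beta>}; v' \<in> {\<alpha>..\<beta>}\<rbrakk> \<Longrightarrow> \<Phi> v - \<Phi> v' \<le> I"
    and deriv: "AE s in lebesgue. s \<in> {a<..<b} \<longrightarrow>
      (\<exists>u' \<eta>' \<sigma>. (u has_vector_derivative u') (at s) \<and> (\<eta> has_real_derivative \<eta>') (at s) \<and>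
        d \<le> \<eta>' \<and> \<sigma> \<in> {a..s} \<and> norm u' \<le> B * (norm (u s) + norm (u \<sigma>)) + c + \<phi> (\<eta> s))"
    and s: "s \<in> {a..b}"
  shows "norm (u s) \<le> 2 * exp (4 * B * (b - a)) * (norm (u a) + c * (b - a) + I / d)"
proof -
  \<comment> \<open>The derivative of \<open>S / 2 * exp (k * (t - a))\<close> is then exactly
    \<open>B * (2 * S * exp (k * (t - a)))\<close>, the bound for the two terms in
    \<open>u\<close>.\<close>
  define k where "k = 4 * B"
  have ab: "a \<le> b" using s by simp
  have uc: "continuous_on {a..b} u" by (rule lipschitz_on_continuous_on[OF u])
  have \<eta>c: "continuous_on {a..b} \<eta>" by (rule lipschitz_on_continuous_on[OF \<eta>])
  have \<eta>mono: "\<eta> x \<le> \<eta> y" if "a \<le> x" "x \<le> y" "y \<le> b" for x y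
  proof (rule AE_nonneg_derivative_imp_le[OF that(2), where K=K'])
    show "continuous_on {x..y} \<eta>" by (rule continuous_on_subset[OF \<eta>c]) (use that in auto)
    show "0 \<le> K'" by (rule lipschitz_on_nonneg[OF \<eta>])
    show "\<eta> v \<le> \<eta> w + K' * (w - v)" if "x \<le> v" "v \<le> w" "w \<le> y" for v w
      using lipschitz_on_normD[OF \<eta>, of v w] that \<open>a \<le> x\<close> \<open>y \<le> b\<close> by auto
    show "AE v in lebesgue. v \<in> {x<..<y} \<longrightarrow> (\<exists>D\<ge>0. (\<eta> has_real_derivative D) (at v))"
      using deriv
    proof (rule AE_mp, intro AE_I2 impI)
      fix v assume *: "v \<in> {a<..<b} \<longrightarrow>
        (\<exists>u' \<eta>' \<sigma>. (u has_vector_derivative u') (at v) \<and> (\<eta> has_real_derivative \<eta>') (at v) \<and>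
        d \<le> \<eta>' \<and> \<sigma> \<in> {a..v} \<and> norm u' \<le> B * (norm (u v) + norm (u \<sigma>)) + c + \<phi> (\<eta> v))"
        and v: "v \<in> {x<..<y}"
      then obtain \<eta>' where "(\<eta> has_real_derivative \<eta>') (at v)" "d \<le> \<eta>'" using \<open>a \<le> x\<close> \<open>y \<le> b\<close> by auto
      then show "\<exists>D\<ge>0. (\<eta> has_real_derivative D) (at v)" using d by (intro exI[of _ \<eta>']) auto
    qed
  qed
  have \<Phi>mono: "\<Phi> v \<le> \<Phi> w" if "v \<in> {\<alpha>..\<beta>}" "w \<in> {\<alpha>..\<beta>}" "v \<le> w" for v w
    by (rule DERIV_nonneg_imp_nondecreasing[OF that(3)])
      (use that \<Phi> \<phi> in \<open>meson atLeastAtMost_iff order_trans\<close>)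
  define p where "p t = exp (- k * (t - a)) * norm (u t)" for t
  have "continuous_on {a..b} p" unfolding p_def by (intro continuous_intros uc)
  then obtain t0 where t0: "t0 \<in> {a..b}" "\<And>t. t \<in> {a..b} \<Longrightarrow> p t \<le> p t0"
    using continuous_attains_sup[of "{a..b}" p] ab by auto
  define S where "S = p t0"
  have S0: "0 \<le> S" by (simp add: S_def p_def)
  have uS: "norm (u t) \<le> S * exp (k * (t - a))" if "t \<in> {a..b}" for t
  proof -
    have "norm (u t) = p t * exp (k * (t - a))" by (simp add: p_def mult_exp_exp)
    also have "\<dots> \<le> S * exp (k * (t - a))"
      unfolding S_def by (intro mult_right_mono t0(2) that) simp
    finally show ?thesis .
  qed
  define G where "G t = S / 2 * exp (k * (t - a)) + c * (t - a) + \<Phi> (\<eta> t) / d" for t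
  have "norm (u t0 - u a) \<le> G t0 - G a"
  proof (rule AE_norm_increment_le)
    show "a \<le> t0" using t0 by simp
    show "K-lipschitz_on {a..t0} u" by (rule lipschitz_on_subset[OF u]) (use t0 in auto)
    have "continuous_on {\<alpha>..\<beta>} \<Phi>"
      by (rule DERIV_continuous_on[of _ _ \<phi>]) (rule has_field_derivative_at_within[OF \<Phi>])
    then have "continuous_on {a..t0} (\<lambda>t. \<Phi> (\<eta> t))"
      by (rule continuous_on_compose2[OF _ continuous_on_subset[OF \<eta>c]]) (use t0 rng in auto)
    then show "continuous_on {a..t0} G" unfolding G_def using d by (intro continuous_intros) auto
    show "mono_on {a..t0} G"
    proof (rule mono_onI)
      fix x y assume xy: "x \<in> {a..t0}" "y \<in> {a..t0}" "x \<le> y"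
      have "S / 2 * exp (k * (x - a)) \<le> S / 2 * exp (k * (y - a))"
        using xy S0 B by (intro mult_left_mono) (auto simp: k_def)
      moreover have "c * (x - a) \<le> c * (y - a)" using xy c by (intro mult_left_mono) auto
      moreover have "\<Phi> (\<eta> x) / d \<le> \<Phi> (\<eta> y) / d"
        using xy t0 rng d by (intro divide_right_mono \<Phi>mono \<eta>mono) auto
      ultimately show "G x \<le> G y" by (simp add: G_def)
    qed
    show "AE t in lebesgue. t \<in> {a<..<t0} \<longrightarrow> (\<exists>u' G'. (u has_vector_derivative u') (at t) \<and>
        (G has_real_derivative G') (at t) \<and> norm u' \<le> G')"
      using deriv
    proof (rule AE_mp, intro AE_I2 impI)
      fix t assume *: "t \<in> {a<..<b} \<longrightarrow>
        (\<exists>u' \<eta>' \<sigma>. (u has_vector_derivative u') (at t) \<and> (\<eta> has_real_derivative \<eta>') (at t) \<and>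
        d \<le> \<eta>' \<and> \<sigma> \<in> {a..t} \<and> norm u' \<le> B * (norm (u t) + norm (u \<sigma>)) + c + \<phi> (\<eta> t))"
        and t: "t \<in> {a<..<t0}"
      then obtain u' \<eta>' \<sigma> where D: "(u has_vector_derivative u') (at t)"
        "(\<eta> has_real_derivative \<eta>') (at t)" "d \<le> \<eta>'" "\<sigma> \<in> {a..t}"
        "norm u' \<le> B * (norm (u t) + norm (u \<sigma>)) + c + \<phi> (\<eta> t)" using t0 by auto
      have rt: "\<eta> t \<in> {\<alpha>..\<beta>}" using t t0 rng by auto
      define G' where "G' = S / 2 * (exp (k * (t - a)) * k) + c + \<phi> (\<eta> t) * \<eta>' / d"
      have "((\<lambda>t. \<Phi> (\<eta> t)) has_real_derivative \<phi> (\<eta> t) * \<eta>') (at t)"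
        by (rule DERIV_chain2[OF \<Phi>[OF rt] D(2)])
      then have "(G has_real_derivative G') (at t)"
        unfolding G_def G'_def using d by (auto intro!: derivative_eq_intros)
      moreover have "norm u' \<le> G'"
      proof -
        have "norm (u \<sigma>) \<le> S * exp (k * (\<sigma> - a))" by (rule uS) (use D(4) t t0 in auto)
        also have "\<dots> \<le> S * exp (k * (t - a))"
          using D(4) S0 B by (intro mult_left_mono) (auto simp: k_def)
        finally have "norm (u t) + norm (u \<sigma>) \<le> 2 * S * exp (k * (t - a))"
          using uS[of t] t t0 by simp
        then have "B * (norm (u t) + norm (u \<sigma>)) \<le> B * (2 * S * exp (k * (t - a)))"
          using B by (intro mult_left_mono) auto
        moreover have "\<phi> (\<eta> t) * d \<le> \<phi> (\<eta> t) * \<eta>'"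
          by (intro mult_left_mono \<phi> rt D)
        \<comment> \<open>The only use of the size of \<open>\<eta>'\<close>: it pays for the
          division by \<open>d\<close> in \<open>G\<close>.\<close>
        then have "\<phi> (\<eta> t) \<le> \<phi> (\<eta> t) * \<eta>' / d" using d by (simp add: field_simps)
        ultimately show ?thesis using D(5) by (simp add: G'_def k_def algebra_simps)
      qed
      ultimately show "\<exists>u' G'. (u has_vector_derivative u') (at t) \<and>
        (G has_real_derivative G') (at t) \<and> norm u' \<le> G'" using D(1) by blast
    qed
  qed
  moreover have "G t0 - G a = S / 2 * exp (k * (t0 - a)) - S / 2 + c * (t0 - a)
      + (\<Phi> (\<eta> t0) - \<Phi> (\<eta> a)) / d"
    by (simp add: G_def diff_divide_distrib)
  moreover have "(\<Phi> (\<eta> t0) - \<Phi> (\<eta> a)) / d \<le> I / d"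
    using d t0 ab by (intro divide_right_mono osc rng) auto
  moreover have "c * (t0 - a) \<le> c * (b - a)" using t0 c by (intro mult_left_mono) auto
  moreover have "norm (u t0) \<le> norm (u a) + norm (u t0 - u a)"
    by (metis norm_triangle_sub)
  moreover have "norm (u t0) = S * exp (k * (t0 - a))"
    by (simp add: S_def p_def mult_exp_exp)
  moreover define Q where "Q = norm (u a) + c * (b - a) + I / d"
  ultimately have *: "S / 2 * exp (k * (t0 - a)) \<le> Q" using S0 by simp
  \<comment> \<open>The weight at the maximal point is dropped to isolate \<open>S\<close>; at a
    general \<open>s\<close> it comes back as the exponential factor.\<close>
  have "1 \<le> exp (k * (t0 - a))" using t0 B by (simp add: k_def)
  then have "S / 2 * 1 \<le> S / 2 * exp (k * (t0 - a))" using S0 by (intro mult_left_mono) auto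
  then have SQ: "S \<le> 2 * Q" using * by simp
  have "norm (u s) \<le> S * exp (k * (s - a))" by (rule uS[OF s])
  also have "\<dots> \<le> 2 * Q * exp (k * (b - a))"
    using SQ S0 s B by (intro mult_mono) (auto simp: k_def)
  also have "\<dots> = 2 * exp (4 * B * (b - a)) * (norm (u a) + c * (b - a) + I / d)"
    unfolding Q_def k_def by (simp only: mult_ac)
  finally show ?thesis .
qed

text \<open>A primitive on the whole line has two-sided derivatives also at the ends of the range of
  \<open>\<eta>\<close>, as \<open>delayed_gronwall\<close> demands.\<close>

lemma continuous_imp_antiderivative:
  fixes f :: "real \<Rightarrow> real"
  assumes "continuous_on UNIV f"
  obtains F where "\<And>v. (F has_real_derivative f v) (at v)"
proof -
  have "\<exists>F. \<forall>x::real. -\<infinity> < ereal x \<longrightarrow> ereal x < \<infinity> \<longrightarrow> (F has_vector_derivative f x) (at x)"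
    using assms by (intro einterval_antiderivative) (auto simp: continuous_on_eq_continuous_at)
  then show thesis
    using that by (auto simp: has_real_derivative_iff_has_vector_derivative)
qed

text \<open>The symmetric sum \<open>y t = x (a + t) + x (a - t)\<close> has derivative
  \<open>q (a + t) - q (a - t)\<close>, of size at most \<open>2 * K * t\<close>, so the mean value
  theorem gives a second power of \<open>e\<close>. Derivatives are taken only in the open interval,
  hence kinks may sit at its ends.\<close>

lemma second_difference_le:
  fixes x :: "real \<Rightarrow> 'b::euclidean_space"
  assumes e: "0 \<le> e" and cont: "continuous_on {a - e..a + e} x"
    and deriv: "\<And>t. t \<in> {a - e<..<a + e} \<Longrightarrow> (x has_vector_derivative q t) (at t)"
    and q: "K-lipschitz_on {a - e<..<a + e} q"
  shows "norm (x (a + e) + x (a - e) - 2 *\<^sub>R x a) \<le> 2 * K * e\<^sup>2"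
proof (cases "e = 0")
  case True
  then show ?thesis by (simp add: scaleR_2)
next
  case False
  then have e: "0 < e" using e by simp
  define y where "y t = x (a + t) + x (a - t)" for t
  have "\<exists>t\<in>{0<..<e}. norm (y e - y 0) \<le> norm ((e - 0) *\<^sub>R (q (a + t) - q (a - t)))"
  proof (rule mvt_general[OF e])
    show "continuous_on {0..e} y" unfolding y_def
      by (intro continuous_intros continuous_on_compose2[OF cont]) auto
    fix t assume t: "0 < t" "t < e"
    have "((x \<circ> (\<lambda>t. a + t)) has_vector_derivative 1 *\<^sub>R q (a + t)) (at t)"
      by (rule vector_diff_chain_at)
        (use t in \<open>auto intro!: derivative_eq_intros deriv\<close>)
    moreover have "((x \<circ> (\<lambda>t. a - t)) has_vector_derivative (- 1) *\<^sub>R q (a - t)) (at t)"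
      by (rule vector_diff_chain_at)
        (use t in \<open>auto intro!: derivative_eq_intros deriv\<close>)
    ultimately have "(y has_vector_derivative (1 *\<^sub>R q (a + t) + (- 1) *\<^sub>R q (a - t))) (at t)"
      unfolding y_def o_def by (rule has_vector_derivative_add)
    then show "(y has_derivative (\<lambda>h. h *\<^sub>R (q (a + t) - q (a - t)))) (at t)"
      by (simp add: has_vector_derivative_def)
  qed
  then obtain t where t: "0 < t" "t < e" "norm (y e - y 0) \<le> e * norm (q (a + t) - q (a - t))"
    using e by auto
  have "norm (q (a + t) - q (a - t)) \<le> K * norm ((a + t) - (a - t))"
    by (rule lipschitz_on_normD[OF q]) (use t in auto)
  also have "\<dots> = K * (2 * t)" using t by simp
  also have "\<dots> \<le> K * (2 * e)" using t lipschitz_on_nonneg[OF q] by (intro mult_left_mono) auto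
  finally have "e * norm (q (a + t) - q (a - t)) \<le> e * (K * (2 * e))"
    using e by (intro mult_left_mono) auto
  then show ?thesis
    using t(3) by (simp add: y_def scaleR_2 power2_eq_square algebra_simps)
qed

section \<open>Histories\<close>

lemma AE_lebesgue_on_Icc_iff:
  fixes a b :: real
  shows "(AE x in lebesgue_on {a..b}. P x) \<longleftrightarrow> (AE x in lebesgue. x \<in> {a<..<b} \<longrightarrow> P x)"
proof -
  have "(AE x in lebesgue_on {a..b}. P x) \<longleftrightarrow> (AE x in lebesgue. x \<in> {a..b} \<longrightarrow> P x)"
    by (rule AE_restrict_space_iff) simp
  also have "\<dots> \<longleftrightarrow> (AE x in lebesgue. x \<in> {a<..<b} \<longrightarrow> P x)"
  proof
    assume "AE x in lebesgue. x \<in> {a<..<b} \<longrightarrow> P x"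
    moreover have "{a, b} \<in> null_sets lebesgue"
      using negligible_finite[of "{a, b}"] by (simp add: negligible_iff_null_sets)
    then have "AE x in lebesgue. x \<notin> {a, b}" by (rule AE_not_in)
    ultimately show "AE x in lebesgue. x \<in> {a..b} \<longrightarrow> P x" by eventually_elim auto
  qed auto
  finally show ?thesis .
qed

lemma AE_lebesgue_on_Ioo_iff:
  fixes a b :: real
  shows "(AE x in lebesgue_on {a<..<b}. P x) \<longleftrightarrow> (AE x in lebesgue. x \<in> {a<..<b} \<longrightarrow> P x)"
  by (rule AE_restrict_space_iff) simp

text \<open>The points of the open interval violating the bound form an open null set, hence none
  exist; the ends follow by closure. The nonempty interior is essential, which is why
  \<open>a < b\<close>.\<close>

lemma AE_norm_le_imp_norm_le:
  fixes u :: "real \<Rightarrow> 'b::real_normed_vector"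
  assumes "a < b" and u: "continuous_on {a..b} u"
    and AE: "AE x in lebesgue_on {a..b}. norm (u x) \<le> r" and x: "x \<in> {a..b}"
  shows "norm (u x) \<le> r"
proof -
  define N where "N = {x \<in> {a<..<b}. norm (u x) \<in> {r<..}}"
  have "N \<in> null_sets lebesgue"
  proof -
    have "AE x in lebesgue. x \<notin> N"
      using AE unfolding AE_lebesgue_on_Icc_iff by eventually_elim (auto simp: N_def)
    then obtain N' where "{x \<in> space lebesgue. \<not> x \<notin> N} \<subseteq> N'" "emeasure lebesgue N' = 0" "N' \<in> sets lebesgue"
      by (rule AE_E)
    then have "N \<subseteq> N'" "negligible N'" by (auto simp: negligible_iff_null_sets)
    then show ?thesis by (metis negligible_subset negligible_iff_null_sets)
  qed
  moreover have "open N"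
  proof -
    have "open ({a<..<b} \<inter> (\<lambda>x. norm (u x)) -` {r<..})"
      by (rule continuous_open_preimage) (auto intro!: continuous_intros continuous_on_subset[OF u])
    then show ?thesis by (simp add: N_def vimage_def Int_def)
  qed
  ultimately have "N = {}"
    using open_not_negligible[of N] by (auto simp: negligible_iff_null_sets)
  then have *: "\<forall>x\<in>{a<..<b}. norm (u x) \<le> r" by (auto simp: N_def)
  have "closure {a<..<b} = {a..b}" using \<open>a < b\<close> by simp
  then show ?thesis
    using continuous_on_closure_norm_le[of "{a<..<b}" u r x] u * x by simp
qed

lemma finite_imp_AE_notin:
  fixes E :: "'a::euclidean_space set"
  assumes "finite E"
  shows "AE x in lebesgue. x \<notin> E"
  using negligible_finite[OF assms] by (intro AE_not_in) (simp add: negligible_iff_null_sets)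

lemma hist_deriv_eq:
  assumes "(w has_vector_derivative D) (at \<theta>)" "\<theta> \<in> {-tb<..<0}"
  shows "hist_deriv tb w \<theta> = D"
proof -
  have "at \<theta> within {-tb..0} = at \<theta>"
    by (rule at_within_interior) (use assms(2) in \<open>simp add: interior_atLeastAtMost_real\<close>)
  then show ?thesis unfolding hist_deriv_def using assms(1) by (simp add: vector_derivative_at)
qed

lemma smooth_point_has_vector_derivative:
  assumes "\<theta> \<in> {-tb<..<0}" "\<theta> \<notin> nonsmooth_points tb w"
  shows "(w has_vector_derivative hist_deriv tb w \<theta>) (at \<theta>)"
proof -
  have "w differentiable (at \<theta>)"
    using assms by (auto simp: nonsmooth_points_def C11_with_def)
  then have "(w has_vector_derivative vector_derivative w (at \<theta>)) (at \<theta>)"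
    by (simp add: vector_derivative_works)
  then show ?thesis using hist_deriv_eq assms(1) by metis
qed

lemma breakpoint_interval:
  fixes \<theta> :: "nat \<Rightarrow> real"
  assumes "\<theta> 0 \<le> x" "x < \<theta> k"
  shows "\<exists>j<k. \<theta> j \<le> x \<and> x < \<theta> (Suc j)"
  using assms(2)
proof (induction k)
  case 0
  then show ?case using assms(1) by simp
next
  case (Suc k)
  then show ?case by (cases "x < \<theta> k") (auto intro: less_SucI)
qed

text \<open>A point strictly between consecutive breakpoints has a neighbourhood within one smooth
  piece, so nonsmooth points are breakpoints. Finiteness matters because \<open>card\<close> of an
  infinite set is 0, which would make the bound in \<open>WN_hist\<close> say nothing.\<close>

lemma finite_nonsmooth_points:
  assumes "w \<in> W_hist tb r"
  shows "finite (nonsmooth_points tb w)"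
proof -
  obtain k \<theta> where \<theta>: "\<theta> 0 = -tb" "\<theta> k = 0"
    "\<And>j. j < k \<Longrightarrow> \<theta> j < \<theta> (Suc j) \<and> C11_with tb r {\<theta> j<..<\<theta> (Suc j)} w"
    using assms by (auto simp: W_hist_def)
  have range: "-tb \<le> \<theta> j \<and> \<theta> j \<le> 0" if "j \<le> k" for j
  proof
    show "-tb \<le> \<theta> j" using that
    proof (induction j)
      case (Suc j)
      then show ?case using \<theta>(3)[of j] by simp
    qed (simp add: \<theta>)
    show "\<theta> j \<le> 0" using that
    proof (induction j rule: inc_induct)
      case (step j)
      then show ?case using \<theta>(3)[of j] by simp
    qed (simp add: \<theta>)
  qed
  have "nonsmooth_points tb w \<subseteq> \<theta> ` {..k}"
  proof
    fix x assume x: "x \<in> nonsmooth_points tb w"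
    then have "-tb < x" "x < 0" by (auto simp: nonsmooth_points_def)
    then obtain j where j: "j < k" "\<theta> j \<le> x" "x < \<theta> (Suc j)"
      using breakpoint_interval[of \<theta> x k] \<theta> by auto
    show "x \<in> \<theta> ` {..k}"
    proof (rule ccontr)
      assume "x \<notin> \<theta> ` {..k}"
      then have "x \<noteq> \<theta> j" using j by auto
      then have "\<theta> j < x" using j by simp
      define e where "e = min (x - \<theta> j) (\<theta> (Suc j) - x)"
      have "{x - e<..<x + e} \<subseteq> {\<theta> j<..<\<theta> (Suc j)}" by (auto simp: e_def)
      moreover have "0 < e" using \<open>\<theta> j < x\<close> j by (simp add: e_def)
      moreover have "{\<theta> j<..<\<theta> (Suc j)} \<subseteq> {-tb<..<0}"
        using range[of j] range[of "Suc j"] j by auto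
      moreover have "C11_with tb r {\<theta> j<..<\<theta> (Suc j)} w" using \<theta>(3) j by simp
      ultimately have "0 < e \<and> {x - e<..<x + e} \<subseteq> {-tb<..<0} \<and> C11_with tb r {x - e<..<x + e} w"
        unfolding C11_with_def by (meson lipschitz_on_subset subset_iff)
      then show False using x unfolding nonsmooth_points_def by blast
    qed
  qed
  then show ?thesis by (rule finite_subset) simp
qed

text \<open>A breakpoint of the chosen partition may lie in the interval without being a nonsmooth
  point, and near it smoothness is known only with some constant. That constant serves for
  continuity of the derivative alone; the constant \<open>r\<close> of the pieces then carries over
  across such breakpoints.\<close>

lemma hist_deriv_lipschitz_on_smooth_interval:
  assumes w: "w \<in> W_hist tb r" and r: "0 \<le> r"
    and sub: "{p<..<q} \<subseteq> {-tb<..<0}" and smooth: "{p<..<q} \<inter> nonsmooth_points tb w = {}"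
  shows "r-lipschitz_on {p<..<q} (hist_deriv tb w)"
proof -
  obtain k \<theta> where \<theta>: "\<theta> 0 = -tb" "\<theta> k = 0"
    "\<And>j. j < k \<Longrightarrow> \<theta> j < \<theta> (Suc j) \<and> C11_with tb r {\<theta> j<..<\<theta> (Suc j)} w"
    using w by (auto simp: W_hist_def)
  have cont: "continuous_on {p<..<q} (hist_deriv tb w)"
  proof (rule continuous_at_imp_continuous_on, rule ballI)
    fix x assume x: "x \<in> {p<..<q}"
    then have "x \<notin> nonsmooth_points tb w" "x \<in> {-tb<..<0}" using smooth sub by auto
    then obtain e K where e: "e > 0" "C11_with tb K {x - e<..<x + e} w"
      unfolding nonsmooth_points_def by auto
    then have "continuous_on {x - e<..<x + e} (hist_deriv tb w)"
      by (auto simp: C11_with_def intro: lipschitz_on_continuous_on)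
    then show "isCont (hist_deriv tb w) x"
      using e(1) by (simp add: continuous_on_eq_continuous_at)
  qed
  have *: "dist (hist_deriv tb w v) (hist_deriv tb w u) \<le> r * (v - u)"
    if uv: "u \<in> {p<..<q}" "v \<in> {p<..<q}" "u \<le> v" for u v
  proof (rule locally_lipschitz_imp_lipschitz_aux[OF uv(3)])
    show "continuous_on {u..v} (hist_deriv tb w)"
      by (rule continuous_on_subset[OF cont]) (use uv in auto)
    fix x assume x: "x \<in> {u..<v}"
    then have "x \<in> {p<..<q}" using uv by auto
    then have "x \<in> {-tb<..<0}" using sub by blast
    then obtain j where j: "j < k" "\<theta> j \<le> x" "x < \<theta> (Suc j)"
      using breakpoint_interval[of \<theta> x k] \<theta> by auto
    \<comment> \<open>Even if \<open>x\<close> is the breakpoint \<open>\<theta> j\<close>, the open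
      interval from \<open>x\<close> to \<open>y\<close> lies in one piece; continuity extends the
      bound to the closed interval.\<close>
    define y where "y = min v ((x + \<theta> (Suc j)) / 2)"
    have y: "x < y" "y \<le> v" "y < \<theta> (Suc j)" using x j by (auto simp: y_def min_less_iff_disj)
    have "r-lipschitz_on {x<..<y} (hist_deriv tb w)"
    proof (rule lipschitz_on_subset)
      show "r-lipschitz_on {\<theta> j<..<\<theta> (Suc j)} (hist_deriv tb w)"
        using \<theta>(3)[OF j(1)] by (simp add: C11_with_def)
    qed (use j y in auto)
    moreover have "continuous_on {x..y} (hist_deriv tb w)"
      by (rule continuous_on_subset[OF cont]) (use uv x y in auto)
    ultimately have "r-lipschitz_on {x..y} (hist_deriv tb w)"
      using lipschitz_on_closure[of r "{x<..<y}" "hist_deriv tb w"] y by simp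
    then have "dist (hist_deriv tb w y) (hist_deriv tb w x) \<le> r * dist y x"
      by (rule lipschitz_onD) (use y in auto)
    then show "\<exists>y\<in>{x<..v}. dist (hist_deriv tb w y) (hist_deriv tb w x) \<le> r * (y - x)"
      using y by (intro bexI[of _ y]) (auto simp: dist_real_def)
  qed
  show ?thesis
    by (rule lipschitz_on_leI[OF _ r]) (use * in \<open>auto simp: dist_commute dist_real_def\<close>)
qed

section \<open>Pointwise consequences of norm bounds on histories\<close>

lemma Linf_norm_le_imp_AE:
  assumes "Linf_norm tb w \<le> ereal r"
  shows "AE \<theta> in lebesgue_on {-tb..0}. norm (w \<theta>) \<le> r"
proof -
  have "AE \<theta> in lebesgue_on {-tb..0}. ereal (norm (w \<theta>)) \<le> Linf_norm tb w"
    unfolding Linf_norm_def by (rule esssup_AE)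
  then show ?thesis
  proof eventually_elim
    case (elim \<theta>)
    then have "ereal (norm (w \<theta>)) \<le> ereal r" using assms by (rule order_trans)
    then show ?case by simp
  qed
qed

lemma W_hist_AE_hist_deriv_le:
  assumes "w \<in> W_hist tb r"
  shows "AE \<theta> in lebesgue_on {-tb..0}. norm (hist_deriv tb w \<theta>) \<le> r"
  using assms by (intro Linf_norm_le_imp_AE) (simp add: W_hist_def V_hist_def)

text \<open>Both essential bounds become pointwise: the one on \<open>w\<close> by continuity, the
  one on its derivative because \<open>w\<close> is differentiable off a finite set.\<close>

lemma W_hist_bounds:
  assumes w: "w \<in> W_hist tb r" and tb: "0 < tb" and r: "0 \<le> r"
  shows "\<theta> \<in> {-tb..0} \<Longrightarrow> norm (w \<theta>) \<le> r" and "r-lipschitz_on {-tb..0} w"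
proof -
  obtain K where K: "K-lipschitz_on {-tb..0} w"
    using w by (auto simp: W_hist_def V_hist_def P_hist_def Lip_hist_def)
  have AE: "AE \<theta> in lebesgue_on {-tb..0}. norm (w \<theta>) \<le> r"
    using w by (intro Linf_norm_le_imp_AE) (simp add: W_hist_def V_hist_def P_hist_def)
  show "norm (w \<theta>) \<le> r" if "\<theta> \<in> {-tb..0}"
    by (rule AE_norm_le_imp_norm_le[OF _ lipschitz_on_continuous_on[OF K] AE that]) (use tb in simp)
  show "r-lipschitz_on {-tb..0} w"
  proof (rule AE_norm_derivative_le_imp_lipschitz[OF K r])
    show "AE x in lebesgue. x \<in> {-tb<..<0} \<longrightarrow> (\<exists>u'. (w has_vector_derivative u') (at x) \<and> norm u' \<le> r)"
      using W_hist_AE_hist_deriv_le[OF w, unfolded AE_lebesgue_on_Icc_iff]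
        finite_imp_AE_notin[OF finite_nonsmooth_points[OF w]]
      by eventually_elim (use smooth_point_has_vector_derivative[of _ tb w] in blast)
  qed
qed

lemma integrable_lebesgue_on_Icc_bounded:
  fixes g :: "real \<Rightarrow> 'b::euclidean_space"
  assumes "g \<in> borel_measurable (lebesgue_on {a..b})"
    and "AE x in lebesgue_on {a..b}. norm (g x) \<le> K"
  shows "integrable (lebesgue_on {a..b}) g"
  by (rule finite_measure.integrable_const_bound[OF finite_measure_lebesgue_on assms(2,1)]) simp

text \<open>Young's inequality \<open>2 * norm (g x) \<le> (norm (g x))\<^sup>2 / \<epsilon> +
  \<epsilon>\<close> is integrated over a length \<open>tb\<close>. It produces the factor
  \<open>(1 + tb) / 2\<close> and is the reason for a positive bound \<open>\<epsilon>\<close> in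
  place of the norm.\<close>

lemma L1_norm_le_L2_norm:
  fixes g :: "real \<Rightarrow> 'b::euclidean_space"
  assumes g: "g \<in> borel_measurable (lebesgue_on {-tb..0})"
    and bd: "AE x in lebesgue_on {-tb..0}. norm (g x) \<le> K"
    and \<epsilon>: "0 < \<epsilon>" "L2_norm tb g \<le> \<epsilon>" and tb: "0 < tb"
  shows "L1_norm tb g \<le> (1 + tb) / 2 * \<epsilon>"
proof -
  let ?M = "lebesgue_on {-tb..0}"
  have "AE x in ?M. norm ((norm (g x))\<^sup>2) \<le> K\<^sup>2"
    using bd by eventually_elim (simp add: power_mono)
  then have i2: "integrable ?M (\<lambda>x. (norm (g x))\<^sup>2)"
    by (intro integrable_lebesgue_on_Icc_bounded) (use g in measurable)
  have i0: "integrable ?M (\<lambda>x. \<epsilon>)" by (intro integrable_lebesgue_on_Icc_bounded[where K=\<epsilon>]) (use \<epsilon> in auto)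
  have "L1_norm tb g \<le> integral\<^sup>L ?M (\<lambda>x. ((norm (g x))\<^sup>2 / \<epsilon> + \<epsilon>) / 2)"
    unfolding L1_norm_def
  proof (rule integral_mono)
    show "integrable ?M (\<lambda>x. norm (g x))"
      using integrable_lebesgue_on_Icc_bounded[OF g bd] by (rule integrable_norm)
    show "integrable ?M (\<lambda>x. ((norm (g x))\<^sup>2 / \<epsilon> + \<epsilon>) / 2)" using i2 i0 by simp
    fix x
    have "0 \<le> (norm (g x) - \<epsilon>)\<^sup>2 / \<epsilon>" using \<epsilon> by simp
    also have "\<dots> = (norm (g x))\<^sup>2 / \<epsilon> + \<epsilon> - 2 * norm (g x)"
      using \<epsilon> by (simp add: field_simps power2_eq_square)
    finally show "norm (g x) \<le> ((norm (g x))\<^sup>2 / \<epsilon> + \<epsilon>) / 2" by simp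
  qed
  also have "\<dots> = (integral\<^sup>L ?M (\<lambda>x. (norm (g x))\<^sup>2) / \<epsilon> + integral\<^sup>L ?M (\<lambda>x. \<epsilon>)) / 2"
    using i2 i0 by simp
  also have "integral\<^sup>L ?M (\<lambda>x. \<epsilon>) = tb * \<epsilon>"
    using tb by (simp add: measure_restrict_space)
  also have "integral\<^sup>L ?M (\<lambda>x. (norm (g x))\<^sup>2) \<le> \<epsilon>\<^sup>2"
  proof -
    have "integral\<^sup>L ?M (\<lambda>x. (norm (g x))\<^sup>2) = (L2_norm tb g)\<^sup>2"
      unfolding L2_norm_def by simp
    also have "\<dots> \<le> \<epsilon>\<^sup>2" by (rule power_mono[OF \<epsilon>(2)]) (simp add: L2_norm_def)
    finally show ?thesis .
  qed
  finally show ?thesis using \<epsilon> by (simp add: divide_right_mono power2_eq_square field_simps)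
qed

text \<open>\<open>V\<close> is the integral of the norm of the derivative from \<open>-tb\<close>.
  It dominates increments of \<open>v\<close> by the fundamental theorem, which tolerates the finite
  set \<open>E\<close>, and \<open>V 0\<close> is the L^1 norm of the derivative.\<close>

lemma H1_norm_bounds:
  fixes v :: "real \<Rightarrow> 'b::euclidean_space"
  assumes tb: "0 < tb" and v: "K-lipschitz_on {-tb..0} v" and E: "finite E"
    and diff: "\<And>t. t \<in> {-tb<..<0} - E \<Longrightarrow> (v has_vector_derivative hist_deriv tb v t) (at t)"
    and bd: "AE t in lebesgue_on {-tb..0}. norm (hist_deriv tb v t) \<le> K'"
    and \<epsilon>: "0 < \<epsilon>" "H1_norm tb v \<le> \<epsilon>"
  obtains V where "continuous_on {-tb..0} V" "V (-tb) = 0" "V 0 \<le> (1 + tb) / 2 * \<epsilon>"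
    "\<And>s t. \<lbrakk>-tb \<le> s; s \<le> t; t \<le> 0\<rbrakk> \<Longrightarrow> norm (v t - v s) \<le> V t - V s"
    "\<And>t. t \<in> {-tb..0} \<Longrightarrow> norm (v t) \<le> (1 + tb) / 2 * (1 + 1 / tb) * \<epsilon>"
    "L1_norm tb v \<le> (1 + tb) / 2 * \<epsilon>"
proof -
  let ?M = "lebesgue_on {-tb..0}"
  let ?v' = "hist_deriv tb v"
  have vc: "continuous_on {-tb..0} v" by (rule lipschitz_on_continuous_on[OF v])
  have L2: "L2_norm tb v \<le> \<epsilon>" "L2_norm tb ?v' \<le> \<epsilon>"
  proof -
    have "L2_norm tb v \<le> H1_norm tb v" "L2_norm tb ?v' \<le> H1_norm tb v"
      unfolding H1_norm_def by (intro real_le_rsqrt; simp)+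
    then show "L2_norm tb v \<le> \<epsilon>" "L2_norm tb ?v' \<le> \<epsilon>" using \<epsilon> by auto
  qed
  have FTC: "(?v' has_integral (v t - v s)) {s..t}" if "-tb \<le> s" "s \<le> t" "t \<le> 0" for s t
    by (rule fundamental_theorem_of_calculus_interior_strong[OF E that(2)])
      (use that diff in \<open>auto intro: continuous_on_subset[OF vc]\<close>)
  have v'm: "?v' \<in> borel_measurable ?M"
    using FTC[of "-tb" 0] tb by (intro integrable_imp_measurable) auto
  have vm: "v \<in> borel_measurable ?M"
    by (intro integrable_imp_measurable integrable_continuous_real vc)
  obtain R where R: "\<And>t. t \<in> {-tb..0} \<Longrightarrow> norm (v t) \<le> R"
    using compact_imp_bounded[OF compact_continuous_image[OF vc compact_Icc]]
    unfolding bounded_iff by (metis imageI)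
  have vbd: "AE t in ?M. norm (v t) \<le> R" by (rule AE_I2) (use R in simp)
  have vi: "integrable ?M (\<lambda>t. norm (v t))" and v'i: "integrable ?M (\<lambda>t. norm (?v' t))"
    using integrable_lebesgue_on_Icc_bounded[OF vm vbd] integrable_lebesgue_on_Icc_bounded[OF v'm bd]
    by (auto intro: integrable_norm)
  have nv': "(\<lambda>t. norm (?v' t)) integrable_on {-tb..0}"
    using v'i by (simp add: integrable_on_lebesgue_on)
  have sub: "(\<lambda>t. norm (?v' t)) integrable_on {s..t}" if "-tb \<le> s" "t \<le> 0" for s t
    by (rule integrable_on_subinterval[OF nv']) (use that in auto)
  define V where "V t = integral {-tb..t} (\<lambda>t. norm (?v' t))" for t
  have Vdiff: "norm (v t - v s) \<le> V t - V s" if "-tb \<le> s" "s \<le> t" "t \<le> 0" for s t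
  proof -
    have "V t - V s = integral {s..t} (\<lambda>t. norm (?v' t))"
      using Henstock_Kurzweil_Integration.integral_combine[OF that(1,2), of "\<lambda>t. norm (?v' t)"] sub[of "-tb" t] that
      by (simp add: V_def algebra_simps)
    moreover have "norm (integral {s..t} ?v') \<le> integral {s..t} (\<lambda>t. norm (?v' t))"
      using FTC[OF that] sub[of s t] that by (intro integral_norm_bound_integral) auto
    moreover have "integral {s..t} ?v' = v t - v s" using FTC[OF that] by (rule integral_unique)
    ultimately show ?thesis by simp
  qed
  have V0: "V 0 = L1_norm tb ?v'"
    unfolding V_def L1_norm_def using v'i by (simp add: lebesgue_integral_eq_integral)
  have V0le: "V 0 \<le> (1 + tb) / 2 * \<epsilon>"
    unfolding V0 by (rule L1_norm_le_L2_norm[OF v'm bd \<epsilon>(1) L2(2) tb])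
  have L1: "L1_norm tb v \<le> (1 + tb) / 2 * \<epsilon>"
    by (rule L1_norm_le_L2_norm[OF vm vbd \<epsilon>(1) L2(1) tb])
  have Vmono: "V s \<le> V t" if "-tb \<le> s" "s \<le> t" "t \<le> 0" for s t
    using Vdiff[OF that] norm_ge_zero[of "v t - v s"] by linarith
  have Vz: "V (-tb) = 0" by (simp add: V_def)
  have sup: "norm (v t) \<le> (1 + tb) / 2 * (1 + 1 / tb) * \<epsilon>" if t: "t \<in> {-tb..0}" for t
  proof -
    \<comment> \<open>Averaging this inequality over \<open>s\<close> bounds a value of
      \<open>v\<close> by \<open>V 0\<close> plus the mean of its norm; dividing by the length gives
      the term \<open>1 / tb\<close>.\<close>
    have "norm (v t) \<le> norm (v s) + V 0" if s: "s \<in> {-tb..0}" for s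
    proof -
      have "norm (v t - v s) \<le> V 0"
      proof (cases "s \<le> t")
        case True
        then show ?thesis using Vdiff[of s t] Vmono[of "-tb" s] Vmono[of t 0] s t Vz by simp
      next
        case False
        then show ?thesis
          using Vdiff[of t s] Vmono[of "-tb" t] Vmono[of s 0] s t Vz by (simp add: norm_minus_commute)
      qed
      then show ?thesis using norm_triangle_sub[of "v t" "v s"] by linarith
    qed
    then have "integral\<^sup>L ?M (\<lambda>s. norm (v t) - V 0) \<le> integral\<^sup>L ?M (\<lambda>s. norm (v s))"
      by (intro integral_mono vi) (auto simp: algebra_simps intro!: integrable_lebesgue_on_Icc_bounded)
    then have "tb * (norm (v t) - V 0) \<le> L1_norm tb v"
      using tb by (simp add: measure_restrict_space L1_norm_def)
    then have "norm (v t) \<le> V 0 + L1_norm tb v / tb" using tb by (simp add: field_simps)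
    also have "\<dots> \<le> (1 + tb) / 2 * \<epsilon> + (1 + tb) / 2 * \<epsilon> / tb"
      using tb by (intro add_mono V0le divide_right_mono L1) auto
    also have "\<dots> = (1 + tb) / 2 * (1 + 1 / tb) * \<epsilon>" by (simp add: algebra_simps add_divide_distrib)
    finally show ?thesis .
  qed
  have "continuous_on {-tb..0} V"
    unfolding V_def by (rule indefinite_integral_continuous_1[OF nv'])
  then show thesis by (rule that[OF _ Vz V0le Vdiff sup L1])
qed

text \<open>The infimum is attained: every difference quotient lies below every Lipschitz constant,
  hence below their infimum. The hypothesis keeps the set of constants nonempty.\<close>

lemma lip_const_lipschitz_on:
  assumes "K-lipschitz_on S v"
  shows "(lip_const S v)-lipschitz_on S v"
proof (rule lipschitz_onI)
  have ne: "{K. K-lipschitz_on S v} \<noteq> {}" using assms by auto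
  show "0 \<le> lip_const S v"
    unfolding lip_const_def by (rule cInf_greatest[OF ne]) (auto dest: lipschitz_on_nonneg)
  fix x y assume xy: "x \<in> S" "y \<in> S"
  show "dist (v x) (v y) \<le> lip_const S v * dist x y"
  proof (cases "x = y")
    case False
    then have "0 < dist x y" by simp
    have "dist (v x) (v y) / dist x y \<le> lip_const S v"
      unfolding lip_const_def
    proof (rule cInf_greatest[OF ne])
      fix K assume "K \<in> {K. K-lipschitz_on S v}"
      then have "dist (v x) (v y) \<le> K * dist x y" using xy by (auto dest: lipschitz_onD)
      then show "dist (v x) (v y) / dist x y \<le> K" using \<open>0 < dist x y\<close> by (simp add: field_simps)
    qed
    then show ?thesis using \<open>0 < dist x y\<close> by (simp add: field_simps)
  qed simp
qed

section \<open>Existence for equations with state-dependent delay\<close>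

text \<open>
  Banach's fixed point theorem for bounded continuous \<open>v\<close> with \<open>u s = exp(k (s - c)) v s\<close>; the constraints
  \<open>good\<close> (a fixed Lipschitz constant and an exponential bound) make the delayed evaluation Lipschitz in \<open>u\<close>.
\<close>

lemma delay_ivp_extension:
  fixes F :: "real \<Rightarrow> 'b::euclidean_space \<Rightarrow> 'b \<Rightarrow> 'b" and \<eta> :: "real \<Rightarrow> 'b \<Rightarrow> real"
    and X0 :: "real \<Rightarrow> 'b"
  assumes cT: "c < T" and l: "0 \<le> l" and m: "0 \<le> m" and C: "0 < C" and R0: "0 \<le> R0"
    and Fcont: "continuous_on ({c..T} \<times> UNIV \<times> UNIV) (\<lambda>(s, z, y). F s z y)"
    and Flip: "\<And>s z y z' y'. s \<in> {c..T} \<Longrightarrow>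
      norm (F s z y - F s z' y') \<le> l * (norm (z - z') + norm (y - y'))"
    and Fgrowth: "\<And>s z y. s \<in> {c..T} \<Longrightarrow> norm (F s z y) \<le> C * (1 + norm z + norm y)"
    and \<eta>cont: "continuous_on ({c..T} \<times> UNIV) (\<lambda>(s, z). \<eta> s z)"
    and \<eta>lip: "\<And>s z z'. s \<in> {c..T} \<Longrightarrow> \<bar>\<eta> s z - \<eta> s z'\<bar> \<le> m * norm (z - z')"
    and \<eta>le: "\<And>s z. s \<in> {c..T} \<Longrightarrow> \<eta> s z \<le> s"
    and X0: "K0-lipschitz_on {..c} X0" "\<And>s. s \<le> c \<Longrightarrow> norm (X0 s) \<le> R0"
  obtains X K where "\<And>s. s \<le> c \<Longrightarrow> X s = X0 s" "K-lipschitz_on UNIV X"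
    "\<And>s. s \<in> {c<..<T} \<Longrightarrow> (X has_vector_derivative F s (X s) (X (\<eta> s (X s)))) (at s)"
proof -
  \<comment> \<open>Time is clamped to \<open>{c..T}\<close> so that candidates are functions on the
    whole line, constant after \<open>T\<close>.\<close>
  define q where "q s = max c (min s T)" for s
  have q: "q s \<in> {c..T}" for s using cT by (auto simp: q_def)
  have q_mono: "s \<le> t \<Longrightarrow> q s \<le> q t" for s t by (auto simp: q_def)
  have q_diff: "s \<le> t \<Longrightarrow> q t - q s \<le> t - s" for s t by (auto simp: q_def)
  have q_id: "s \<in> {c..T} \<Longrightarrow> q s = s" for s by (auto simp: q_def)
  have q_c: "s \<le> c \<Longrightarrow> q s = c" for s using cT by (auto simp: q_def)
  \<comment> \<open>The solution of \<open>\<rho>' = 2 * C * (\<rho> + 1)\<close> with value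
    \<open>R0\<close> at \<open>c\<close>. Its slope dominates the growth bound
    \<open>C * (1 + 2 * \<rho>)\<close>, so the constraint
    \<open>norm (u s) \<le> \<rho> (q s)\<close> reproduces itself.\<close>
  define \<rho> where "\<rho> s = (R0 + 1) * exp (2 * C * (s - c)) - 1" for s
  have \<rho>_mono: "s \<le> t \<Longrightarrow> \<rho> s \<le> \<rho> t" for s t
    using C R0 by (auto simp: \<rho>_def intro!: mult_left_mono)
  have \<rho>_c: "\<rho> c = R0" by (simp add: \<rho>_def)
  have \<rho>_ge: "c \<le> s \<Longrightarrow> R0 \<le> \<rho> s" for s using \<rho>_mono[of c s] \<rho>_c by simp
  have \<rho>_deriv: "(\<rho> has_real_derivative 2 * C * (\<rho> s + 1)) (at s within S)" for s S
    unfolding \<rho>_def by (auto intro!: derivative_eq_intros)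
  define M1 where "M1 = C * (1 + 2 * \<rho> T)"
  define M where "M = K0 + M1"
  have M1: "0 \<le> M1" using C R0 \<rho>_ge[of T] cT by (simp add: M1_def)
  have K0: "0 \<le> K0" by (rule lipschitz_on_nonneg[OF X0(1)])
  have M: "0 \<le> M" using K0 M1 by (simp add: M_def)
  \<comment> \<open>One unit stems from the current value, one from the delayed value at a common
    time, and \<open>M * m\<close> from the shift of the delayed time; the final 1 ensures
    positivity.\<close>
  define L where "L = l * (2 + M * m) + 1"
  have L: "0 < L" using l M m by (simp add: L_def add_nonneg_pos)
  \<comment> \<open>With this weight the contraction factor is 1/2 on all of \<open>{c..T}\<close>,
    so the interval need not be subdivided.\<close>
  define k where "k = 2 * L"
  define e where "e s = exp (k * (q s - c))" for s
  have e_pos: "0 < e s" for s by (simp add: e_def)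
  have e_ge: "1 \<le> e s" for s using L q[of s] by (simp add: e_def k_def)
  have e_mono: "s \<le> t \<Longrightarrow> e s \<le> e t" for s t using L q_mono by (simp add: e_def k_def)
  have e_cont: "continuous_on S e" for S unfolding e_def q_def by (intro continuous_intros)
  define good where "good u \<longleftrightarrow> (\<forall>s\<le>c. u s = X0 s) \<and> (\<forall>s t. norm (u s - u t) \<le> M * \<bar>s - t\<bar>) \<and>
      (\<forall>s. norm (u s) \<le> \<rho> (q s))" for u :: "real \<Rightarrow> 'b"
  define U where "U v s = e s *\<^sub>R apply_bcontfun v s" for v :: "real \<Rightarrow>\<^sub>C 'b" and s
  define S where "S = {v :: real \<Rightarrow>\<^sub>C 'b. good (U v)}"
  define g where "g u s = F s (u s) (u (\<eta> s (u s)))" for u :: "real \<Rightarrow> 'b" and s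
  define \<Psi> where "\<Psi> u s = X0 (min s c) + integral {c..q s} (g u)" for u s
  have good_cont: "continuous_on A u" if "good u" for u A
  proof -
    have "M-lipschitz_on A u"
      using that M by (intro lipschitz_onI) (auto simp: good_def dist_norm)
    then show ?thesis by (rule lipschitz_on_continuous_on)
  qed
  have g_cont: "continuous_on {c..T} (g u)" if u: "good u" for u
  proof -
    have "continuous_on {c..T} ((\<lambda>(s, z). \<eta> s z) \<circ> (\<lambda>s. (s, u s)))"
      by (intro continuous_on_compose continuous_on_Pair continuous_on_id good_cont[OF u]
          continuous_on_subset[OF \<eta>cont]) auto
    then have "continuous_on {c..T} (\<lambda>s. \<eta> s (u s))" by (simp add: o_def)
    then have "continuous_on {c..T} (\<lambda>s. u (\<eta> s (u s)))"
      by (rule continuous_on_compose2[OF good_cont[OF u, of UNIV]]) auto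
    then have "continuous_on {c..T} ((\<lambda>(s, z, y). F s z y) \<circ> (\<lambda>s. (s, u s, u (\<eta> s (u s)))))"
      by (intro continuous_on_compose continuous_on_Pair continuous_on_id good_cont[OF u]
          continuous_on_subset[OF Fcont]) auto
    then show ?thesis by (simp add: o_def g_def[abs_def])
  qed
  have g_int: "g u integrable_on {a..b}" if "good u" "c \<le> a" "b \<le> T" for u a b
    by (rule integrable_continuous_real[OF continuous_on_subset[OF g_cont[OF that(1)]]])
      (use that in auto)
  have g_bound: "norm (g u s) \<le> C * (1 + 2 * \<rho> s)" if u: "good u" and s: "s \<in> {c..T}" for u s
  proof -
    have "norm (u s) \<le> \<rho> s" using u s q_id[OF s] by (metis good_def)
    moreover have "norm (u (\<eta> s (u s))) \<le> \<rho> s"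
    proof -
      have "norm (u (\<eta> s (u s))) \<le> \<rho> (q (\<eta> s (u s)))" using u by (simp add: good_def)
      also have "\<dots> \<le> \<rho> s"
        using q_mono[OF \<eta>le[OF s, of "u s"]] q_id[OF s] by (intro \<rho>_mono) simp
      finally show ?thesis .
    qed
    ultimately have "C * (1 + norm (u s) + norm (u (\<eta> s (u s)))) \<le> C * (1 + 2 * \<rho> s)"
      using C by (intro mult_left_mono) auto
    then show ?thesis using Fgrowth[OF s, of "u s" "u (\<eta> s (u s))"] by (simp add: g_def)
  qed
  have \<Psi>_good: "good (\<Psi> u)" if u: "good u" for u
    unfolding good_def
  proof (intro conjI allI impI)
    show "\<Psi> u s = X0 s" if "s \<le> c" for s using that by (simp add: \<Psi>_def q_c)
    have le: "norm (\<Psi> u t - \<Psi> u s) \<le> M * (t - s)" if st: "s \<le> t" for s t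
    proof -
      have "integral {c..q s} (g u) + integral {q s..q t} (g u) = integral {c..q t} (g u)"
        by (rule Henstock_Kurzweil_Integration.integral_combine)
          (use q[of s] q[of t] q_mono[OF st] g_int[OF u] in auto)
      then have "\<Psi> u t - \<Psi> u s = (X0 (min t c) - X0 (min s c)) + integral {q s..q t} (g u)"
        by (simp add: \<Psi>_def algebra_simps)
      moreover have "norm (X0 (min t c) - X0 (min s c)) \<le> K0 * (t - s)"
      proof -
        have "norm (X0 (min t c) - X0 (min s c)) \<le> K0 * norm (min t c - min s c)"
          by (rule lipschitz_on_normD[OF X0(1)]) auto
        also have "\<dots> \<le> K0 * (t - s)" using st by (intro mult_left_mono K0) auto
        finally show ?thesis .
      qed
      moreover have "norm (integral {q s..q t} (g u)) \<le> M1 * (t - s)"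
      proof -
        have "norm (integral {q s..q t} (g u)) \<le> M1 * (q t - q s)"
        proof (rule integral_bound)
          show "q s \<le> q t" by (rule q_mono[OF st])
          show "continuous_on {q s..q t} (g u)"
            by (rule continuous_on_subset[OF g_cont[OF u]]) (use q[of s] q[of t] in auto)
          fix \<sigma> assume "\<sigma> \<in> {q s..q t}"
          then have \<sigma>: "\<sigma> \<in> {c..T}" using q[of s] q[of t] by auto
          have "C * (1 + 2 * \<rho> \<sigma>) \<le> M1"
            unfolding M1_def using \<sigma> C by (intro mult_left_mono) (auto intro: \<rho>_mono)
          then show "norm (g u \<sigma>) \<le> M1" using g_bound[OF u \<sigma>] by simp
        qed
        also have "\<dots> \<le> M1 * (t - s)" using q_diff[OF st] by (intro mult_left_mono M1)
        finally show ?thesis .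
      qed
      ultimately show ?thesis
        using norm_triangle_ineq[of "X0 (min t c) - X0 (min s c)" "integral {q s..q t} (g u)"]
        unfolding M_def distrib_right by simp
    qed
    show "norm (\<Psi> u s - \<Psi> u t) \<le> M * \<bar>s - t\<bar>" for s t
    proof (cases "s \<le> t")
      case True
      then show ?thesis using le[OF True] by (simp add: norm_minus_commute)
    next
      case False
      then show ?thesis using le[of t s] by simp
    qed
    show "norm (\<Psi> u s) \<le> \<rho> (q s)" for s
    proof -
      have hi: "((\<lambda>\<sigma>. 2 * C * (\<rho> \<sigma> + 1)) has_integral \<rho> (q s) - \<rho> c) {c..q s}"
        using q[of s] \<rho>_deriv
        by (intro fundamental_theorem_of_calculus)
          (auto simp: has_real_derivative_iff_has_vector_derivative)
      have "norm (integral {c..q s} (g u)) \<le> integral {c..q s} (\<lambda>\<sigma>. 2 * C * (\<rho> \<sigma> + 1))"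
      proof (rule integral_norm_bound_integral)
        show "g u integrable_on {c..q s}" using q[of s] by (intro g_int u) auto
        show "(\<lambda>\<sigma>. 2 * C * (\<rho> \<sigma> + 1)) integrable_on {c..q s}" using hi by blast
        fix \<sigma> assume "\<sigma> \<in> {c..q s}"
        then have "\<sigma> \<in> {c..T}" using q[of s] by auto
        from g_bound[OF u this] show "norm (g u \<sigma>) \<le> 2 * C * (\<rho> \<sigma> + 1)"
          using C by (simp add: algebra_simps)
      qed
      then have "norm (integral {c..q s} (g u)) \<le> \<rho> (q s) - R0"
        unfolding integral_unique[OF hi] \<rho>_c .
      moreover have "norm (X0 (min s c)) \<le> R0" by (rule X0(2)) simp
      ultimately show ?thesis
        using norm_triangle_ineq[of "X0 (min s c)" "integral {c..q s} (g u)"] by (simp add: \<Psi>_def)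
    qed
  qed
  have good_bcontfun: "\<exists>v. U v = u" if u: "good u" for u
  proof -
    have "(\<lambda>s. (1 / e s) *\<^sub>R u s) \<in> bcontfun"
      unfolding bcontfun_def
    proof (intro CollectI conjI)
      show "continuous_on UNIV (\<lambda>s. (1 / e s) *\<^sub>R u s)"
        using e_pos by (intro continuous_intros e_cont good_cont[OF u]) (metis less_irrefl)
      have "norm ((1 / e s) *\<^sub>R u s) \<le> \<rho> T" for s
      proof -
        have "norm ((1 / e s) *\<^sub>R u s) = norm (u s) / e s" using e_pos[of s] by simp
        also have "\<dots> \<le> norm (u s) / 1" using e_ge[of s] by (intro divide_left_mono) auto
        also have "\<dots> \<le> \<rho> T"
          using u \<rho>_mono[of "q s" T] q[of s] by (auto simp: good_def intro: order_trans)
        finally show ?thesis .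
      qed
      then show "bounded (range (\<lambda>s. (1 / e s) *\<^sub>R u s))" unfolding bounded_iff by blast
    qed
    then obtain v where "(\<lambda>s. (1 / e s) *\<^sub>R u s) = apply_bcontfun v" by (rule bcontfunE)
    then have v: "apply_bcontfun v s = (1 / e s) *\<^sub>R u s" for s by (metis (no_types))
    have "U v s = u s" for s using e_pos[of s] by (simp add: U_def v)
    then show ?thesis by (intro exI[of _ v]) auto
  qed
  have U_inj: "v1 = v2" if "U v1 = U v2" for v1 v2
  proof (rule bcontfun_eqI)
    fix s
    have "e s *\<^sub>R apply_bcontfun v1 s = e s *\<^sub>R apply_bcontfun v2 s" using that by (metis U_def)
    then show "apply_bcontfun v1 s = apply_bcontfun v2 s" using e_pos[of s] by simp
  qed
  define \<Theta> where "\<Theta> v = (SOME v'. U v' = \<Psi> (U v))" for v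
  have \<Theta>: "U (\<Theta> v) = \<Psi> (U v)" if "v \<in> S" for v
    unfolding \<Theta>_def by (rule someI_ex) (use that good_bcontfun \<Psi>_good in \<open>simp add: S_def\<close>)
  have "complete S"
  proof -
    have ev: "continuous_on UNIV (\<lambda>v :: real \<Rightarrow>\<^sub>C 'b. U v s)" for s
    proof -
      have "1-lipschitz_on UNIV (\<lambda>v :: real \<Rightarrow>\<^sub>C 'b. apply_bcontfun v s)"
        by (rule lipschitz_onI) (auto simp: dist_bounded)
      from lipschitz_on_continuous_on[OF this] show ?thesis
        unfolding U_def by (intro continuous_intros)
    qed
    have "closed S"
      unfolding S_def good_def
      by (intro closed_Collect_conj closed_Collect_all closed_Collect_imp open_Collect_const
          closed_Collect_eq closed_Collect_le continuous_intros ev)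
    then show ?thesis by (simp add: complete_eq_closed)
  qed
  moreover have "S \<noteq> {}"
  proof -
    have "good (\<lambda>s. X0 (min s c))"
      unfolding good_def
    proof (intro conjI allI impI)
      fix s t
      have "norm (X0 (min s c) - X0 (min t c)) \<le> K0 * norm (min s c - min t c)"
        by (rule lipschitz_on_normD[OF X0(1)]) auto
      also have "\<dots> \<le> M * \<bar>s - t\<bar>"
        using K0 M1 M by (intro mult_mono) (auto simp: M_def)
      finally show "norm (X0 (min s c) - X0 (min t c)) \<le> M * \<bar>s - t\<bar>" .
      show "norm (X0 (min s c)) \<le> \<rho> (q s)"
        using X0(2)[of "min s c"] \<rho>_ge[of "q s"] q[of s] by simp
    qed simp
    moreover from good_bcontfun[OF this] obtain v where "U v = (\<lambda>s. X0 (min s c))" ..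
    ultimately have "v \<in> S" by (simp add: S_def)
    then show ?thesis by blast
  qed
  moreover have "\<Theta> ` S \<subseteq> S" using \<Theta> \<Psi>_good by (auto simp: S_def)
  moreover have "dist (\<Theta> v1) (\<Theta> v2) \<le> (1 / 2) * dist v1 v2" if v: "v1 \<in> S" "v2 \<in> S" for v1 v2
  proof (rule dist_bound)
    fix s
    define D where "D = dist v1 v2"
    define u1 where "u1 = U v1"
    define u2 where "u2 = U v2"
    have good: "good u1" "good u2" using v by (auto simp: S_def u1_def u2_def)
    have D0: "0 \<le> D" by (simp add: D_def)
    have uD: "norm (u1 t - u2 t) \<le> e t * D" for t
    proof -
      have "norm (u1 t - u2 t) = e t * dist (apply_bcontfun v1 t) (apply_bcontfun v2 t)"
        using e_pos[of t] by (simp add: u1_def u2_def U_def dist_norm flip: scaleR_diff_right)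
      also have "\<dots> \<le> e t * D" unfolding D_def
        by (intro mult_left_mono dist_bounded) (simp add: e_def)
      finally show ?thesis .
    qed
    have gD: "norm (g u1 t - g u2 t) \<le> L * e t * D" if t: "t \<in> {c..T}" for t
    proof -
      let ?\<eta>1 = "\<eta> t (u1 t)" and ?\<eta>2 = "\<eta> t (u2 t)"
      have "norm (u1 ?\<eta>1 - u1 ?\<eta>2) \<le> M * \<bar>?\<eta>1 - ?\<eta>2\<bar>" using good by (simp add: good_def)
      also have "\<dots> \<le> M * (m * norm (u1 t - u2 t))" by (intro mult_left_mono \<eta>lip[OF t] M)
      also have "\<dots> \<le> M * (m * (e t * D))" by (intro mult_left_mono uD M m)
      finally have "norm (u1 ?\<eta>1 - u1 ?\<eta>2) \<le> M * m * (e t * D)" by simp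
      \<comment> \<open>Delayed times do not exceed \<open>t\<close> and the weight is monotone, so
        a delayed difference costs no more than a current one.\<close>
      moreover have "norm (u1 ?\<eta>2 - u2 ?\<eta>2) \<le> e t * D"
      proof -
        have "e ?\<eta>2 * D \<le> e t * D" by (intro mult_right_mono e_mono \<eta>le[OF t] D0)
        then show ?thesis using uD[of ?\<eta>2] by simp
      qed
      moreover have "norm (u1 ?\<eta>1 - u2 ?\<eta>2) \<le> norm (u1 ?\<eta>1 - u1 ?\<eta>2) + norm (u1 ?\<eta>2 - u2 ?\<eta>2)"
        using norm_triangle_ineq[of "u1 ?\<eta>1 - u1 ?\<eta>2" "u1 ?\<eta>2 - u2 ?\<eta>2"] by simp
      ultimately have "norm (u1 t - u2 t) + norm (u1 ?\<eta>1 - u2 ?\<eta>2) \<le> (2 + M * m) * (e t * D)"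
        using uD[of t] by (simp add: algebra_simps)
      then have "l * (norm (u1 t - u2 t) + norm (u1 ?\<eta>1 - u2 ?\<eta>2)) \<le> l * ((2 + M * m) * (e t * D))"
        by (intro mult_left_mono l)
      also have "\<dots> \<le> L * e t * D"
        using D0 e_pos[of t] by (simp add: L_def algebra_simps)
      finally show ?thesis
        using Flip[OF t, of "u1 t" "u1 ?\<eta>1" "u2 t" "u2 ?\<eta>2"] by (simp add: g_def)
    qed
    have int: "((\<lambda>t. L * exp (k * (t - c)) * D) has_integral D / 2 * e s - D / 2) {c..q s}"
    proof -
      have "((\<lambda>t. L * exp (k * (t - c)) * D) has_integral
          D / 2 * exp (k * (q s - c)) - D / 2 * exp (k * (c - c))) {c..q s}"
        by (rule fundamental_theorem_of_calculus)
          (use q[of s] in \<open>auto simp: k_def has_real_derivative_iff_has_vector_derivative[symmetric]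
             intro!: derivative_eq_intros\<close>)
      then show ?thesis by (simp add: e_def)
    qed
    have i: "g u1 integrable_on {c..q s}" "g u2 integrable_on {c..q s}"
      using q[of s] by (auto intro!: g_int good)
    have "\<Psi> u1 s - \<Psi> u2 s = integral {c..q s} (\<lambda>t. g u1 t - g u2 t)"
      using Henstock_Kurzweil_Integration.integral_diff[OF i] by (simp add: \<Psi>_def)
    moreover have "norm (integral {c..q s} (\<lambda>t. g u1 t - g u2 t))
        \<le> integral {c..q s} (\<lambda>t. L * exp (k * (t - c)) * D)"
    proof (rule integral_norm_bound_integral)
      show "(\<lambda>t. g u1 t - g u2 t) integrable_on {c..q s}" using i by (rule integrable_diff)
      show "(\<lambda>t. L * exp (k * (t - c)) * D) integrable_on {c..q s}" using int by blast
      fix t assume "t \<in> {c..q s}"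
      then have "t \<in> {c..T}" using q[of s] by auto
      then show "norm (g u1 t - g u2 t) \<le> L * exp (k * (t - c)) * D"
        using gD[of t] q_id[of t] by (simp add: e_def)
    qed
    ultimately have "norm (\<Psi> u1 s - \<Psi> u2 s) \<le> D / 2 * e s - D / 2"
      unfolding integral_unique[OF int] by simp
    then have "norm (\<Psi> u1 s - \<Psi> u2 s) \<le> D / 2 * e s" using D0 by simp
    moreover have "\<Psi> u1 s - \<Psi> u2 s = e s *\<^sub>R (apply_bcontfun (\<Theta> v1) s - apply_bcontfun (\<Theta> v2) s)"
      using \<Theta>[OF v(1)] \<Theta>[OF v(2)] unfolding u1_def u2_def
      by (simp add: U_def[symmetric] scaleR_diff_right)
    ultimately have "e s * dist (apply_bcontfun (\<Theta> v1) s) (apply_bcontfun (\<Theta> v2) s) \<le> e s * (D / 2)"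
      using e_pos[of s] by (simp add: dist_norm mult.commute)
    then show "dist (apply_bcontfun (\<Theta> v1) s) (apply_bcontfun (\<Theta> v2) s) \<le> 1 / 2 * dist v1 v2"
      using e_pos[of s] by (simp add: D_def)
  qed
  ultimately have "\<exists>!v\<in>S. \<Theta> v = v" by (intro Banach_fix[of S "1/2"]) auto
  then obtain v where v: "v \<in> S" "\<Theta> v = v" by blast
  define X where "X = U v"
  have good: "good X" using v by (simp add: S_def X_def)
  have X_fixed: "X s = \<Psi> X s" for s using \<Theta>[OF v(1)] v(2) by (simp add: X_def)
  show thesis
  proof (rule that)
    show "X s = X0 s" if "s \<le> c" for s using good that by (simp add: good_def)
    show "M-lipschitz_on UNIV X"
      using good M by (intro lipschitz_onI) (auto simp: good_def dist_norm)
    fix s assume s: "s \<in> {c<..<T}"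
    have "((\<lambda>t. integral {c..t} (g X)) has_vector_derivative g X s) (at s within {c..T})"
      by (rule integral_has_vector_derivative[OF g_cont[OF good]]) (use s in auto)
    then have "((\<lambda>t. integral {c..t} (g X)) has_vector_derivative g X s) (at s)"
      using s at_within_interior[of s "{c..T}"] by (simp add: interior_atLeastAtMost_real)
    then have "((\<lambda>t. X0 c + integral {c..t} (g X)) has_vector_derivative 0 + g X s) (at s)"
      by (intro has_vector_derivative_add has_vector_derivative_const)
    then have "((\<lambda>t. X0 c + integral {c..t} (g X)) has_vector_derivative g X s) (at s)" by simp
    then have "(X has_vector_derivative g X s) (at s)"
    proof (rule has_vector_derivative_transform_within_open)
      show "open {c<..<T}" "s \<in> {c<..<T}" using s by auto
      show "X0 c + integral {c..t} (g X) = X t" if "t \<in> {c<..<T}" for t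
        using that X_fixed[of t] q_id[of t] by (simp add: \<Psi>_def min_def)
    qed
    then show "(X has_vector_derivative F s (X s) (X (\<eta> s (X s)))) (at s)" by (simp add: g_def)
  qed
qed

section \<open>Trajectories of the control problem\<close>

text \<open>The derivative is bounded on the compact set, and convexity keeps segments inside it. It
  supplies Lipschitz bounds jointly in all variables, including time, whereas the assumed ones on
  \<open>f\<close> and \<open>tau\<close> concern the state variables only.\<close>

lemma C1_derivative_lipschitz_on_compact_convex:
  assumes "has_C1_derivative_on f f' S" "K \<subseteq> S" "compact K" "convex K"
  shows "\<exists>L. L-lipschitz_on K f"
proof -
  have "continuous_on K f'"
    using assms(1,2) by (auto simp: has_C1_derivative_on_def intro: continuous_on_subset)
  then have "bounded (f' ` K)" by (intro compact_imp_bounded compact_continuous_image assms(3))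
  then obtain L where "L > 0" and L: "\<And>x. x \<in> K \<Longrightarrow> norm (f' x) \<le> L"
    unfolding bounded_pos by (metis imageI)
  have "L-lipschitz_on K f"
  proof (rule lipschitz_onI)
    fix x y assume xy: "x \<in> K" "y \<in> K"
    have "norm (f x - f y) \<le> L * norm (x - y)"
    proof (rule differentiable_bound[OF assms(4) _ _ xy])
      show "(f has_derivative blinfun_apply (f' z)) (at z within K)" if "z \<in> K" for z
        using assms(1,2) that
        by (auto simp: has_C1_derivative_on_def intro: has_derivative_subset)
      show "onorm (blinfun_apply (f' z)) \<le> L" if "z \<in> K" for z
        using L[OF that] by (simp add: norm_blinfun.rep_eq)
    qed
    then show "dist (f x) (f y) \<le> L * dist x y" by (simp add: dist_norm)
  qed (use \<open>L > 0\<close> in simp)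
  then show ?thesis ..
qed

lemma is_trajectoryD:
  assumes "is_trajectory f tau tb t te w \<alpha> x"
  shows "\<exists>K. K-lipschitz_on {t - tb..te} x"
    and "AE s in lebesgue. s \<in> {t<..<te} \<longrightarrow>
      (x has_vector_derivative f (s, x s, x (s - tau (s, x s)), \<alpha> s)) (at s)"
    and "\<And>\<theta>. \<theta> \<in> {-tb..0} \<Longrightarrow> x (t + \<theta>) = w \<theta>"
  using assms unfolding is_trajectory_def AE_lebesgue_on_Ioo_iff by blast+

context delay_control_problem
begin

lemma tau_range:
  assumes "s \<in> {t0..T}"
  shows "0 \<le> tau (s, z)" "tau (s, z) \<le> tb"
proof -
  show "0 \<le> tau (s, z)" using tau_nonneg assms by blast
  show "tau (s, z) \<le> tb" unfolding tb_sup
    by (rule cSUP_upper[OF _ tau_bdd]) (use assms in auto)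
qed

text \<open>Comparison with \<open>z = y = 0\<close>, where \<open>f\<close> is bounded because time
  and control range over compact sets.\<close>

lemma f_growth:
  "\<exists>C>0. \<forall>t\<in>{t0..T}. \<forall>z y. \<forall>a\<in>A. norm (f (t, z, y, a)) \<le> C * (1 + norm z + norm y)"
proof -
  obtain lf where lf: "lf > 0" "\<And>t z y z' y' a. \<lbrakk>t \<in> {t0..T}; a \<in> A\<rbrakk> \<Longrightarrow>
      norm (f (t, z, y, a) - f (t, z', y', a)) \<le> lf * (norm (z - z') + norm (y - y'))"
    using f_lipschitz by metis
  have "compact (f ` ({t0..T} \<times> {0} \<times> {0} \<times> A))"
    by (intro compact_continuous_image continuous_on_subset[OF f_cont] compact_Times A_set) auto
  from compact_imp_bounded[OF this] obtain R
    where "R > 0" and R: "\<And>p. p \<in> {t0..T} \<times> {0} \<times> {0} \<times> A \<Longrightarrow> norm (f p) \<le> R"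
    unfolding bounded_pos by (metis imageI)
  have "norm (f (t, z, y, a)) \<le> (R + lf) * (1 + norm z + norm y)" if "t \<in> {t0..T}" "a \<in> A" for t z y a
  proof -
    have "norm (f (t, z, y, a)) \<le> norm (f (t, 0, 0, a)) + norm (f (t, z, y, a) - f (t, 0, 0, a))"
      by (rule norm_triangle_sub)
    also have "\<dots> \<le> R + lf * (norm z + norm y)"
      using R[of "(t, 0, 0, a)"] lf(2)[OF that, of z y 0 0] that by simp
    also have "\<dots> \<le> (R + lf) * (1 + norm z + norm y)"
      using lf(1) \<open>R > 0\<close> by (simp add: algebra_simps)
    finally show ?thesis .
  qed
  then show ?thesis using lf(1) \<open>R > 0\<close> by (intro exI[of _ "R + lf"]) auto
qed

definition admissible :: "real \<Rightarrow> real \<Rightarrow> (real \<Rightarrow> real^'m) \<Rightarrow> bool" where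
  "admissible tm tp \<alpha> \<longleftrightarrow> t0 \<le> tm \<and> tm < tp \<and> tp \<le> T \<and> continuous_on {tm<..tp} \<alpha> \<and> \<alpha> ` {tm<..tp} \<subseteq> A"

text \<open>A pointwise form of the bounds in \<open>V_hist\<close> that averaging preserves with
  the same \<open>r\<close>; the number of kinks may double under averaging.\<close>

definition bounded_hist :: "real \<Rightarrow> (real \<Rightarrow> real^'n) \<Rightarrow> bool" where
  "bounded_hist r w \<longleftrightarrow> (\<forall>\<theta>\<in>{-tb..0}. norm (w \<theta>) \<le> r) \<and> r-lipschitz_on {-tb..0} w"

lemma bounded_hist_imp_P_hist:
  assumes "bounded_hist r w"
  shows "w \<in> P_hist tb r"
proof -
  have w: "r-lipschitz_on {-tb..0} w" "\<And>\<theta>. \<theta> \<in> {-tb..0} \<Longrightarrow> norm (w \<theta>) \<le> r"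
    using assms by (auto simp: bounded_hist_def)
  have "w \<in> borel_measurable (lebesgue_on {-tb..0})"
    by (intro integrable_imp_measurable integrable_continuous_real lipschitz_on_continuous_on[OF w(1)])
  then have "(\<lambda>\<theta>. ereal (norm (w \<theta>))) \<in> borel_measurable (lebesgue_on {-tb..0})" by measurable
  then have "Linf_norm tb w \<le> ereal r"
    unfolding Linf_norm_def by (rule esssup_I) (auto intro!: AE_I2 w(2))
  then show ?thesis using w(1) by (auto simp: P_hist_def Lip_hist_def)
qed

text \<open>Needed because the monotone delay condition only speaks about solutions up to the final time.\<close>

lemma extend_trajectory:
  assumes adm: "admissible tm tp \<alpha>" and traj: "is_trajectory f tau tb tm tp w \<alpha> x"
  obtains \<alpha>' x' where "\<alpha>' \<in> controls A tm T" "is_trajectory f tau tb tm T w \<alpha>' x'"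
    "\<And>s. s \<in> {tm - tb..tp} \<Longrightarrow> x' s = x s"
proof -
  have t: "t0 \<le> tm" "tm < tp" "tp \<le> T" using adm by (auto simp: admissible_def)
  have \<alpha>: "continuous_on {tm<..tp} \<alpha>" "\<And>s. s \<in> {tm<..tp} \<Longrightarrow> \<alpha> s \<in> A"
    using adm by (auto simp: admissible_def)
  obtain K where K: "K-lipschitz_on {tm - tb..tp} x" using is_trajectoryD(1)[OF traj] ..
  \<comment> \<open>Freezing the control at its final value keeps it continuous, hence measurable,
    and inside \<open>A\<close>.\<close>
  define \<alpha>' where "\<alpha>' s = \<alpha> (min s tp)" for s
  have \<alpha>'A: "\<alpha>' s \<in> A" if "tm < s" for s unfolding \<alpha>'_def using t that by (intro \<alpha>) auto
  have "continuous_on {tm<..<T} \<alpha>'"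
    unfolding \<alpha>'_def by (rule continuous_on_compose2[OF \<alpha>(1)]) (use t in \<open>auto intro!: continuous_intros\<close>)
  then have "\<alpha>' \<in> borel_measurable (lebesgue_on {tm<..<T})"
    by (intro continuous_imp_measurable_on_sets_lebesgue) auto
  then have ctl: "\<alpha>' \<in> controls A tm T" using \<alpha>'A by (auto simp: controls_def)
  show thesis
  proof (cases "tp = T")
    case True
    have "AE s in lebesgue. s \<in> {tm<..<T} \<longrightarrow>
      (x has_vector_derivative f (s, x s, x (s - tau (s, x s)), \<alpha>' s)) (at s)"
      using is_trajectoryD(2)[OF traj] unfolding True
      by eventually_elim (auto simp: \<alpha>'_def True min_def)
    then have "is_trajectory f tau tb tm T w \<alpha>' x"
      using K is_trajectoryD(3)[OF traj]
      unfolding is_trajectory_def AE_lebesgue_on_Ioo_iff True by blast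
    then show thesis by (rule that[OF ctl]) simp
  next
    case False
    then have tpT: "tp < T" using t by simp
    obtain lf where lf: "lf > 0" "\<And>t z y z' y' a. \<lbrakk>t \<in> {t0..T}; a \<in> A\<rbrakk> \<Longrightarrow>
        norm (f (t, z, y, a) - f (t, z', y', a)) \<le> lf * (norm (z - z') + norm (y - y'))"
      using f_lipschitz by metis
    obtain lt where lt: "lt > 0" "\<And>t z y. t \<in> {t0..T} \<Longrightarrow> \<bar>tau (t, z) - tau (t, y)\<bar> \<le> lt * norm (z - y)"
      using tau_lipschitz by metis
    obtain C where C: "C > 0" "\<And>t z y a. \<lbrakk>t \<in> {t0..T}; a \<in> A\<rbrakk> \<Longrightarrow>
        norm (f (t, z, y, a)) \<le> C * (1 + norm z + norm y)"
      using f_growth by metis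
    have a: "\<alpha> tp \<in> A" using t by (intro \<alpha>) auto
    have xc: "continuous_on {tm - tb..tp} x" by (rule lipschitz_on_continuous_on[OF K])
    obtain R where R: "0 < R" "\<And>s. s \<in> {tm - tb..tp} \<Longrightarrow> norm (x s) \<le> R"
      using compact_imp_bounded[OF compact_continuous_image[OF xc compact_Icc]]
      unfolding bounded_pos by (metis imageI)
    \<comment> \<open>The existence result expects initial data on a half-line; to the left of the
      history the value is continued constantly, which keeps the constant \<open>K\<close>.\<close>
    define X0 where "X0 s = x (max s (tm - tb))" for s
    have X0l: "K-lipschitz_on {..tp} X0"
    proof (rule lipschitz_onI[OF _ lipschitz_on_nonneg[OF K]])
      fix s s' assume s: "s \<in> {..tp}" "s' \<in> {..tp}"
      have "dist (X0 s) (X0 s') \<le> K * dist (max s (tm - tb)) (max s' (tm - tb))"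
        unfolding X0_def by (rule lipschitz_onD[OF K]) (use s t tb_pos in auto)
      also have "\<dots> \<le> K * dist s s'"
        by (intro mult_left_mono lipschitz_on_nonneg[OF K]) (auto simp: dist_real_def)
      finally show "dist (X0 s) (X0 s') \<le> K * dist s s'" .
    qed
    obtain X K' where X: "\<And>s. s \<le> tp \<Longrightarrow> X s = X0 s" "K'-lipschitz_on UNIV X"
      "\<And>s. s \<in> {tp<..<T} \<Longrightarrow>
        (X has_vector_derivative f (s, X s, X (s - tau (s, X s)), \<alpha> tp)) (at s)"
    proof (rule delay_ivp_extension[OF tpT, where F="\<lambda>s z y. f (s, z, y, \<alpha> tp)"
          and \<eta>="\<lambda>s z. s - tau (s, z)" and ?X0.0=X0 and ?K0.0=K and ?R0.0=R and l=lf and m=lt and C=C])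
      show "continuous_on ({tp..T} \<times> UNIV \<times> UNIV) (\<lambda>(s, z, y). f (s, z, y, \<alpha> tp))"
        unfolding case_prod_unfold
        by (rule continuous_on_compose2[OF f_cont]) (use t a in \<open>auto intro!: continuous_intros\<close>)
      have "continuous_on ({t0..T} \<times> UNIV) tau"
        using tau_C1 unfolding has_C1_derivative_on_def
        by (meson has_derivative_continuous_on)
      then have "continuous_on ({tp..T} \<times> UNIV) tau" by (rule continuous_on_subset) (use t in auto)
      then show "continuous_on ({tp..T} \<times> UNIV) (\<lambda>(s, z). s - tau (s, z))"
        unfolding case_prod_unfold prod.collapse by (intro continuous_intros)
      show "\<bar>s - tau (s, z) - (s - tau (s, z'))\<bar> \<le> lt * norm (z - z')" if "s \<in> {tp..T}" for s z z'
        using lt(2)[of s z' z] that t by (simp add: norm_minus_commute)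
      show "s - tau (s, z) \<le> s" if "s \<in> {tp..T}" for s z using tau_range[of s z] that t by simp
      show "norm (X0 s) \<le> R" if "s \<le> tp" for s
        unfolding X0_def by (rule R(2)) (use that t tb_pos in auto)
    qed (use lf lt C R a t X0l in auto)
    have Xx: "X s = x s" if "s \<in> {tm - tb..tp}" for s using that X(1) by (simp add: X0_def)
    have "AE s in lebesgue. s \<in> {tm<..<T} \<longrightarrow>
      (X has_vector_derivative f (s, X s, X (s - tau (s, X s)), \<alpha>' s)) (at s)"
      using is_trajectoryD(2)[OF traj] finite_imp_AE_notin[of "{tp}", simplified]
    proof eventually_elim
      case (elim s)
      show ?case
      proof
        assume s: "s \<in> {tm<..<T}"
        show "(X has_vector_derivative f (s, X s, X (s - tau (s, X s)), \<alpha>' s)) (at s)"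
        proof (cases "s < tp")
          case True
          then have D: "(x has_vector_derivative f (s, x s, x (s - tau (s, x s)), \<alpha> s)) (at s)"
            using elim s by auto
          have "X s = x s" using True s tb_pos by (intro Xx) auto
          moreover have "X (s - tau (s, x s)) = x (s - tau (s, x s))"
            using tau_range[of s "x s"] True s t by (intro Xx) auto
          moreover have "(X has_vector_derivative f (s, x s, x (s - tau (s, x s)), \<alpha> s)) (at s)"
            by (rule has_vector_derivative_transform_within_open[OF D, of "{tm<..<tp}"])
              (use True s tb_pos in \<open>auto intro!: Xx[symmetric]\<close>)
          ultimately show ?thesis using True by (simp add: \<alpha>'_def)
        next
          case False
          then have "tp < s" using elim by simp
          then show ?thesis using X(3)[of s] s by (simp add: \<alpha>'_def)
        qed
      qed
    qed
    moreover have "K'-lipschitz_on {tm - tb..T} X" by (rule lipschitz_on_subset[OF X(2)]) simp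
    moreover have "X (tm + \<theta>) = w \<theta>" if "\<theta> \<in> {-tb..0}" for \<theta>
      using that t Xx[of "tm + \<theta>"] is_trajectoryD(3)[OF traj that] by simp
    ultimately have "is_trajectory f tau tb tm T w \<alpha>' X"
      unfolding is_trajectory_def AE_lebesgue_on_Ioo_iff by blast
    then show thesis by (rule that[OF ctl]) (rule Xx)
  qed
qed

text \<open>By the chain rule, the expression in the monotone delay condition is the derivative of
  the delayed time. The condition is applied to an extension of the trajectory up to
  \<open>T\<close>, which agrees with it before \<open>tp\<close>; thus \<open>d\<close> depends
  only on \<open>r\<close>.\<close>

lemma delay_time_derivative:
  assumes r: "0 < r"
  shows "\<exists>d>0. \<forall>tm tp w \<alpha> x. admissible tm tp \<alpha> \<and> bounded_hist r w \<and>
    is_trajectory f tau tb tm tp w \<alpha> x \<longrightarrow>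
    (AE s in lebesgue. s \<in> {tm<..<tp} \<longrightarrow>
      (\<exists>\<eta>'\<ge>d. ((\<lambda>s. s - tau (s, x s)) has_real_derivative \<eta>') (at s)))"
proof -
  from monotone_delay[THEN spec, THEN mp, OF r] obtain d where d: "d > 0"
    and mono: "\<forall>t\<in>{t0..T}. \<forall>w\<in>P_hist tb r. \<forall>\<alpha>\<in>controls A t T. \<forall>x.
      is_trajectory f tau tb t T w \<alpha> x \<longrightarrow> (AE s in lebesgue_on {t..T}.
         d \<le> 1 - blinfun_apply (Dtau (s, x s)) (1, 0)
               - blinfun_apply (Dtau (s, x s)) (0, vector_derivative x (at s)))"
    by (elim exE conjE)
  have "AE s in lebesgue. s \<in> {tm<..<tp} \<longrightarrow>
      (\<exists>\<eta>'\<ge>d. ((\<lambda>s. s - tau (s, x s)) has_real_derivative \<eta>') (at s))"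
    if adm: "admissible tm tp \<alpha>" and w: "bounded_hist r w"
      and traj: "is_trajectory f tau tb tm tp w \<alpha> x" for tm tp w \<alpha> x
  proof -
    have t: "t0 \<le> tm" "tm < tp" "tp \<le> T" using adm by (auto simp: admissible_def)
    obtain \<alpha>' x' where x': "\<alpha>' \<in> controls A tm T" "is_trajectory f tau tb tm T w \<alpha>' x'"
      "\<And>s. s \<in> {tm - tb..tp} \<Longrightarrow> x' s = x s"
      using extend_trajectory[OF adm traj] by blast
    have "AE s in lebesgue. s \<in> {tm<..<T} \<longrightarrow>
         d \<le> 1 - blinfun_apply (Dtau (s, x' s)) (1, 0)
               - blinfun_apply (Dtau (s, x' s)) (0, vector_derivative x' (at s))"
      using mono[rule_format, OF _ bounded_hist_imp_P_hist[OF w] x'(1,2)] t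
      unfolding AE_lebesgue_on_Icc_iff by simp
    with is_trajectoryD(2)[OF traj] show ?thesis
    proof eventually_elim
      case (elim s)
      show ?case
      proof
        assume s: "s \<in> {tm<..<tp}"
        then obtain D where D: "(x has_vector_derivative D) (at s)" using elim by blast
        have "(x' has_vector_derivative D) (at s)"
          by (rule has_vector_derivative_transform_within_open[OF D, of "{tm<..<tp}"])
            (use s tb_pos in \<open>auto intro!: x'(3)[symmetric]\<close>)
        then have "vector_derivative x' (at s) = D" by (rule vector_derivative_at)
        moreover have "x' s = x s" using s tb_pos by (intro x') auto
        ultimately have le: "d \<le> 1 - blinfun_apply (Dtau (s, x s)) (1, 0)
            - blinfun_apply (Dtau (s, x s)) (0, D)"
          using elim s t by auto
        \<comment> \<open>At interior times the derivative of \<open>tau\<close> relative to its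
          domain is a full derivative, as the chain rule requires.\<close>
        have "(s, x s) \<in> interior ({t0..T} \<times> UNIV)"
          using s t by (simp add: interior_Times interior_atLeastAtMost_real)
        then have "at (s, x s) within ({t0..T} \<times> UNIV) = at (s, x s)" by (rule at_within_interior)
        moreover have "(tau has_derivative blinfun_apply (Dtau (s, x s))) (at (s, x s) within ({t0..T} \<times> UNIV))"
          using tau_C1 s t by (simp add: has_C1_derivative_on_def)
        ultimately have tauD: "(tau has_derivative blinfun_apply (Dtau (s, x s))) (at (s, x s))" by simp
        have "((\<lambda>s. (s, x s)) has_derivative (\<lambda>h. (h, h *\<^sub>R D))) (at s)"
          using D unfolding has_vector_derivative_def
          by (intro has_derivative_Pair has_derivative_ident)
        from has_derivative_compose[OF this tauD]
        have "((\<lambda>s. tau (s, x s)) has_derivative (\<lambda>h. blinfun_apply (Dtau (s, x s)) (h, h *\<^sub>R D))) (at s)" .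
        moreover have "blinfun_apply (Dtau (s, x s)) (h, h *\<^sub>R D)
            = (blinfun_apply (Dtau (s, x s)) (1, 0) + blinfun_apply (Dtau (s, x s)) (0, D)) * h" for h
        proof -
          have "(h, h *\<^sub>R D) = h *\<^sub>R ((1, 0) + (0, D))" by simp
          then show ?thesis by (simp only: blinfun.scaleR_right blinfun.add_right) simp
        qed
        ultimately have "((\<lambda>s. tau (s, x s)) has_real_derivative
            (blinfun_apply (Dtau (s, x s)) (1, 0) + blinfun_apply (Dtau (s, x s)) (0, D))) (at s)"
          by (simp add: has_field_derivative_def)
        from DERIV_diff[OF DERIV_ident this] le
        show "\<exists>\<eta>'\<ge>d. ((\<lambda>s. s - tau (s, x s)) has_real_derivative \<eta>') (at s)"
          by (intro exI conjI) auto
      qed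
    qed
  qed
  then show ?thesis using d by blast
qed

lemma trajectory_history:
  assumes "is_trajectory f tau tb tm tp w \<alpha> x" "s \<in> {tm - tb..tm}"
  shows "x s = w (s - tm)"
  using is_trajectoryD(3)[OF assms(1), of "s - tm"] assms(2) by simp

text \<open>Gronwall with the trivial data \<open>\<eta> s = s\<close> and
  \<open>\<phi> = 0\<close>: delayed values that fall into the history are bounded by
  \<open>r\<close> and go into the constant \<open>c\<close>. The Lipschitz constant then follows by
  inserting the bound \<open>R\<close> into the growth condition.\<close>

lemma trajectory_bounds:
  assumes r: "0 < r"
  shows "\<exists>R>0. \<exists>M>0. \<forall>tm tp w \<alpha> x. admissible tm tp \<alpha> \<and> bounded_hist r w \<and>
    is_trajectory f tau tb tm tp w \<alpha> x \<longrightarrow>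
    (\<forall>s\<in>{tm - tb..tp}. norm (x s) \<le> R) \<and> M-lipschitz_on {tm - tb..tp} x"
proof -
  obtain C where C: "C > 0" "\<And>t z y a. \<lbrakk>t \<in> {t0..T}; a \<in> A\<rbrakk> \<Longrightarrow>
      norm (f (t, z, y, a)) \<le> C * (1 + norm z + norm y)"
    using f_growth by metis
  define c where "c = C * (1 + r)"
  define R1 where "R1 = 2 * exp (4 * C * (T - t0)) * (r + c * (T - t0))"
  define R where "R = r + R1"
  define M where "M = C * (1 + 2 * R) + r"
  have c: "0 \<le> c" using C r by (simp add: c_def)
  have R1: "0 \<le> R1" using C r c horizon by (simp add: R1_def)
  have R: "0 < R" using R1 r by (simp add: R_def)
  have M: "0 < M" "r \<le> M" using R C r by (auto simp: M_def intro!: add_pos_pos mult_pos_pos)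
  have "(\<forall>s\<in>{tm - tb..tp}. norm (x s) \<le> R) \<and> M-lipschitz_on {tm - tb..tp} x"
    if adm: "admissible tm tp \<alpha>" and w: "bounded_hist r w"
      and traj: "is_trajectory f tau tb tm tp w \<alpha> x" for tm tp w \<alpha> x
  proof -
    have t: "t0 \<le> tm" "tm < tp" "tp \<le> T" using adm by (auto simp: admissible_def)
    obtain K where K: "K-lipschitz_on {tm - tb..tp} x" using is_trajectoryD(1)[OF traj] ..
    have K': "K-lipschitz_on {tm..tp} x" by (rule lipschitz_on_subset[OF K]) (use tb_pos in auto)
    have hist: "norm (x s) \<le> r" if "s \<in> {tm - tb..tm}" for s
      using w that trajectory_history[OF traj that] by (auto simp: bounded_hist_def)
    have R1b: "norm (x s) \<le> R1" if s: "s \<in> {tm..tp}" for s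
    proof -
      have "norm (x s) \<le> 2 * exp (4 * C * (tp - tm)) * (norm (x tm) + c * (tp - tm) + 0 / 1)"
      proof (rule delayed_gronwall[OF K' _ C(1) c _ _ _ _ _ _ s, where \<eta>="\<lambda>s. s" and \<phi>="\<lambda>_. 0"
            and \<Phi>="\<lambda>_. 0" and \<alpha>=tm and \<beta>=tp and K'=1])
        show "AE s in lebesgue. s \<in> {tm<..<tp} \<longrightarrow>
          (\<exists>u' \<eta>' \<sigma>. (x has_vector_derivative u') (at s) \<and> ((\<lambda>s. s) has_real_derivative \<eta>') (at s) \<and>
            1 \<le> \<eta>' \<and> \<sigma> \<in> {tm..s} \<and> norm u' \<le> C * (norm (x s) + norm (x \<sigma>)) + c + 0)"
          using is_trajectoryD(2)[OF traj]
        proof (rule AE_mp, intro AE_I2 impI)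
          fix s assume D: "s \<in> {tm<..<tp} \<longrightarrow>
            (x has_vector_derivative f (s, x s, x (s - tau (s, x s)), \<alpha> s)) (at s)"
            and s: "s \<in> {tm<..<tp}"
          let ?\<eta> = "s - tau (s, x s)"
          \<comment> \<open>Gronwall admits only delayed times after \<open>tm\<close>; earlier ones
            are replaced by \<open>tm\<close> itself at the cost of the summand
            \<open>r\<close>.\<close>
          define \<sigma> where "\<sigma> = max ?\<eta> tm"
          have \<eta>: "?\<eta> \<in> {tm - tb..s}" using tau_range[of s "x s"] s t by auto
          have "norm (x ?\<eta>) \<le> norm (x \<sigma>) + r"
          proof (cases "tm \<le> ?\<eta>")
            case False
            then have "norm (x ?\<eta>) \<le> 0 + r" using hist[of ?\<eta>] \<eta> by simp
            also have "\<dots> \<le> norm (x \<sigma>) + r" by (intro add_right_mono norm_ge_zero)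
            finally show ?thesis .
          qed (use r in \<open>simp add: \<sigma>_def\<close>)
          then have "C * (1 + norm (x s) + norm (x ?\<eta>)) \<le> C * (1 + norm (x s) + (norm (x \<sigma>) + r))"
            using C by (intro mult_left_mono) auto
          moreover have "norm (f (s, x s, x ?\<eta>, \<alpha> s)) \<le> C * (1 + norm (x s) + norm (x ?\<eta>))"
            using s t adm by (intro C(2)) (auto simp: admissible_def)
          ultimately have "norm (f (s, x s, x ?\<eta>, \<alpha> s)) \<le> C * (norm (x s) + norm (x \<sigma>)) + c + 0"
            by (simp add: c_def algebra_simps)
          moreover have "\<sigma> \<in> {tm..s}" using \<eta> s by (auto simp: \<sigma>_def)
          moreover have "((\<lambda>s::real. s) has_real_derivative 1) (at s)" by (rule DERIV_ident)
          ultimately show "\<exists>u' \<eta>' \<sigma>. (x has_vector_derivative u') (at s) \<and>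
            ((\<lambda>s. s) has_real_derivative \<eta>') (at s) \<and>
            1 \<le> \<eta>' \<and> \<sigma> \<in> {tm..s} \<and> norm u' \<le> C * (norm (x s) + norm (x \<sigma>)) + c + 0"
            using D s by blast
        qed
      qed (auto intro: lipschitz_on_id)
      also have "\<dots> \<le> R1"
      proof -
        have "norm (x tm) \<le> r" using hist[of tm] tb_pos by simp
        moreover have "c * (tp - tm) \<le> c * (T - t0)" using t c by (intro mult_left_mono) auto
        moreover have "exp (4 * C * (tp - tm)) \<le> exp (4 * C * (T - t0))" using t C by simp
        moreover have "norm (x tm) + c * (tp - tm) + 0 / 1 \<le> r + c * (T - t0)"
          using calculation by simp
        ultimately show ?thesis unfolding R1_def using c t by (intro mult_mono) auto
      qed
      finally show ?thesis .
    qed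
    have Rb: "norm (x s) \<le> R" if "s \<in> {tm - tb..tp}" for s
      using R1b[of s] hist[of s] that R1 r by (cases "s \<le> tm") (auto simp: R_def)
    have "M-lipschitz_on {tm..tp} x"
    proof (rule AE_norm_derivative_le_imp_lipschitz[OF K'])
      show "0 \<le> M" using M by simp
      show "AE s in lebesgue. s \<in> {tm<..<tp} \<longrightarrow> (\<exists>u'. (x has_vector_derivative u') (at s) \<and> norm u' \<le> M)"
        using is_trajectoryD(2)[OF traj]
      proof (rule AE_mp, intro AE_I2 impI)
        fix s assume D: "s \<in> {tm<..<tp} \<longrightarrow>
          (x has_vector_derivative f (s, x s, x (s - tau (s, x s)), \<alpha> s)) (at s)"
          and s: "s \<in> {tm<..<tp}"
        let ?\<eta> = "s - tau (s, x s)"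
        have \<eta>: "?\<eta> \<in> {tm - tb..s}" using tau_range[of s "x s"] s t by auto
        have "norm (f (s, x s, x ?\<eta>, \<alpha> s)) \<le> C * (1 + norm (x s) + norm (x ?\<eta>))"
          using s t adm by (intro C(2)) (auto simp: admissible_def)
        also have "\<dots> \<le> C * (1 + 2 * R)"
          using Rb[of s] Rb[of ?\<eta>] s t \<eta> tb_pos C by (intro mult_left_mono) auto
        also have "\<dots> \<le> M" using r by (simp add: M_def)
        finally show "\<exists>u'. (x has_vector_derivative u') (at s) \<and> norm u' \<le> M" using D s by blast
      qed
    qed
    moreover have "M-lipschitz_on {tm - tb..tm} x"
    proof (rule lipschitz_onI)
      fix s s' assume s: "s \<in> {tm - tb..tm}" "s' \<in> {tm - tb..tm}"
      have "dist (w (s - tm)) (w (s' - tm)) \<le> r * dist (s - tm) (s' - tm)"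
        using w s unfolding bounded_hist_def by (intro lipschitz_onD[of r "{-tb..0}" w]) auto
      also have "\<dots> \<le> M * dist s s'" using M by (intro mult_mono) (auto simp: dist_real_def)
      finally show "dist (x s) (x s') \<le> M * dist s s'"
        using trajectory_history[OF traj] s by simp
    qed (use M in simp)
    \<comment> \<open>Both branches are \<open>x\<close>; the conditional serves to glue the two
      Lipschitz bounds at \<open>tm\<close>.\<close>
    ultimately have "M-lipschitz_on {tm - tb..tp} (\<lambda>s. if s \<le> tm then x s else x s)"
      by (intro lipschitz_on_concat) auto
    then show ?thesis using Rb by simp
  qed
  then show ?thesis using R M by blast
qed

text \<open>The dependence of \<open>tau\<close> on time is controlled only through its
  \<open>C1\<close> property, so the a priori bound \<open>R\<close> is used to stay in a compact
  set.\<close>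

lemma delay_time_lipschitz:
  assumes r: "0 < r"
  shows "\<exists>L>0. \<forall>tm tp w \<alpha> x. admissible tm tp \<alpha> \<and> bounded_hist r w \<and>
    is_trajectory f tau tb tm tp w \<alpha> x \<longrightarrow> L-lipschitz_on {tm..tp} (\<lambda>s. s - tau (s, x s))"
proof -
  obtain R M where RM: "R > 0" "M > 0" "\<And>tm tp w \<alpha> x. \<lbrakk>admissible tm tp \<alpha>; bounded_hist r w;
      is_trajectory f tau tb tm tp w \<alpha> x\<rbrakk> \<Longrightarrow>
      (\<forall>s\<in>{tm - tb..tp}. norm (x s) \<le> R) \<and> M-lipschitz_on {tm - tb..tp} x"
    using trajectory_bounds[OF r] by blast
  have "\<exists>L. L-lipschitz_on ({t0..T} \<times> cball 0 R) tau"
    by (rule C1_derivative_lipschitz_on_compact_convex[OF tau_C1])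
      (auto intro: compact_Times convex_Times)
  then obtain L where L: "L-lipschitz_on ({t0..T} \<times> cball 0 R) tau" ..
  define L' where "L' = 1 + L * sqrt (1\<^sup>2 + M\<^sup>2)"
  have "L'-lipschitz_on {tm..tp} (\<lambda>s. s - tau (s, x s))"
    if adm: "admissible tm tp \<alpha>" and w: "bounded_hist r w"
      and traj: "is_trajectory f tau tb tm tp w \<alpha> x" for tm tp w \<alpha> x
  proof -
    have t: "t0 \<le> tm" "tm < tp" "tp \<le> T" using adm by (auto simp: admissible_def)
    have x: "\<And>s. s \<in> {tm - tb..tp} \<Longrightarrow> norm (x s) \<le> R" "M-lipschitz_on {tm - tb..tp} x"
      using RM(3)[OF that] by auto
    have "M-lipschitz_on {tm..tp} x" by (rule lipschitz_on_subset[OF x(2)]) (use tb_pos in auto)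
    then have "(sqrt (1\<^sup>2 + M\<^sup>2))-lipschitz_on {tm..tp} (\<lambda>s. (s, x s))"
      by (rule lipschitz_on_Pair[OF lipschitz_on_id])
    moreover have "L-lipschitz_on ((\<lambda>s. (s, x s)) ` {tm..tp}) tau"
      by (rule lipschitz_on_subset[OF L]) (use x(1) t tb_pos in auto)
    ultimately have "(L * sqrt (1\<^sup>2 + M\<^sup>2))-lipschitz_on {tm..tp} (\<lambda>s. tau (s, x s))"
      by (rule lipschitz_on_compose2)
    then show ?thesis unfolding L'_def by (rule lipschitz_on_diff[OF lipschitz_on_id])
  qed
  moreover have "0 < L'"
    using lipschitz_on_nonneg[OF L] by (simp add: L'_def add_pos_nonneg)
  ultimately show ?thesis by blast
qed

section \<open>First-order estimate\<close>

text \<open>The delayed values differ by a shift of the delayed time along \<open>x1\<close>, which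
  costs \<open>M * lt * norm (u s)\<close>, and by a difference at the common time
  \<open>\<eta> s\<close>. The latter is either a value of \<open>u\<close> after \<open>tm\<close>
  or a difference of histories, which plays the role of \<open>\<phi>\<close>.\<close>

lemma trajectory_difference_bound:
  assumes r: "0 < r"
  shows "\<exists>C>0. \<forall>tm tp w1 w2 \<alpha> x1 x2. admissible tm tp \<alpha> \<and> bounded_hist r w1 \<and> bounded_hist r w2 \<and>
    is_trajectory f tau tb tm tp w1 \<alpha> x1 \<and> is_trajectory f tau tb tm tp w2 \<alpha> x2 \<longrightarrow>
    (\<forall>s\<in>{tm..tp}. norm (x1 s - x2 s) \<le> C * (norm (w1 0 - w2 0) + L1_norm tb (\<lambda>\<theta>. w1 \<theta> - w2 \<theta>)))"
proof -
  obtain lf where lf: "lf > 0" "\<And>t z y z' y' a. \<lbrakk>t \<in> {t0..T}; a \<in> A\<rbrakk> \<Longrightarrow>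
      norm (f (t, z, y, a) - f (t, z', y', a)) \<le> lf * (norm (z - z') + norm (y - y'))"
    using f_lipschitz by metis
  obtain lt where lt: "lt > 0" "\<And>t z y. t \<in> {t0..T} \<Longrightarrow> \<bar>tau (t, z) - tau (t, y)\<bar> \<le> lt * norm (z - y)"
    using tau_lipschitz by metis
  obtain R M where RM: "R > 0" "M > 0" "\<And>tm tp w \<alpha> x. \<lbrakk>admissible tm tp \<alpha>; bounded_hist r w;
      is_trajectory f tau tb tm tp w \<alpha> x\<rbrakk> \<Longrightarrow>
      (\<forall>s\<in>{tm - tb..tp}. norm (x s) \<le> R) \<and> M-lipschitz_on {tm - tb..tp} x"
    using trajectory_bounds[OF r] by blast
  obtain L where L: "L > 0" "\<And>tm tp w \<alpha> x. \<lbrakk>admissible tm tp \<alpha>; bounded_hist r w;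
      is_trajectory f tau tb tm tp w \<alpha> x\<rbrakk> \<Longrightarrow> L-lipschitz_on {tm..tp} (\<lambda>s. s - tau (s, x s))"
    using delay_time_lipschitz[OF r] by blast
  obtain d where d: "d > 0" "\<And>tm tp w \<alpha> x. \<lbrakk>admissible tm tp \<alpha>; bounded_hist r w;
      is_trajectory f tau tb tm tp w \<alpha> x\<rbrakk> \<Longrightarrow> (AE s in lebesgue. s \<in> {tm<..<tp} \<longrightarrow>
      (\<exists>\<eta>'\<ge>d. ((\<lambda>s. s - tau (s, x s)) has_real_derivative \<eta>') (at s)))"
    using delay_time_derivative[OF r] by blast
  define B where "B = lf * (1 + M * lt)"
  have B: "0 < B" using lf lt RM by (simp add: B_def add_pos_pos)
  define C where "C = 2 * exp (4 * B * (T - t0)) * (1 + lf * (1 + (T - t0)) / d)"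
  have C: "0 < C" using lf d horizon unfolding C_def by (intro mult_pos_pos add_pos_nonneg) auto
  have "norm (x1 s - x2 s) \<le> C * (norm (w1 0 - w2 0) + L1_norm tb (\<lambda>\<theta>. w1 \<theta> - w2 \<theta>))"
    if adm: "admissible tm tp \<alpha>" and w: "bounded_hist r w1" "bounded_hist r w2"
      and traj: "is_trajectory f tau tb tm tp w1 \<alpha> x1" "is_trajectory f tau tb tm tp w2 \<alpha> x2"
      and s: "s \<in> {tm..tp}" for tm tp w1 w2 \<alpha> x1 x2 s
  proof -
    have t: "t0 \<le> tm" "tm < tp" "tp \<le> T" using adm by (auto simp: admissible_def)
    have x1: "M-lipschitz_on {tm - tb..tp} x1" and x2: "M-lipschitz_on {tm - tb..tp} x2"
      using RM(3)[OF adm w(1) traj(1)] RM(3)[OF adm w(2) traj(2)] by auto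
    define u where "u s = x1 s - x2 s" for s
    define \<eta> where "\<eta> s = s - tau (s, x2 s)" for s
    have u: "(M + M)-lipschitz_on {tm..tp} u"
      unfolding u_def by (rule lipschitz_on_diff; rule lipschitz_on_subset[OF x1] lipschitz_on_subset[OF x2])
        (use tb_pos in auto)
    have \<eta>rng: "\<eta> s \<in> {tm - tb..s}" if "s \<in> {tm..tp}" for s
      using tau_range[of s "x2 s"] that t by (auto simp: \<eta>_def)
    define \<delta> where "\<delta> = norm (w1 0 - w2 0)"
    \<comment> \<open>Clamping makes this continuous on the whole line. After time 0 it keeps the
      value \<open>\<delta>\<close> instead of vanishing, which adds the harmless term
      \<open>(tp - tm) * \<delta>\<close> to the oscillation of \<open>\<Psi>\<close>.\<close>
    define \<psi>0 where "\<psi>0 \<theta> = norm (w1 (max (-tb) (min 0 \<theta>)) - w2 (max (-tb) (min 0 \<theta>)))" for \<theta>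
    have "continuous_on UNIV \<psi>0"
      unfolding \<psi>0_def
      by (intro continuous_intros; rule continuous_on_compose2[of "{-tb..0}"])
        (use w tb_pos in \<open>auto simp: bounded_hist_def intro!: continuous_intros intro: lipschitz_on_continuous_on\<close>)
    then obtain \<Psi> where \<Psi>: "\<And>v. (\<Psi> has_real_derivative \<psi>0 v) (at v)"
      using continuous_imp_antiderivative by blast
    have \<Psi>_mono: "\<Psi> v \<le> \<Psi> v'" if "v \<le> v'" for v v'
    proof (rule DERIV_nonneg_imp_nondecreasing[OF that])
      show "\<exists>y. (\<Psi> has_real_derivative y) (at x) \<and> 0 \<le> y" for x
        using \<Psi>[of x] by (intro exI[of _ "\<psi>0 x"]) (simp add: \<psi>0_def)
    qed
    define N1 where "N1 = L1_norm tb (\<lambda>\<theta>. w1 \<theta> - w2 \<theta>)"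
    have N1: "\<Psi> 0 - \<Psi> (-tb) = N1" "0 \<le> N1"
    proof -
      have "(\<psi>0 has_integral \<Psi> 0 - \<Psi> (-tb)) {-tb..0}"
        using tb_pos \<Psi> by (intro fundamental_theorem_of_calculus)
          (auto simp: has_real_derivative_iff_has_vector_derivative[symmetric] intro: has_field_derivative_at_within)
      then have hi: "((\<lambda>\<theta>. norm (w1 \<theta> - w2 \<theta>)) has_integral \<Psi> 0 - \<Psi> (-tb)) {-tb..0}"
        by (rule has_integral_eq[rotated]) (auto simp: \<psi>0_def min_def max_def)
      have "continuous_on {-tb..0} (\<lambda>\<theta>. norm (w1 \<theta> - w2 \<theta>))"
        using w by (intro continuous_intros) (auto simp: bounded_hist_def intro: lipschitz_on_continuous_on)
      then have "integrable (lebesgue_on {-tb..0}) (\<lambda>\<theta>. norm (w1 \<theta> - w2 \<theta>))"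
        by (rule continuous_imp_integrable_real)
      then have "N1 = integral {-tb..0} (\<lambda>\<theta>. norm (w1 \<theta> - w2 \<theta>))"
        unfolding N1_def L1_norm_def by (simp add: lebesgue_integral_eq_integral)
      then show "\<Psi> 0 - \<Psi> (-tb) = N1" using integral_unique[OF hi] by simp
      then show "0 \<le> N1" using \<Psi>_mono[of "-tb" 0] tb_pos by simp
    qed
    have tail: "\<Psi> (tp - tm) - \<Psi> 0 = (tp - tm) * \<delta>"
    proof -
      have "(\<psi>0 has_integral \<Psi> (tp - tm) - \<Psi> 0) {0..tp - tm}"
        using t \<Psi> by (intro fundamental_theorem_of_calculus)
          (auto simp: has_real_derivative_iff_has_vector_derivative[symmetric] intro: has_field_derivative_at_within)
      then have "((\<lambda>_. \<delta>) has_integral \<Psi> (tp - tm) - \<Psi> 0) {0..tp - tm}"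
        by (rule has_integral_eq[rotated]) (use tb_pos in \<open>auto simp: \<psi>0_def \<delta>_def min_def max_def\<close>)
      moreover have "((\<lambda>_. \<delta>) has_integral (tp - tm) * \<delta>) {0..tp - tm}"
        using has_integral_const_real[of \<delta> 0 "tp - tm"] t by simp
      ultimately show ?thesis by (rule has_integral_unique)
    qed
    define I where "I = lf * (N1 + (T - t0) * \<delta>)"
    have "norm (u s) \<le> 2 * exp (4 * B * (tp - tm)) * (norm (u tm) + 0 * (tp - tm) + I / d)"
    proof (rule delayed_gronwall[OF u _ B _ d(1) _ _ _ _ _ s, where \<eta>=\<eta> and \<phi>="\<lambda>v. lf * \<psi>0 (v - tm)"
          and \<Phi>="\<lambda>v. lf * \<Psi> (v - tm)" and \<alpha>="tm - tb" and \<beta>=tp and K'=L])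
      show "L-lipschitz_on {tm..tp} \<eta>" unfolding \<eta>_def by (rule L(2)[OF adm w(2) traj(2)])
      show "\<eta> s \<in> {tm - tb..tp}" if "s \<in> {tm..tp}" for s using \<eta>rng[OF that] that by auto
      show "((\<lambda>v. lf * \<Psi> (v - tm)) has_real_derivative lf * \<psi>0 (v - tm)) (at v)" for v
      proof -
        have "((\<lambda>v. \<Psi> (v - tm)) has_real_derivative \<psi>0 (v - tm) * 1) (at v)"
          by (rule DERIV_chain2[OF \<Psi>]) (auto intro!: derivative_eq_intros)
        from DERIV_cmult[OF this, of lf] show ?thesis by simp
      qed
      show "0 \<le> lf * \<psi>0 (v - tm)" for v using lf by (simp add: \<psi>0_def)
      show "lf * \<Psi> (v - tm) - lf * \<Psi> (v' - tm) \<le> I" if "v \<in> {tm - tb..tp}" "v' \<in> {tm - tb..tp}" for v v'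
      proof -
        have "\<Psi> (v - tm) - \<Psi> (v' - tm) \<le> \<Psi> (tp - tm) - \<Psi> (-tb)"
          using that by (intro diff_mono \<Psi>_mono) auto
        also have "\<dots> = N1 + (tp - tm) * \<delta>" using N1 tail by simp
        also have "\<dots> \<le> N1 + (T - t0) * \<delta>" using t by (simp add: \<delta>_def mult_right_mono)
        finally show ?thesis using lf by (simp add: I_def flip: right_diff_distrib)
      qed
      show "AE s in lebesgue. s \<in> {tm<..<tp} \<longrightarrow>
        (\<exists>u' \<eta>' \<sigma>. (u has_vector_derivative u') (at s) \<and> (\<eta> has_real_derivative \<eta>') (at s) \<and>
        d \<le> \<eta>' \<and> \<sigma> \<in> {tm..s} \<and> norm u' \<le> B * (norm (u s) + norm (u \<sigma>)) + 0 + lf * \<psi>0 (\<eta> s - tm))"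
        using is_trajectoryD(2)[OF traj(1)] is_trajectoryD(2)[OF traj(2)] d(2)[OF adm w(2) traj(2)]
      proof eventually_elim
        case (elim s)
        show ?case
        proof
          assume s: "s \<in> {tm<..<tp}"
          let ?\<eta>1 = "s - tau (s, x1 s)"
          let ?f1 = "f (s, x1 s, x1 ?\<eta>1, \<alpha> s)" and ?f2 = "f (s, x2 s, x2 (\<eta> s), \<alpha> s)"
          have st: "s \<in> {t0..T}" "\<alpha> s \<in> A" using s t adm by (auto simp: admissible_def)
          have D: "(u has_vector_derivative ?f1 - ?f2) (at s)"
            unfolding u_def \<eta>_def using elim s by (intro has_vector_derivative_diff) auto
          obtain \<eta>' where \<eta>': "d \<le> \<eta>'" "(\<eta> has_real_derivative \<eta>') (at s)"
            using elim(3) s unfolding \<eta>_def by auto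
          define \<sigma> where "\<sigma> = max (\<eta> s) tm"
          have r1: "?\<eta>1 \<in> {tm - tb..tp}" "\<eta> s \<in> {tm - tb..tp}"
            using tau_range[OF st(1), of "x1 s"] \<eta>rng[of s] s by auto
          have \<sigma>: "\<sigma> \<in> {tm..s}" using \<eta>rng[of s] s by (auto simp: \<sigma>_def)
          have "norm (x1 ?\<eta>1 - x1 (\<eta> s)) \<le> M * norm (?\<eta>1 - \<eta> s)"
            by (rule lipschitz_on_normD[OF x1]) (use r1 in auto)
          also have "\<dots> \<le> M * (lt * norm (u s))"
            using RM lt(2)[OF st(1), of "x2 s" "x1 s"]
            by (intro mult_left_mono) (auto simp: \<eta>_def u_def norm_minus_commute)
          finally have 1: "norm (x1 ?\<eta>1 - x1 (\<eta> s)) \<le> M * (lt * norm (u s))" .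
          have 2: "norm (x1 (\<eta> s) - x2 (\<eta> s)) \<le> norm (u \<sigma>) + \<psi>0 (\<eta> s - tm)"
          proof (cases "tm \<le> \<eta> s")
            case True
            then show ?thesis by (simp add: \<sigma>_def u_def \<psi>0_def)
          next
            case False
            then have h: "\<eta> s \<in> {tm - tb..tm}" using r1 by auto
            have "max (-tb) (min 0 (\<eta> s - tm)) = \<eta> s - tm" using h by auto
            then have "norm (x1 (\<eta> s) - x2 (\<eta> s)) = \<psi>0 (\<eta> s - tm)"
              using trajectory_history[OF traj(1) h] trajectory_history[OF traj(2) h] by (simp add: \<psi>0_def)
            then show ?thesis by simp
          qed
          have "norm (x1 ?\<eta>1 - x2 (\<eta> s)) \<le> norm (x1 ?\<eta>1 - x1 (\<eta> s)) + norm (x1 (\<eta> s) - x2 (\<eta> s))"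
            using norm_triangle_ineq[of "x1 ?\<eta>1 - x1 (\<eta> s)" "x1 (\<eta> s) - x2 (\<eta> s)"] by simp
          with 1 2 have "norm (u s) + norm (x1 ?\<eta>1 - x2 (\<eta> s))
              \<le> (1 + M * lt) * norm (u s) + norm (u \<sigma>) + \<psi>0 (\<eta> s - tm)"
            by (simp add: algebra_simps)
          also have "\<dots> \<le> (1 + M * lt) * (norm (u s) + norm (u \<sigma>)) + \<psi>0 (\<eta> s - tm)"
            using RM lt by (simp add: algebra_simps)
          finally have "lf * (norm (u s) + norm (x1 ?\<eta>1 - x2 (\<eta> s)))
              \<le> lf * ((1 + M * lt) * (norm (u s) + norm (u \<sigma>)) + \<psi>0 (\<eta> s - tm))"
            using lf by (intro mult_left_mono) auto
          moreover have "norm (?f1 - ?f2) \<le> lf * (norm (u s) + norm (x1 ?\<eta>1 - x2 (\<eta> s)))"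
            unfolding u_def by (rule lf(2)[OF st])
          ultimately have "norm (?f1 - ?f2) \<le> B * (norm (u s) + norm (u \<sigma>)) + 0 + lf * \<psi>0 (\<eta> s - tm)"
            unfolding B_def by (simp add: algebra_simps)
          then show "\<exists>u' \<eta>' \<sigma>. (u has_vector_derivative u') (at s) \<and> (\<eta> has_real_derivative \<eta>') (at s) \<and>
            d \<le> \<eta>' \<and> \<sigma> \<in> {tm..s} \<and> norm u' \<le> B * (norm (u s) + norm (u \<sigma>)) + 0 + lf * \<psi>0 (\<eta> s - tm)"
            using D \<eta>' \<sigma> by blast
        qed
      qed
    qed simp
    also have "norm (u tm) = \<delta>"
      using trajectory_history[OF traj(1), of tm] trajectory_history[OF traj(2), of tm] tb_pos
      by (simp add: u_def \<delta>_def)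
    also have "2 * exp (4 * B * (tp - tm)) * (\<delta> + 0 * (tp - tm) + I / d) \<le> C * (\<delta> + N1)"
    proof -
      have \<delta>: "0 \<le> \<delta>" by (simp add: \<delta>_def)
      have "N1 + (T - t0) * \<delta> \<le> (1 + (T - t0)) * (\<delta> + N1)"
        using \<delta> mult_left_mono[of t0 T N1] N1(2) horizon by (simp add: algebra_simps)
      then have "I \<le> lf * ((1 + (T - t0)) * (\<delta> + N1))"
        unfolding I_def using lf by (intro mult_left_mono) auto
      then have "I / d \<le> lf * ((1 + (T - t0)) * (\<delta> + N1)) / d" using d by (intro divide_right_mono) auto
      then have "\<delta> + 0 * (tp - tm) + I / d \<le> (1 + lf * (1 + (T - t0)) / d) * (\<delta> + N1)"
        using \<delta> N1(2) by (simp add: algebra_simps add_divide_distrib)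
      moreover have "0 \<le> I" using lf N1 \<delta> horizon by (simp add: I_def)
      ultimately have "2 * exp (4 * B * (tp - tm)) * (\<delta> + 0 * (tp - tm) + I / d)
          \<le> 2 * exp (4 * B * (T - t0)) * ((1 + lf * (1 + (T - t0)) / d) * (\<delta> + N1))"
        using t B \<delta> d by (intro mult_mono) auto
      then show ?thesis by (simp add: C_def mult.assoc)
    qed
    finally show ?thesis by (simp add: u_def \<delta>_def N1_def)
  qed
  then show ?thesis using C by blast
qed

text \<open>Both choices of \<open>J\<close> contain the half-open interval, and a constant valid on
  \<open>J\<close> remains valid there.\<close>

lemma Lip_controls_imp_admissible:
  assumes t: "t0 \<le> tm" "tm < tp" "tp \<le> T"
    and J: "J = {tm..tp} \<or> J = {tm<..tp}" and \<alpha>: "\<alpha> \<in> Lip_controls J A"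
  shows "admissible tm tp \<alpha>" "(lip_const J \<alpha>)-lipschitz_on {tm<..tp} \<alpha>"
proof -
  have sub: "{tm<..tp} \<subseteq> J" using J by auto
  obtain K where K: "K-lipschitz_on J \<alpha>" "\<And>s. s \<in> J \<Longrightarrow> \<alpha> s \<in> A"
    using \<alpha> by (auto simp: Lip_controls_def)
  show lip: "(lip_const J \<alpha>)-lipschitz_on {tm<..tp} \<alpha>"
    by (rule lipschitz_on_subset[OF lip_const_lipschitz_on[OF K(1)] sub])
  show "admissible tm tp \<alpha>"
    unfolding admissible_def using t K(2) sub lipschitz_on_continuous_on[OF lip] by auto
qed

section \<open>Second-order estimate\<close>

lemma W_hist_imp_bounded_hist:
  assumes "w \<in> W_hist tb r" "0 < r"
  shows "bounded_hist r w"
  using W_hist_bounds[OF assms(1) tb_pos] assms(2) by (simp add: bounded_hist_def)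

lemma bounded_hist_average:
  assumes w: "bounded_hist r w1" "bounded_hist r w2"
  shows "bounded_hist r (\<lambda>\<theta>. (1/2) *\<^sub>R (w1 \<theta> + w2 \<theta>))"
  unfolding bounded_hist_def
proof
  have l: "r-lipschitz_on {-tb..0} w1" "r-lipschitz_on {-tb..0} w2"
    using w by (auto simp: bounded_hist_def)
  have "(\<bar>1/2\<bar> * (r + r))-lipschitz_on {-tb..0} (\<lambda>\<theta>. (1/2) *\<^sub>R (w1 \<theta> + w2 \<theta>))"
    by (rule lipschitz_on_cmult[OF lipschitz_on_add[OF l]])
  then show "r-lipschitz_on {-tb..0} (\<lambda>\<theta>. (1/2) *\<^sub>R (w1 \<theta> + w2 \<theta>))" by simp
  show "\<forall>\<theta>\<in>{-tb..0}. norm ((1/2) *\<^sub>R (w1 \<theta> + w2 \<theta>)) \<le> r"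
  proof
    fix \<theta> assume "\<theta> \<in> {-tb..0}"
    then have "norm (w1 \<theta>) \<le> r" "norm (w2 \<theta>) \<le> r" using w by (auto simp: bounded_hist_def)
    then show "norm ((1/2) *\<^sub>R (w1 \<theta> + w2 \<theta>)) \<le> r"
      using norm_triangle_ineq[of "w1 \<theta>" "w2 \<theta>"] by simp
  qed
qed

text \<open>Off the finite union of the two kink sets the derivative of the difference is the
  difference of the derivatives, so the bounds for a single function apply.\<close>

lemma W_hist_diff_bounds:
  fixes w1 w2 :: "real \<Rightarrow> real^'n"
  assumes w: "w1 \<in> W_hist tb r" "w2 \<in> W_hist tb r" and r: "0 < r"
    and \<epsilon>: "0 < \<epsilon>" "H1_norm tb (\<lambda>\<theta>. w1 \<theta> - w2 \<theta>) \<le> \<epsilon>"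
  obtains V where "continuous_on {-tb..0} V" "V (-tb) = 0" "V 0 \<le> (1 + tb) / 2 * \<epsilon>"
    "\<And>s t. \<lbrakk>-tb \<le> s; s \<le> t; t \<le> 0\<rbrakk> \<Longrightarrow> norm ((w1 t - w2 t) - (w1 s - w2 s)) \<le> V t - V s"
    "\<And>t. t \<in> {-tb..0} \<Longrightarrow> norm (w1 t - w2 t) \<le> (1 + tb) / 2 * (1 + 1 / tb) * \<epsilon>"
    "L1_norm tb (\<lambda>\<theta>. w1 \<theta> - w2 \<theta>) \<le> (1 + tb) / 2 * \<epsilon>"
proof -
  let ?E = "nonsmooth_points tb w1 \<union> nonsmooth_points tb w2"
  let ?v = "\<lambda>\<theta>. w1 \<theta> - w2 \<theta>"
  have E: "finite ?E" using finite_nonsmooth_points[OF w(1)] finite_nonsmooth_points[OF w(2)] by simp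
  have l: "(r + r)-lipschitz_on {-tb..0} ?v"
    using W_hist_bounds(2)[OF w(1) tb_pos] W_hist_bounds(2)[OF w(2) tb_pos] r
    by (intro lipschitz_on_diff) auto
  have D: "(?v has_vector_derivative hist_deriv tb w1 t - hist_deriv tb w2 t) (at t)"
    if "t \<in> {-tb<..<0} - ?E" for t
    using that by (intro has_vector_derivative_diff smooth_point_has_vector_derivative) auto
  have eq: "hist_deriv tb ?v t = hist_deriv tb w1 t - hist_deriv tb w2 t"
    if "t \<in> {-tb<..<0} - ?E" for t
    using D[OF that] that by (intro hist_deriv_eq) auto
  have bd: "AE t in lebesgue_on {-tb..0}. norm (hist_deriv tb ?v t) \<le> r + r"
    using W_hist_AE_hist_deriv_le[OF w(1)] W_hist_AE_hist_deriv_le[OF w(2)] finite_imp_AE_notin[OF E]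
    unfolding AE_lebesgue_on_Icc_iff
  proof eventually_elim
    case (elim t)
    show ?case
    proof
      assume t: "t \<in> {-tb<..<0}"
      have "hist_deriv tb ?v t = hist_deriv tb w1 t - hist_deriv tb w2 t" using elim t by (intro eq) auto
      moreover have "norm (hist_deriv tb w1 t) \<le> r" "norm (hist_deriv tb w2 t) \<le> r" using elim t by auto
      ultimately show "norm (hist_deriv tb ?v t) \<le> r + r"
        using norm_triangle_ineq4[of "hist_deriv tb w1 t" "hist_deriv tb w2 t"] by simp
    qed
  qed
  show thesis
    by (rule H1_norm_bounds[OF tb_pos l E _ bd \<epsilon>]) (use D eq in force, rule that)
qed

section \<open>Second differences along a single trajectory\<close>

text \<open>If no kink lies strictly within distance \<open>e\<close> of \<open>a\<close>, the
  interval is entirely in the history or entirely after \<open>tm\<close>, and the derivative is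
  Lipschitz there. Otherwise the crude bound \<open>2 * M * e\<close> is charged to the kernel of
  that kink, which is at least 1 because \<open>e \<le> h\<close>.\<close>

lemma trajectory_second_difference_bound:
  assumes r: "0 < r" and l: "0 \<le> l"
  shows "\<exists>K>0. \<forall>tm tp w \<alpha> x a e h. admissible tm tp \<alpha> \<and> l-lipschitz_on {tm<..tp} \<alpha> \<and>
    w \<in> W_hist tb r \<and> is_trajectory f tau tb tm tp w \<alpha> x \<and> 0 < h \<and> \<bar>e\<bar> \<le> h \<and>
    {a - \<bar>e\<bar>..a + \<bar>e\<bar>} \<subseteq> {tm - tb..tp} \<longrightarrow>
    norm (x (a + e) + x (a - e) - 2 *\<^sub>R x a)
      \<le> K * h\<^sup>2 + K * h * (\<Sum>p\<in>insert tm ((+) tm ` nonsmooth_points tb w). 2 / (1 + ((a - p) / h)\<^sup>2))"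
proof -
  obtain R M where RM: "R > 0" "M > 0" "\<And>tm tp w \<alpha> x. \<lbrakk>admissible tm tp \<alpha>; bounded_hist r w;
      is_trajectory f tau tb tm tp w \<alpha> x\<rbrakk> \<Longrightarrow>
      (\<forall>s\<in>{tm - tb..tp}. norm (x s) \<le> R) \<and> M-lipschitz_on {tm - tb..tp} x"
    using trajectory_bounds[OF r] by blast
  obtain L where L: "L > 0" "\<And>tm tp w \<alpha> x. \<lbrakk>admissible tm tp \<alpha>; bounded_hist r w;
      is_trajectory f tau tb tm tp w \<alpha> x\<rbrakk> \<Longrightarrow> L-lipschitz_on {tm..tp} (\<lambda>s. s - tau (s, x s))"
    using delay_time_lipschitz[OF r] by blast
  obtain f' where f': "has_C1_derivative_on f f' ({t0..T} \<times> UNIV \<times> UNIV \<times> A)"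
    using f_C1 by (auto simp: C1_on_def)
  have "\<exists>Lf. Lf-lipschitz_on ({t0..T} \<times> cball 0 R \<times> cball 0 R \<times> A) f"
    by (rule C1_derivative_lipschitz_on_compact_convex[OF f'])
      (auto intro!: compact_Times convex_Times A_set)
  then obtain Lf where Lf: "Lf-lipschitz_on ({t0..T} \<times> cball 0 R \<times> cball 0 R \<times> A) f" ..
  \<comment> \<open>Lipschitz constant of the right-hand side along a trajectory; the nested roots
    come from pairing time, state, delayed state and control. The constant \<open>l\<close> of the
    control enters here.\<close>
  define Kq where "Kq = Lf * sqrt (1\<^sup>2 + (sqrt (M\<^sup>2 + (sqrt ((M * L)\<^sup>2 + l\<^sup>2))\<^sup>2))\<^sup>2)"
  have Kq: "0 \<le> Kq" using lipschitz_on_nonneg[OF Lf] by (simp add: Kq_def)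
  define K where "K = 2 * (r + Kq + M)"
  have K: "0 < K" using r Kq RM by (simp add: K_def)
  have main: "norm (x (a + e) + x (a - e) - 2 *\<^sub>R x a)
      \<le> K * h\<^sup>2 + K * h * (\<Sum>p\<in>insert tm ((+) tm ` nonsmooth_points tb w). 2 / (1 + ((a - p) / h)\<^sup>2))"
    if adm: "admissible tm tp \<alpha>" and \<alpha>: "l-lipschitz_on {tm<..tp} \<alpha>" and w: "w \<in> W_hist tb r"
      and traj: "is_trajectory f tau tb tm tp w \<alpha> x" and h: "0 < h" and e: "0 \<le> e" "e \<le> h"
      and sub: "{a - e..a + e} \<subseteq> {tm - tb..tp}" for tm tp w \<alpha> x a e h
  proof -
    have t: "t0 \<le> tm" "tm < tp" "tp \<le> T" using adm by (auto simp: admissible_def)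
    have bw: "bounded_hist r w" by (rule W_hist_imp_bounded_hist[OF w r])
    have x: "\<And>s. s \<in> {tm - tb..tp} \<Longrightarrow> norm (x s) \<le> R" "M-lipschitz_on {tm - tb..tp} x"
      using RM(3)[OF adm bw traj] by auto
    define P where "P = insert tm ((+) tm ` nonsmooth_points tb w)"
    define \<kappa> where "\<kappa> p = 2 / (1 + ((a - p) / h)\<^sup>2)" for p
    have \<kappa>: "0 \<le> \<kappa> p" for p by (simp add: \<kappa>_def)
    have P: "finite P" using finite_nonsmooth_points[OF w] by (simp add: P_def)
    have ends: "tm - tb \<le> a - e" "a + e \<le> tp" using sub e by auto
    have xc: "continuous_on {a - e..a + e} x"
      by (rule continuous_on_subset[OF lipschitz_on_continuous_on[OF x(2)] sub])
    have "norm (x (a + e) + x (a - e) - 2 *\<^sub>R x a) \<le> K * h\<^sup>2 + K * h * (\<Sum>p\<in>P. \<kappa> p)"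
    proof (cases "e = 0 \<or> P \<inter> {a - e<..<a + e} = {}")
      case False
      then obtain p where "p \<in> P" "p \<in> {a - e<..<a + e}" by blast
      then have p: "p \<in> P" "\<bar>a - p\<bar> < e" by (simp_all add: abs_less_iff)
      have "\<bar>(a - p) / h\<bar> = \<bar>a - p\<bar> / h" using h by (simp only: abs_divide abs_of_pos)
      also have "\<dots> \<le> 1" using p e h by (simp only: divide_le_eq_1_pos)
      finally have "\<bar>(a - p) / h\<bar> \<le> 1" .
      then have "((a - p) / h)\<^sup>2 \<le> 1" by (simp add: abs_square_le_1)
      moreover have "0 < 1 + ((a - p) / h)\<^sup>2" by (simp add: add_pos_nonneg)
      ultimately have "1 \<le> \<kappa> p" by (simp add: \<kappa>_def field_simps)
      also have "\<dots> \<le> (\<Sum>p\<in>P. \<kappa> p)" by (rule member_le_sum[OF p(1)]) (use \<kappa> P in auto)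
      finally have "K * h * 1 \<le> K * h * (\<Sum>p\<in>P. \<kappa> p)" using K h by (intro mult_left_mono) auto
      moreover have "norm (x (a + e) + x (a - e) - 2 *\<^sub>R x a) \<le> K * h"
      proof -
        have "norm (x (a + e) - x a) \<le> M * norm (a + e - a)" "norm (x (a - e) - x a) \<le> M * norm (a - e - a)"
          by (rule lipschitz_on_normD[OF x(2)]; use ends e in simp)+
        moreover have "x (a + e) + x (a - e) - 2 *\<^sub>R x a = (x (a + e) - x a) + (x (a - e) - x a)"
          by (simp add: scaleR_2)
        ultimately have "norm (x (a + e) + x (a - e) - 2 *\<^sub>R x a) \<le> M * e + M * e"
          using norm_triangle_ineq[of "x (a + e) - x a" "x (a - e) - x a"] e by simp
        also have "\<dots> = (2 * M) * e" by simp
        also have "\<dots> \<le> K * h" using e RM Kq r by (intro mult_mono) (auto simp: K_def)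
        finally show ?thesis .
      qed
      moreover have "0 \<le> K * h\<^sup>2" using K by simp
      ultimately show ?thesis by simp
    next
      case True
      have "norm (x (a + e) + x (a - e) - 2 *\<^sub>R x a) \<le> 2 * (r + Kq) * e\<^sup>2"
      proof (cases "e = 0")
        case True
        then show ?thesis by (simp add: scaleR_2)
      next
        case False
        then have e0: "0 < e" and free: "P \<inter> {a - e<..<a + e} = {}" using True e by auto
        then have "tm \<notin> {a - e<..<a + e}" by (auto simp: P_def)
        then consider "a + e \<le> tm" | "tm \<le> a - e" using e0 by force
        then show ?thesis
        proof cases
          case 1
          define p where "p = a - e - tm"
          define p' where "p' = a + e - tm"
          have pp: "{p<..<p'} \<subseteq> {-tb<..<0}" using 1 ends by (auto simp: p_def p'_def)
          have sm: "{p<..<p'} \<inter> nonsmooth_points tb w = {}"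
          proof (rule ccontr)
            assume "{p<..<p'} \<inter> nonsmooth_points tb w \<noteq> {}"
            then obtain \<theta> where "\<theta> \<in> {p<..<p'}" "\<theta> \<in> nonsmooth_points tb w" by blast
            then have "tm + \<theta> \<in> P \<inter> {a - e<..<a + e}" by (auto simp: P_def p_def p'_def)
            then show False using free by auto
          qed
          have lip: "r-lipschitz_on {p<..<p'} (hist_deriv tb w)"
            by (rule hist_deriv_lipschitz_on_smooth_interval[OF w _ pp sm]) (use r in simp)
          have "norm (x (a + e) + x (a - e) - 2 *\<^sub>R x a) \<le> 2 * r * e\<^sup>2"
          proof (rule second_difference_le[OF e(1) xc, where q="\<lambda>s. hist_deriv tb w (s - tm)"])
            show "(x has_vector_derivative hist_deriv tb w (s - tm)) (at s)"
              if s: "s \<in> {a - e<..<a + e}" for s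
            proof -
              have "s - tm \<in> {p<..<p'}" using s by (auto simp: p_def p'_def)
              then have "(w has_vector_derivative hist_deriv tb w (s - tm)) (at (s - tm))"
                using pp sm by (intro smooth_point_has_vector_derivative) blast+
              moreover have "((\<lambda>s. s - tm) has_vector_derivative 1) (at s)"
                by (auto intro!: derivative_eq_intros)
              ultimately have "((w \<circ> (\<lambda>s. s - tm)) has_vector_derivative 1 *\<^sub>R hist_deriv tb w (s - tm)) (at s)"
                by (intro vector_diff_chain_at)
              then have "((\<lambda>s. w (s - tm)) has_vector_derivative hist_deriv tb w (s - tm)) (at s)"
                by (simp add: o_def)
              then show ?thesis
                by (rule has_vector_derivative_transform_within_open[of _ _ _ "{a - e<..<a + e}"])
                  (use s 1 ends in \<open>auto intro!: trajectory_history[OF traj, symmetric]\<close>)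
            qed
            show "r-lipschitz_on {a - e<..<a + e} (\<lambda>s. hist_deriv tb w (s - tm))"
            proof (rule lipschitz_onI)
              fix s s' assume s: "s \<in> {a - e<..<a + e}" "s' \<in> {a - e<..<a + e}"
              have "dist (hist_deriv tb w (s - tm)) (hist_deriv tb w (s' - tm)) \<le> r * dist (s - tm) (s' - tm)"
                by (rule lipschitz_onD[OF lip]) (use s in \<open>auto simp: p_def p'_def\<close>)
              then show "dist (hist_deriv tb w (s - tm)) (hist_deriv tb w (s' - tm)) \<le> r * dist s s'"
                by (simp add: dist_real_def)
            qed (use r in simp)
          qed
          also have "\<dots> \<le> 2 * (r + Kq) * e\<^sup>2" using Kq by (intro mult_right_mono) auto
          finally show ?thesis .
        next
          case 2
          define q where "q s = f (s, x s, x (s - tau (s, x s)), \<alpha> s)" for s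
          have \<eta>: "s - tau (s, x s) \<in> {tm - tb..s}" if "s \<in> {tm<..<tp}" for s
            using tau_range[of s "x s"] that t by auto
          have q: "Kq-lipschitz_on {tm<..<tp} q"
          proof -
            have l1: "M-lipschitz_on {tm<..<tp} x" by (rule lipschitz_on_subset[OF x(2)]) (use tb_pos in auto)
            have l2: "(M * L)-lipschitz_on {tm<..<tp} (\<lambda>s. x (s - tau (s, x s)))"
            proof (rule lipschitz_on_compose2[where f="\<lambda>s. s - tau (s, x s)" and g=x])
              show "L-lipschitz_on {tm<..<tp} (\<lambda>s. s - tau (s, x s))"
                by (rule lipschitz_on_subset[OF L(2)[OF adm bw traj]]) auto
              show "M-lipschitz_on ((\<lambda>s. s - tau (s, x s)) ` {tm<..<tp}) x"
                by (rule lipschitz_on_subset[OF x(2)]) (use \<eta> in fastforce)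
            qed
            have l3: "l-lipschitz_on {tm<..<tp} \<alpha>" by (rule lipschitz_on_subset[OF \<alpha>]) auto
            show ?thesis
              unfolding q_def Kq_def
            proof (rule lipschitz_on_compose2[where g=f])
              show "(sqrt (1\<^sup>2 + (sqrt (M\<^sup>2 + (sqrt ((M * L)\<^sup>2 + l\<^sup>2))\<^sup>2))\<^sup>2))-lipschitz_on {tm<..<tp}
                  (\<lambda>s. (s, x s, x (s - tau (s, x s)), \<alpha> s))"
                by (intro lipschitz_on_Pair lipschitz_on_id l1 l2 l3)
              show "Lf-lipschitz_on ((\<lambda>s. (s, x s, x (s - tau (s, x s)), \<alpha> s)) ` {tm<..<tp}) f"
              proof (rule lipschitz_on_subset[OF Lf])
                have "s \<in> {t0..T} \<and> norm (x s) \<le> R \<and> norm (x (s - tau (s, x s))) \<le> R \<and> \<alpha> s \<in> A"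
                  if s: "s \<in> {tm<..<tp}" for s
                  using s t tb_pos x(1)[of s] x(1)[of "s - tau (s, x s)"] \<eta>[OF s] adm
                  by (auto simp: admissible_def)
                then show "(\<lambda>s. (s, x s, x (s - tau (s, x s)), \<alpha> s)) ` {tm<..<tp}
                    \<subseteq> {t0..T} \<times> cball 0 R \<times> cball 0 R \<times> A" by auto
              qed
            qed
          qed
          have "norm (x (a + e) + x (a - e) - 2 *\<^sub>R x a) \<le> 2 * Kq * e\<^sup>2"
          proof (rule second_difference_le[OF e(1) xc, where q=q])
            \<comment> \<open>Since \<open>q\<close> is continuous along the trajectory, the state
              equation holds at every time of the open interval.\<close>
            show "(x has_vector_derivative q s) (at s)" if s: "s \<in> {a - e<..<a + e}" for s
            proof (rule AE_derivative_continuous_imp_derivative)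
              show "M-lipschitz_on {tm..tp} x" by (rule lipschitz_on_subset[OF x(2)]) (use tb_pos in auto)
              show "continuous_on {tm<..<tp} q" by (rule lipschitz_on_continuous_on[OF q])
              show "AE s in lebesgue. s \<in> {tm<..<tp} \<longrightarrow> (x has_vector_derivative q s) (at s)"
                using is_trajectoryD(2)[OF traj] by (simp add: q_def)
              show "s \<in> {tm<..<tp}" using s 2 ends by auto
            qed
            show "Kq-lipschitz_on {a - e<..<a + e} q"
              by (rule lipschitz_on_subset[OF q]) (use 2 ends in auto)
          qed
          also have "\<dots> \<le> 2 * (r + Kq) * e\<^sup>2" using r by (intro mult_right_mono) auto
          finally show ?thesis .
        qed
      qed
      also have "\<dots> \<le> K * h\<^sup>2"
        using e r Kq RM by (intro mult_mono power_mono) (auto simp: K_def)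
      also have "\<dots> \<le> K * h\<^sup>2 + K * h * (\<Sum>p\<in>P. \<kappa> p)"
        using K h \<kappa> by (simp add: sum_nonneg)
      finally show ?thesis .
    qed
    then show ?thesis by (simp only: P_def \<kappa>_def)
  qed
  have "norm (x (a + e) + x (a - e) - 2 *\<^sub>R x a)
      \<le> K * h\<^sup>2 + K * h * (\<Sum>p\<in>insert tm ((+) tm ` nonsmooth_points tb w). 2 / (1 + ((a - p) / h)\<^sup>2))"
    if asm: "admissible tm tp \<alpha>" "l-lipschitz_on {tm<..tp} \<alpha>" "w \<in> W_hist tb r"
      "is_trajectory f tau tb tm tp w \<alpha> x" "0 < h" "\<bar>e\<bar> \<le> h"
      "{a - \<bar>e\<bar>..a + \<bar>e\<bar>} \<subseteq> {tm - tb..tp}" for tm tp w \<alpha> x a e h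
  proof -
    \<comment> \<open>The second difference is even in \<open>e\<close>, so either order of the two
      delayed times is covered.\<close>
    have "x (a + e) + x (a - e) - 2 *\<^sub>R x a = x (a + \<bar>e\<bar>) + x (a - \<bar>e\<bar>) - 2 *\<^sub>R x a"
      by (cases "0 \<le> e") auto
    then show ?thesis using main[OF asm(1-5) _ asm(6,7)] by simp
  qed
  then show ?thesis using K by blast
qed

section \<open>Second difference of three trajectories\<close>

text \<open>The positive bound \<open>\<epsilon>\<close> replaces the norm itself, which may vanish, because \<open>h\<close> is divided by.\<close>

lemma trajectory_second_order_bound_aux:
  assumes r: "0 < r" and l: "0 \<le> l"
  shows "\<exists>C>0. \<forall>tm tp w1 w2 w3 \<alpha> x1 x2 x3 \<epsilon>. admissible tm tp \<alpha> \<and> l-lipschitz_on {tm<..tp} \<alpha> \<and>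
    w1 \<in> WN_hist tb r N \<and> w2 \<in> WN_hist tb r N \<and> w3 = (\<lambda>\<theta>. (1/2) *\<^sub>R (w1 \<theta> + w2 \<theta>)) \<and>
    is_trajectory f tau tb tm tp w1 \<alpha> x1 \<and> is_trajectory f tau tb tm tp w2 \<alpha> x2 \<and>
    is_trajectory f tau tb tm tp w3 \<alpha> x3 \<and> 0 < \<epsilon> \<and> H1_norm tb (\<lambda>\<theta>. w1 \<theta> - w2 \<theta>) \<le> \<epsilon> \<longrightarrow>
    (\<forall>s\<in>{tm..tp}. norm (x1 s + x2 s - 2 *\<^sub>R x3 s) \<le> C * \<epsilon>\<^sup>2)"
proof -
  obtain lf where lf: "lf > 0" "\<And>t z y z' y' a. \<lbrakk>t \<in> {t0..T}; a \<in> A\<rbrakk> \<Longrightarrow>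
      norm (f (t, z, y, a) - f (t, z', y', a)) \<le> lf * (norm (z - z') + norm (y - y'))"
    using f_lipschitz by metis
  obtain lt where lt: "lt > 0" "\<And>t z y. t \<in> {t0..T} \<Longrightarrow> \<bar>tau (t, z) - tau (t, y)\<bar> \<le> lt * norm (z - y)"
    using tau_lipschitz by metis
  obtain R M where RM: "R > 0" "M > 0" "\<And>tm tp w \<alpha> x. \<lbrakk>admissible tm tp \<alpha>; bounded_hist r w;
      is_trajectory f tau tb tm tp w \<alpha> x\<rbrakk> \<Longrightarrow>
      (\<forall>s\<in>{tm - tb..tp}. norm (x s) \<le> R) \<and> M-lipschitz_on {tm - tb..tp} x"
    using trajectory_bounds[OF r] by blast
  obtain L where L: "L > 0" "\<And>tm tp w \<alpha> x. \<lbrakk>admissible tm tp \<alpha>; bounded_hist r w;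
      is_trajectory f tau tb tm tp w \<alpha> x\<rbrakk> \<Longrightarrow> L-lipschitz_on {tm..tp} (\<lambda>s. s - tau (s, x s))"
    using delay_time_lipschitz[OF r] by blast
  obtain d where d: "d > 0" "\<And>tm tp w \<alpha> x. \<lbrakk>admissible tm tp \<alpha>; bounded_hist r w;
      is_trajectory f tau tb tm tp w \<alpha> x\<rbrakk> \<Longrightarrow> (AE s in lebesgue. s \<in> {tm<..<tp} \<longrightarrow>
      (\<exists>\<eta>'\<ge>d. ((\<lambda>s. s - tau (s, x s)) has_real_derivative \<eta>') (at s)))"
    using delay_time_derivative[OF r] by blast
  obtain C1 where C1: "C1 > 0" "\<And>tm tp w1 w2 \<alpha> x1 x2 s. \<lbrakk>admissible tm tp \<alpha>; bounded_hist r w1;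
      bounded_hist r w2; is_trajectory f tau tb tm tp w1 \<alpha> x1; is_trajectory f tau tb tm tp w2 \<alpha> x2;
      s \<in> {tm..tp}\<rbrakk> \<Longrightarrow>
      norm (x1 s - x2 s) \<le> C1 * (norm (w1 0 - w2 0) + L1_norm tb (\<lambda>\<theta>. w1 \<theta> - w2 \<theta>))"
    using trajectory_difference_bound[OF r] by blast
  obtain K where K: "K > 0" "\<And>tm tp w \<alpha> x a e h. \<lbrakk>admissible tm tp \<alpha>; l-lipschitz_on {tm<..tp} \<alpha>;
      w \<in> W_hist tb r; is_trajectory f tau tb tm tp w \<alpha> x; 0 < h; \<bar>e\<bar> \<le> h;
      {a - \<bar>e\<bar>..a + \<bar>e\<bar>} \<subseteq> {tm - tb..tp}\<rbrakk> \<Longrightarrow> norm (x (a + e) + x (a - e) - 2 *\<^sub>R x a)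
      \<le> K * h\<^sup>2 + K * h * (\<Sum>p\<in>insert tm ((+) tm ` nonsmooth_points tb w). 2 / (1 + ((a - p) / h)\<^sup>2))"
    using trajectory_second_difference_bound[OF r l] by blast
  obtain \<gamma>f where \<gamma>f: "\<gamma>f > 0" "\<And>t a z1 y1 z2 y2. \<lbrakk>t \<in> {t0..T}; a \<in> A; norm z1 \<le> R; norm y1 \<le> R;
      norm z2 \<le> R; norm y2 \<le> R\<rbrakk> \<Longrightarrow> norm (f (t, z1, y1, a) + f (t, z2, y2, a)
            - 2 *\<^sub>R f (t, (1/2) *\<^sub>R (z1 + z2), (1/2) *\<^sub>R (y1 + y2), a))
        \<le> \<gamma>f * ((norm (z1 - z2))\<^sup>2 + (norm (y1 - y2))\<^sup>2)"
  proof -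
    from f_second_diff[THEN spec, THEN mp, OF RM(1)] obtain \<gamma> where "\<gamma> > 0" and
      \<gamma>: "\<forall>t\<in>{t0..T}. \<forall>a\<in>A.
      \<forall>z1\<in>cball 0 R. \<forall>y1\<in>cball 0 R. \<forall>z2\<in>cball 0 R. \<forall>y2\<in>cball 0 R.
      norm (f (t, z1, y1, a) + f (t, z2, y2, a)
            - 2 *\<^sub>R f (t, (1/2) *\<^sub>R (z1 + z2), (1/2) *\<^sub>R (y1 + y2), a))
        \<le> \<gamma> * ((norm (z1 - z2))\<^sup>2 + (norm (y1 - y2))\<^sup>2)"
      by (elim exE conjE)
    show thesis by (rule that[OF \<open>\<gamma> > 0\<close>]) (rule \<gamma>[rule_format]; simp)
  qed
  obtain \<gamma>t where \<gamma>t: "\<gamma>t > 0" "\<And>t z1 z2. \<lbrakk>t \<in> {t0..T}; norm z1 \<le> R; norm z2 \<le> R\<rbrakk> \<Longrightarrow>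
      \<bar>tau (t, z1) + tau (t, z2) - 2 * tau (t, (1/2) *\<^sub>R (z1 + z2))\<bar> \<le> \<gamma>t * (norm (z1 - z2))\<^sup>2"
  proof -
    from tau_second_diff[THEN spec, THEN mp, OF RM(1)] obtain \<gamma> where "\<gamma> > 0" and
      \<gamma>: "\<forall>t\<in>{t0..T}. \<forall>z1\<in>cball 0 R. \<forall>z2\<in>cball 0 R.
      \<bar>tau (t, z1) + tau (t, z2) - 2 * tau (t, (1/2) *\<^sub>R (z1 + z2))\<bar> \<le> \<gamma> * (norm (z1 - z2))\<^sup>2"
      by (elim exE conjE)
    show thesis by (rule that[OF \<open>\<gamma> > 0\<close>]) (rule \<gamma>[rule_format]; simp)
  qed
  \<comment> \<open>In multiples of \<open>\<epsilon>\<close>: \<open>c0\<close> bounds the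
    variation and L^1 norm of \<open>w1 - w2\<close>, \<open>c1\<close> its supremum,
    \<open>c2\<close> the difference \<open>D\<close>, \<open>c3\<close> the difference of the
    delayed values, \<open>c4\<close> the Lipschitz constant of \<open>D\<close> after
    \<open>tm\<close>. In multiples of \<open>\<epsilon>\<^sup>2\<close>: \<open>c5\<close> collects
    the constant terms and \<open>c6\<close> the oscillation of \<open>\<Phi>\<close>.\<close>
  define c0 where "c0 = (1 + tb) / 2"
  define c1 where "c1 = c0 * (1 + 1 / tb)"
  define c2 where "c2 = C1 * (c1 + c0) + c1"
  define c3 where "c3 = (M * lt + 1) * c2"
  define c4 where "c4 = lf * (c2 + c3)"
  define c5 where "c5 = \<gamma>f * (c2\<^sup>2 + c3\<^sup>2) + lf * (M * (\<gamma>t * c2\<^sup>2)) + lf * (c4 * (lt * c2)) + lf * (K * (lt * c2)\<^sup>2)"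
  define c6 where "c6 = lf * (2 * (lt * c2) * c0) + lf * (K * (real (Suc N) * (2 * pi * (lt * c2)\<^sup>2)))"
  define B where "B = lf * (1 + M * lt)"
  define C where "C = 2 * exp (4 * B * (T - t0)) * (c5 * (T - t0) + c6 / d) + 1"
  have c0: "0 < c0" and c1: "0 < c1" using tb_pos by (auto simp: c0_def c1_def intro!: mult_pos_pos add_pos_pos)
  have c2: "0 < c2" using C1 c0 c1 by (simp add: c2_def add_pos_pos)
  have c3: "0 < c3" using RM lt c2 by (simp add: c3_def add_pos_pos)
  have c4: "0 < c4" using lf c2 c3 by (simp add: c4_def)
  have c5: "0 \<le> c5" using \<gamma>f \<gamma>t lf RM c4 lt c2 K by (simp add: c5_def)
  have c6: "0 \<le> c6" using lf lt c2 c0 K by (simp add: c6_def)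
  have B: "0 < B" using lf lt RM by (simp add: B_def add_pos_pos)
  have C: "0 < C" using c5 c6 d horizon unfolding C_def by (intro add_nonneg_pos) auto
  have "norm (x1 s + x2 s - 2 *\<^sub>R x3 s) \<le> C * \<epsilon>\<^sup>2"
    if adm: "admissible tm tp \<alpha>" and \<alpha>: "l-lipschitz_on {tm<..tp} \<alpha>"
      and wN: "w1 \<in> WN_hist tb r N" "w2 \<in> WN_hist tb r N" and w3: "w3 = (\<lambda>\<theta>. (1/2) *\<^sub>R (w1 \<theta> + w2 \<theta>))"
      and traj: "is_trajectory f tau tb tm tp w1 \<alpha> x1" "is_trajectory f tau tb tm tp w2 \<alpha> x2"
        "is_trajectory f tau tb tm tp w3 \<alpha> x3"
      and \<epsilon>: "0 < \<epsilon>" "H1_norm tb (\<lambda>\<theta>. w1 \<theta> - w2 \<theta>) \<le> \<epsilon>"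
      and s: "s \<in> {tm..tp}" for tm tp w1 w2 w3 \<alpha> x1 x2 x3 \<epsilon> s
  proof -
    have t: "t0 \<le> tm" "tm < tp" "tp \<le> T" using adm by (auto simp: admissible_def)
    have W: "w1 \<in> W_hist tb r" "w2 \<in> W_hist tb r" using wN by (auto simp: WN_hist_def)
    have w: "bounded_hist r w1" "bounded_hist r w2" using W r by (auto intro: W_hist_imp_bounded_hist)
    have bw3: "bounded_hist r w3" unfolding w3 by (rule bounded_hist_average[OF w])
    have x1: "\<And>s. s \<in> {tm - tb..tp} \<Longrightarrow> norm (x1 s) \<le> R" "M-lipschitz_on {tm - tb..tp} x1"
      and x2: "\<And>s. s \<in> {tm - tb..tp} \<Longrightarrow> norm (x2 s) \<le> R" "M-lipschitz_on {tm - tb..tp} x2"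
      and x3: "M-lipschitz_on {tm - tb..tp} x3"
      using RM(3)[OF adm w(1) traj(1)] RM(3)[OF adm w(2) traj(2)] RM(3)[OF adm bw3 traj(3)] by auto
    obtain V where V: "continuous_on {-tb..0} V" "V (-tb) = 0" "V 0 \<le> c0 * \<epsilon>"
      "\<And>s t. \<lbrakk>-tb \<le> s; s \<le> t; t \<le> 0\<rbrakk> \<Longrightarrow> norm ((w1 t - w2 t) - (w1 s - w2 s)) \<le> V t - V s"
      "\<And>t. t \<in> {-tb..0} \<Longrightarrow> norm (w1 t - w2 t) \<le> c1 * \<epsilon>"
      "L1_norm tb (\<lambda>\<theta>. w1 \<theta> - w2 \<theta>) \<le> c0 * \<epsilon>"
      using W_hist_diff_bounds[OF W r \<epsilon>] unfolding c0_def c1_def by blast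
    have Vmono: "V s \<le> V t" if "-tb \<le> s" "s \<le> t" "t \<le> 0" for s t
      using order_trans[OF norm_ge_zero V(4)[OF that]] by simp
    define D where "D s = x1 s - x2 s" for s
    have D_hist: "D s = w1 (s - tm) - w2 (s - tm)" if "s \<in> {tm - tb..tm}" for s
      using trajectory_history[OF traj(1) that] trajectory_history[OF traj(2) that] by (simp add: D_def)
    have D: "norm (D s) \<le> c2 * \<epsilon>" if s: "s \<in> {tm - tb..tp}" for s
    proof (cases "s \<le> tm")
      case True
      then have "norm (D s) \<le> c1 * \<epsilon>" using s D_hist[of s] V(5)[of "s - tm"] by simp
      also have "\<dots> \<le> c2 * \<epsilon>" using \<epsilon> C1 c0 c1 by (intro mult_right_mono) (auto simp: c2_def)
      finally show ?thesis .
    next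
      case False
      then have "norm (D s) \<le> C1 * (norm (w1 0 - w2 0) + L1_norm tb (\<lambda>\<theta>. w1 \<theta> - w2 \<theta>))"
        unfolding D_def using s by (intro C1(2)[OF adm w traj(1,2)]) auto
      also have "\<dots> \<le> C1 * (c1 * \<epsilon> + c0 * \<epsilon>)"
        using V(5)[of 0] V(6) C1 tb_pos by (intro mult_left_mono add_mono) auto
      also have "\<dots> \<le> c2 * \<epsilon>" using \<epsilon> c1 by (simp add: c2_def algebra_simps)
      finally show ?thesis .
    qed
    define h where "h = lt * c2 * \<epsilon>"
    have h: "0 < h" using lt c2 \<epsilon> by (simp add: h_def)
    define \<eta>1 where "\<eta>1 s = s - tau (s, x1 s)" for s
    define \<eta>2 where "\<eta>2 s = s - tau (s, x2 s)" for s
    define \<eta>3 where "\<eta>3 s = s - tau (s, x3 s)" for s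
    define \<eta> where "\<eta> s = (\<eta>1 s + \<eta>2 s) / 2" for s
    have rng: "\<eta>1 s \<in> {tm - tb..s}" "\<eta>2 s \<in> {tm - tb..s}" "\<eta>3 s \<in> {tm - tb..s}" "\<eta> s \<in> {tm - tb..s}"
      if "s \<in> {tm..tp}" for s
      using tau_range[of s "x1 s"] tau_range[of s "x2 s"] tau_range[of s "x3 s"] that t
      by (auto simp: \<eta>1_def \<eta>2_def \<eta>3_def \<eta>_def)
    have \<eta>12: "\<bar>\<eta>1 s - \<eta>2 s\<bar> \<le> h" if "s \<in> {tm..tp}" for s
    proof -
      have "\<bar>\<eta>1 s - \<eta>2 s\<bar> \<le> lt * norm (D s)"
        using lt(2)[of s "x2 s" "x1 s"] that t by (simp add: \<eta>1_def \<eta>2_def D_def norm_minus_commute)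
      also have "\<dots> \<le> lt * (c2 * \<epsilon>)" using D[of s] that lt tb_pos by (intro mult_left_mono) auto
      finally show ?thesis by (simp add: h_def)
    qed
    have y12: "norm (x1 (\<eta>1 s) - x2 (\<eta>2 s)) \<le> c3 * \<epsilon>" if s: "s \<in> {tm..tp}" for s
    proof -
      have "norm (x1 (\<eta>1 s) - x1 (\<eta>2 s)) \<le> M * norm (\<eta>1 s - \<eta>2 s)"
        by (rule lipschitz_on_normD[OF x1(2)]) (use rng[OF s] s in auto)
      also have "\<dots> \<le> M * h" using \<eta>12[OF s] RM by (intro mult_left_mono) auto
      finally have 1: "norm (x1 (\<eta>1 s) - x1 (\<eta>2 s)) \<le> M * h" .
      have 2: "norm (x1 (\<eta>2 s) - x2 (\<eta>2 s)) \<le> c2 * \<epsilon>"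
        using D[of "\<eta>2 s"] rng(2)[OF s] s by (simp add: D_def)
      have "norm (x1 (\<eta>1 s) - x2 (\<eta>2 s)) \<le> M * h + c2 * \<epsilon>"
        using norm_triangle_ineq[of "x1 (\<eta>1 s) - x1 (\<eta>2 s)" "x1 (\<eta>2 s) - x2 (\<eta>2 s)"] 1 2 by simp
      then show ?thesis by (simp add: c3_def h_def algebra_simps)
    qed
    have Dlip: "(c4 * \<epsilon>)-lipschitz_on {tm..tp} D"
    proof (rule AE_norm_derivative_le_imp_lipschitz)
      show "(M + M)-lipschitz_on {tm..tp} D"
        unfolding D_def
        by (rule lipschitz_on_diff; rule lipschitz_on_subset[OF x1(2)] lipschitz_on_subset[OF x2(2)])
          (use tb_pos in auto)
      show "0 \<le> c4 * \<epsilon>" using c4 \<epsilon> by simp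
      show "AE s in lebesgue. s \<in> {tm<..<tp} \<longrightarrow>
          (\<exists>u'. (D has_vector_derivative u') (at s) \<and> norm u' \<le> c4 * \<epsilon>)"
        using is_trajectoryD(2)[OF traj(1)] is_trajectoryD(2)[OF traj(2)]
      proof eventually_elim
        case (elim s)
        show ?case
        proof
          assume s: "s \<in> {tm<..<tp}"
          let ?f1 = "f (s, x1 s, x1 (\<eta>1 s), \<alpha> s)" and ?f2 = "f (s, x2 s, x2 (\<eta>2 s), \<alpha> s)"
          have st: "s \<in> {t0..T}" "\<alpha> s \<in> A" using s t adm by (auto simp: admissible_def)
          have "(D has_vector_derivative ?f1 - ?f2) (at s)"
            unfolding D_def \<eta>1_def \<eta>2_def using elim s by (intro has_vector_derivative_diff) auto
          moreover have "norm (?f1 - ?f2) \<le> c4 * \<epsilon>"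
          proof -
            have "norm (?f1 - ?f2) \<le> lf * (norm (D s) + norm (x1 (\<eta>1 s) - x2 (\<eta>2 s)))"
              unfolding D_def by (rule lf(2)[OF st])
            also have "\<dots> \<le> lf * (c2 * \<epsilon> + c3 * \<epsilon>)"
              using D[of s] y12[of s] s lf tb_pos by (intro mult_left_mono add_mono) auto
            finally show ?thesis by (simp add: c4_def algebra_simps)
          qed
          ultimately show "\<exists>u'. (D has_vector_derivative u') (at s) \<and> norm u' \<le> c4 * \<epsilon>" by blast
        qed
      qed
    qed
    \<comment> \<open>The variation is continued constantly, since the window from
      \<open>v - h\<close> to \<open>v + h\<close> may leave the history.\<close>
    define Vt where "Vt v = V (max (-tb) (min 0 (v - tm)))" for v
    have Vt_mono: "Vt v \<le> Vt v'" if "v \<le> v'" for v v'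
      unfolding Vt_def using that tb_pos by (intro Vmono) auto
    have Vt_range: "0 \<le> Vt v" "Vt v \<le> c0 * \<epsilon>" for v
    proof -
      have "V (-tb) \<le> Vt v" unfolding Vt_def using tb_pos by (intro Vmono) auto
      then show "0 \<le> Vt v" using V(2) by simp
      have "Vt v \<le> V 0" unfolding Vt_def using tb_pos by (intro Vmono) auto
      then show "Vt v \<le> c0 * \<epsilon>" using V(3) by simp
    qed
    have "continuous_on UNIV Vt"
      unfolding Vt_def
      by (rule continuous_on_compose2[OF V(1)]) (use tb_pos in \<open>auto intro!: continuous_intros\<close>)
    then obtain F where F: "\<And>v. (F has_real_derivative Vt v) (at v)"
      using continuous_imp_antiderivative by blast
    \<comment> \<open>The difference is the integral of \<open>Vt\<close> over a window of width
      \<open>2 * h\<close>: one factor \<open>\<epsilon>\<close> comes from \<open>h\<close>, the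
      other from the total variation.\<close>
    have F_diff: "0 \<le> F (v + h) - F (v - h)" "F (v + h) - F (v - h) \<le> 2 * h * (c0 * \<epsilon>)" for v
    proof -
      obtain z where "F (v + h) - F (v - h) = ((v + h) - (v - h)) * Vt z"
        using MVT2[of "v - h" "v + h" F Vt] F h by auto
      then have eq: "F (v + h) - F (v - h) = 2 * h * Vt z" by simp
      show "0 \<le> F (v + h) - F (v - h)" unfolding eq using h Vt_range by simp
      show "F (v + h) - F (v - h) \<le> 2 * h * (c0 * \<epsilon>)"
        unfolding eq using h Vt_range by (intro mult_left_mono) auto
    qed
    have D_incr: "norm (D v' - D v) \<le> (Vt v' - Vt v) + c4 * \<epsilon> * (v' - v)"
      if v: "tm - tb \<le> v" "v \<le> v'" "v' \<le> tp" for v v'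
    proof -
      have left: "norm (D b - D a) \<le> Vt b - Vt a" if "tm - tb \<le> a" "a \<le> b" "b \<le> tm" for a b
        using V(4)[of "a - tm" "b - tm"] that D_hist[of a] D_hist[of b] by (simp add: Vt_def)
      have right: "norm (D b - D a) \<le> c4 * \<epsilon> * (b - a)" if "tm \<le> a" "a \<le> b" "b \<le> tp" for a b
        using lipschitz_on_normD[OF Dlip, of b a] that by simp
      have nn: "0 \<le> Vt v' - Vt v" "0 \<le> c4 * \<epsilon> * (v' - v)" using Vt_mono v c4 \<epsilon> by auto
      consider "v' \<le> tm" | "tm \<le> v" | "v \<le> tm" "tm \<le> v'" by linarith
      then show ?thesis
      proof cases
        case 1
        then show ?thesis using left[of v v'] v nn by simp
      next
        case 2
        then show ?thesis using right[of v v'] v nn by simp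
      next
        case 3
        have "norm (D v' - D v) \<le> norm (D v' - D tm) + norm (D tm - D v)"
          using norm_triangle_ineq[of "D v' - D tm" "D tm - D v"] by simp
        also have "\<dots> \<le> c4 * \<epsilon> * (v' - tm) + (Vt tm - Vt v)"
          using left[of v tm] right[of tm v'] 3 v by (intro add_mono) auto
        also have "c4 * \<epsilon> * (v' - tm) \<le> c4 * \<epsilon> * (v' - v)"
          using 3 c4 \<epsilon> by (intro mult_left_mono) auto
        also have "Vt tm \<le> Vt v'" by (rule Vt_mono[OF 3(2)])
        finally show ?thesis by simp
      qed
    qed
    define P where "P = insert tm ((+) tm ` nonsmooth_points tb w2)"
    have P: "finite P" "card P \<le> Suc N"
    proof -
      have fin: "finite (nonsmooth_points tb w2)" by (rule finite_nonsmooth_points[OF W(2)])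
      then show "finite P" by (simp add: P_def)
      have "card P \<le> Suc (card ((+) tm ` nonsmooth_points tb w2))"
        unfolding P_def by (rule card_insert_le_m1) (use fin in auto)
      also have "\<dots> \<le> Suc N"
        using card_image_le[OF fin, of "(+) tm"] wN(2) by (simp add: WN_hist_def)
      finally show "card P \<le> Suc N" .
    qed
    define \<phi> where "\<phi> v = lf * (Vt (v + h) - Vt (v - h))
        + lf * (K * h * (\<Sum>p\<in>P. 2 / (1 + ((v - p) / h)\<^sup>2)))" for v
    \<comment> \<open>Each arctangent term increases by at most \<open>2 * h * pi\<close> over the
      whole line; together with the prefactor \<open>K * h\<close> this has order
      \<open>h\<^sup>2\<close> per kink.\<close>
    define \<Phi> where "\<Phi> v = lf * (F (v + h) - F (v - h))
        + lf * (K * h * (\<Sum>p\<in>P. 2 * h * arctan ((v - p) / h)))" for v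
    have \<Phi>_deriv: "(\<Phi> has_real_derivative \<phi> v) (at v)" for v
    proof -
      have 1: "((\<lambda>v. F (v + h)) has_real_derivative Vt (v + h) * 1) (at v)"
        by (rule DERIV_chain2[OF F]) (auto intro!: derivative_eq_intros)
      have 2: "((\<lambda>v. F (v - h)) has_real_derivative Vt (v - h) * 1) (at v)"
        by (rule DERIV_chain2[OF F]) (auto intro!: derivative_eq_intros)
      have 3: "((\<lambda>v. 2 * h * arctan ((v - p) / h)) has_real_derivative 2 / (1 + ((v - p) / h)\<^sup>2)) (at v)" for p
      proof -
        have "((\<lambda>v. arctan ((v - p) / h)) has_real_derivative inverse (1 + ((v - p) / h)\<^sup>2) * (1 / h)) (at v)"
          by (rule DERIV_chain2[OF DERIV_arctan]) (use h in \<open>auto intro!: derivative_eq_intros\<close>)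
        from DERIV_cmult[OF this, of "2 * h"]
        have "((\<lambda>v. 2 * h * arctan ((v - p) / h)) has_real_derivative
            2 * h * (inverse (1 + ((v - p) / h)\<^sup>2) * (1 / h))) (at v)" .
        moreover have "2 * h * (inverse X * (1 / h)) = 2 / X" for X using h by (simp add: divide_inverse)
        ultimately show ?thesis by simp
      qed
      have "(\<Phi> has_real_derivative lf * (Vt (v + h) * 1 - Vt (v - h) * 1)
          + lf * (K * h * (\<Sum>p\<in>P. 2 / (1 + ((v - p) / h)\<^sup>2)))) (at v)"
        unfolding \<Phi>_def by (intro DERIV_add DERIV_cmult DERIV_diff 1 2 DERIV_sum 3)
      then show ?thesis by (simp add: \<phi>_def)
    qed
    have \<phi>_nonneg: "0 \<le> \<phi> v" for v
      unfolding \<phi>_def using lf K h Vt_mono[of "v - h" "v + h"]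
      by (intro add_nonneg_nonneg mult_nonneg_nonneg sum_nonneg divide_nonneg_nonneg) auto
    have \<Phi>_osc: "\<Phi> v - \<Phi> v' \<le> c6 * \<epsilon>\<^sup>2" for v v'
    proof -
      have 1: "(F (v + h) - F (v - h)) - (F (v' + h) - F (v' - h)) \<le> 2 * h * (c0 * \<epsilon>)"
        using F_diff(2)[of v] F_diff(1)[of v'] by linarith
      have "(\<Sum>p\<in>P. 2 * h * arctan ((v - p) / h)) - (\<Sum>p\<in>P. 2 * h * arctan ((v' - p) / h))
          = (\<Sum>p\<in>P. 2 * h * (arctan ((v - p) / h) - arctan ((v' - p) / h)))"
        by (simp add: sum_subtractf right_diff_distrib)
      also have "\<dots> \<le> (\<Sum>p\<in>P. 2 * h * pi)"
      proof (rule sum_mono)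
        fix p
        have "arctan ((v - p) / h) - arctan ((v' - p) / h) \<le> pi"
          using arctan_ubound[of "(v - p) / h"] arctan_lbound[of "(v' - p) / h"] by linarith
        then show "2 * h * (arctan ((v - p) / h) - arctan ((v' - p) / h)) \<le> 2 * h * pi"
          using h by (intro mult_left_mono) auto
      qed
      also have "\<dots> = real (card P) * (2 * h * pi)" by simp
      also have "\<dots> \<le> real (Suc N) * (2 * h * pi)" using P(2) h by (intro mult_right_mono) auto
      finally have 2: "(\<Sum>p\<in>P. 2 * h * arctan ((v - p) / h)) - (\<Sum>p\<in>P. 2 * h * arctan ((v' - p) / h))
          \<le> real (Suc N) * (2 * h * pi)" .
      have "\<Phi> v - \<Phi> v' = lf * ((F (v + h) - F (v - h)) - (F (v' + h) - F (v' - h)))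
        + lf * (K * h * ((\<Sum>p\<in>P. 2 * h * arctan ((v - p) / h)) - (\<Sum>p\<in>P. 2 * h * arctan ((v' - p) / h))))"
        unfolding \<Phi>_def right_diff_distrib by simp
      also have "\<dots> \<le> lf * (2 * h * (c0 * \<epsilon>)) + lf * (K * h * (real (Suc N) * (2 * h * pi)))"
        using lf K h by (intro add_mono mult_left_mono 1 2) auto
      also have "\<dots> = c6 * \<epsilon>\<^sup>2"
        unfolding c6_def h_def by (simp only: power2_eq_square) (simp add: algebra_simps)
      finally show ?thesis .
    qed
    define u where "u s = x1 s + x2 s - 2 *\<^sub>R x3 s" for s
    have u_hist: "u s = 0" if "s \<in> {tm - tb..tm}" for s
      using trajectory_history[OF traj(1) that] trajectory_history[OF traj(2) that]
        trajectory_history[OF traj(3) that] by (simp add: u_def w3)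
    have ul: "(M + M + 2 * M)-lipschitz_on {tm..tp} u"
    proof -
      have sub: "{tm..tp} \<subseteq> {tm - tb..tp}" using tb_pos by auto
      have "(\<bar>2\<bar> * M)-lipschitz_on {tm..tp} (\<lambda>s. 2 *\<^sub>R x3 s)"
        by (rule lipschitz_on_cmult[OF lipschitz_on_subset[OF x3 sub]])
      then have "(2 * M)-lipschitz_on {tm..tp} (\<lambda>s. 2 *\<^sub>R x3 s)" by simp
      then show ?thesis unfolding u_def
        by (intro lipschitz_on_diff lipschitz_on_add lipschitz_on_subset[OF x1(2) sub]
            lipschitz_on_subset[OF x2(2) sub])
    qed
    have "norm (u s) \<le> 2 * exp (4 * B * (tp - tm)) * (norm (u tm) + c5 * \<epsilon>\<^sup>2 * (tp - tm) + c6 * \<epsilon>\<^sup>2 / d)"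
    proof (rule delayed_gronwall[OF ul _ B _ d(1) _ \<Phi>_deriv \<phi>_nonneg \<Phi>_osc _ s, where \<eta>=\<eta>
          and \<alpha>="tm - tb" and \<beta>=tp and K'=L])
      show "L-lipschitz_on {tm..tp} \<eta>"
      proof -
        have "(\<bar>1/2\<bar> * (L + L))-lipschitz_on {tm..tp} (\<lambda>s. 1/2 * (\<eta>1 s + \<eta>2 s))"
          unfolding \<eta>1_def \<eta>2_def
          by (intro lipschitz_on_cmult_real lipschitz_on_add L(2)[OF adm w(1) traj(1)] L(2)[OF adm w(2) traj(2)])
        then show ?thesis by (simp add: \<eta>_def[abs_def])
      qed
      show "0 \<le> c5 * \<epsilon>\<^sup>2" using c5 by simp
      show "\<eta> s \<in> {tm - tb..tp}" if "s \<in> {tm..tp}" for s using rng(4)[OF that] that by auto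
      show "AE s in lebesgue. s \<in> {tm<..<tp} \<longrightarrow>
        (\<exists>u' \<eta>' \<sigma>. (u has_vector_derivative u') (at s) \<and> (\<eta> has_real_derivative \<eta>') (at s) \<and>
        d \<le> \<eta>' \<and> \<sigma> \<in> {tm..s} \<and> norm u' \<le> B * (norm (u s) + norm (u \<sigma>)) + c5 * \<epsilon>\<^sup>2 + \<phi> (\<eta> s))"
        using is_trajectoryD(2)[OF traj(1)] is_trajectoryD(2)[OF traj(2)] is_trajectoryD(2)[OF traj(3)]
          d(2)[OF adm w(1) traj(1)] d(2)[OF adm w(2) traj(2)]
      proof eventually_elim
        case (elim s)
        show ?case
        proof
          assume s: "s \<in> {tm<..<tp}"
          then have s': "s \<in> {tm..tp}" "s \<in> {tm - tb..tp}" using tb_pos by auto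
          have st: "s \<in> {t0..T}" "\<alpha> s \<in> A" using s t adm by (auto simp: admissible_def)
          let ?f1 = "f (s, x1 s, x1 (\<eta>1 s), \<alpha> s)" and ?f2 = "f (s, x2 s, x2 (\<eta>2 s), \<alpha> s)"
          let ?f3 = "f (s, x3 s, x3 (\<eta>3 s), \<alpha> s)"
          \<comment> \<open>The midpoints \<open>xb\<close> and \<open>yb\<close> separate two
            effects: the second difference of \<open>f\<close> about them, and a Lipschitz step from
            them to the arguments of \<open>x3\<close>, measured by \<open>u s\<close> and
            \<open>Y\<close>.\<close>
          define xb where "xb = (1/2) *\<^sub>R (x1 s + x2 s)"
          define yb where "yb = (1/2) *\<^sub>R (x1 (\<eta>1 s) + x2 (\<eta>2 s))"
          let ?fb = "f (s, xb, yb, \<alpha> s)"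
          define Y where "Y = x1 (\<eta>1 s) + x2 (\<eta>2 s) - 2 *\<^sub>R x3 (\<eta>3 s)"
          have udv: "(u has_vector_derivative ?f1 + ?f2 - 2 *\<^sub>R ?f3) (at s)"
          proof -
            have "((\<lambda>s. 2 *\<^sub>R x3 s) has_vector_derivative 2 *\<^sub>R ?f3) (at s)"
              using elim s unfolding \<eta>3_def
              by (intro bounded_linear.has_vector_derivative[OF bounded_linear_scaleR_right]) auto
            then show ?thesis
              unfolding u_def \<eta>1_def \<eta>2_def using elim s
              by (intro has_vector_derivative_diff has_vector_derivative_add) auto
          qed
          obtain e1 e2 where e12: "d \<le> e1" "(\<eta>1 has_real_derivative e1) (at s)"
            "d \<le> e2" "(\<eta>2 has_real_derivative e2) (at s)"
            using elim(4,5) s unfolding \<eta>1_def \<eta>2_def by auto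
          have \<eta>': "(\<eta> has_real_derivative (e1 + e2) / 2) (at s)"
            unfolding \<eta>_def by (intro DERIV_cdivide DERIV_add e12)
          define \<sigma> where "\<sigma> = max (\<eta> s) tm"
          have \<sigma>: "\<sigma> \<in> {tm..s}" using rng(4)[OF s'(1)] s by (auto simp: \<sigma>_def)
          have u\<eta>: "norm (u (\<eta> s)) \<le> norm (u \<sigma>)"
            using u_hist[of "\<eta> s"] rng(4)[OF s'(1)] by (cases "tm \<le> \<eta> s") (auto simp: \<sigma>_def)
          \<comment> \<open>\<open>\<eta> - \<eta>3\<close> is split at \<open>tau (s, xb)\<close>:
            the second difference of \<open>tau\<close> is quadratic in \<open>D\<close>, and the
            rest is linear in \<open>u s\<close>, which Gronwall absorbs.\<close>
          have x3b: "norm (2 *\<^sub>R (x3 (\<eta> s) - x3 (\<eta>3 s))) \<le> M * (\<gamma>t * (c2 * \<epsilon>)\<^sup>2 + lt * norm (u s))"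
          proof -
            have "\<bar>tau (s, x1 s) + tau (s, x2 s) - 2 * tau (s, xb)\<bar> \<le> \<gamma>t * (norm (D s))\<^sup>2"
              unfolding xb_def D_def by (rule \<gamma>t(2)[OF st(1) x1(1)[OF s'(2)] x2(1)[OF s'(2)]])
            also have "\<dots> \<le> \<gamma>t * (c2 * \<epsilon>)\<^sup>2"
              using \<gamma>t D[OF s'(2)] by (intro mult_left_mono power_mono) auto
            finally have 1: "\<bar>tau (s, x1 s) + tau (s, x2 s) - 2 * tau (s, xb)\<bar> \<le> \<gamma>t * (c2 * \<epsilon>)\<^sup>2" .
            have "2 * \<bar>tau (s, xb) - tau (s, x3 s)\<bar> \<le> 2 * (lt * norm (xb - x3 s))"
              using lt(2)[OF st(1), of xb "x3 s"] by simp
            also have "2 * norm (xb - x3 s) = norm (u s)"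
            proof -
              have "u s = 2 *\<^sub>R (xb - x3 s)" by (simp add: u_def xb_def scaleR_diff_right)
              then show ?thesis by simp
            qed
            then have "2 * (lt * norm (xb - x3 s)) = lt * norm (u s)" by simp
            finally have 2: "2 * \<bar>tau (s, xb) - tau (s, x3 s)\<bar> \<le> lt * norm (u s)" .
            have "2 * \<bar>\<eta> s - \<eta>3 s\<bar> = \<bar>(tau (s, x1 s) + tau (s, x2 s) - 2 * tau (s, xb))
                + 2 * (tau (s, xb) - tau (s, x3 s))\<bar>"
              by (simp add: \<eta>_def \<eta>1_def \<eta>2_def \<eta>3_def field_simps abs_if)
            also have "\<dots> \<le> \<gamma>t * (c2 * \<epsilon>)\<^sup>2 + lt * norm (u s)"
              using 1 2 by (simp add: abs_if split: if_splits)
            finally have 3: "2 * \<bar>\<eta> s - \<eta>3 s\<bar> \<le> \<gamma>t * (c2 * \<epsilon>)\<^sup>2 + lt * norm (u s)" .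
            have "norm (x3 (\<eta> s) - x3 (\<eta>3 s)) \<le> M * norm (\<eta> s - \<eta>3 s)"
              by (rule lipschitz_on_normD[OF x3]) (use rng[OF s'(1)] s' in auto)
            then have "norm (2 *\<^sub>R (x3 (\<eta> s) - x3 (\<eta>3 s))) \<le> M * (2 * \<bar>\<eta> s - \<eta>3 s\<bar>)" by simp
            also have "\<dots> \<le> M * (\<gamma>t * (c2 * \<epsilon>)\<^sup>2 + lt * norm (u s))"
              using RM 3 by (intro mult_left_mono) auto
            finally show ?thesis .
          qed
          \<comment> \<open>Centering at the mean delayed time makes \<open>\<eta>1\<close> and
            \<open>\<eta>2\<close> symmetric, as the second difference of \<open>x2\<close>
            requires.\<close>
          define e where "e = (\<eta>1 s - \<eta>2 s) / 2"
          have e: "\<bar>e\<bar> \<le> h" using \<eta>12[OF s'(1)] by (simp add: e_def)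
          have \<eta>e: "\<eta>1 s = \<eta> s + e" "\<eta>2 s = \<eta> s - e" by (auto simp: \<eta>_def e_def field_simps)
          have sub: "{\<eta> s - \<bar>e\<bar>..\<eta> s + \<bar>e\<bar>} \<subseteq> {tm - tb..tp}"
            using rng(1,2)[OF s'(1)] s' \<eta>e by (cases "0 \<le> e") auto
          have sd: "norm (x2 (\<eta>1 s) + x2 (\<eta>2 s) - 2 *\<^sub>R x2 (\<eta> s))
              \<le> K * h\<^sup>2 + K * h * (\<Sum>p\<in>P. 2 / (1 + ((\<eta> s - p) / h)\<^sup>2))"
            unfolding \<eta>e P_def by (rule K(2)[OF adm \<alpha> W(2) traj(2) h e sub])
          have Dd: "norm (D (\<eta>1 s) - D (\<eta> s)) \<le> (Vt (\<eta> s + h) - Vt (\<eta> s - h)) + c4 * \<epsilon> * h"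
          proof -
            have ceh: "c4 * \<epsilon> * \<bar>e\<bar> \<le> c4 * \<epsilon> * h" using c4 \<epsilon> e by (intro mult_left_mono) auto
            show ?thesis
            proof (cases "\<eta> s \<le> \<eta>1 s")
              case True
              then have "norm (D (\<eta>1 s) - D (\<eta> s)) \<le> (Vt (\<eta>1 s) - Vt (\<eta> s)) + c4 * \<epsilon> * (\<eta>1 s - \<eta> s)"
                using rng[OF s'(1)] s' by (intro D_incr) auto
              moreover have "Vt (\<eta>1 s) \<le> Vt (\<eta> s + h)" "Vt (\<eta> s - h) \<le> Vt (\<eta> s)"
                using e h \<eta>e by (auto intro!: Vt_mono)
              moreover have "\<eta>1 s - \<eta> s = \<bar>e\<bar>" using True \<eta>e by simp
              ultimately show ?thesis using ceh by simp
            next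
              case False
              then have "norm (D (\<eta> s) - D (\<eta>1 s)) \<le> (Vt (\<eta> s) - Vt (\<eta>1 s)) + c4 * \<epsilon> * (\<eta> s - \<eta>1 s)"
                using rng[OF s'(1)] s' by (intro D_incr) auto
              moreover have "Vt (\<eta> s) \<le> Vt (\<eta> s + h)" "Vt (\<eta> s - h) \<le> Vt (\<eta>1 s)"
                using e h \<eta>e by (auto intro!: Vt_mono)
              moreover have "\<eta> s - \<eta>1 s = \<bar>e\<bar>" using False \<eta>e by simp
              ultimately show ?thesis using ceh by (simp add: norm_minus_commute)
            qed
          qed
          have Yeq: "Y = u (\<eta> s) + 2 *\<^sub>R (x3 (\<eta> s) - x3 (\<eta>3 s)) + (D (\<eta>1 s) - D (\<eta> s))
              + (x2 (\<eta>1 s) + x2 (\<eta>2 s) - 2 *\<^sub>R x2 (\<eta> s))"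
            by (simp add: Y_def u_def D_def scaleR_2 algebra_simps)
          have Yb: "norm Y \<le> norm (u \<sigma>) + M * (\<gamma>t * (c2 * \<epsilon>)\<^sup>2 + lt * norm (u s))
              + ((Vt (\<eta> s + h) - Vt (\<eta> s - h)) + c4 * \<epsilon> * h)
              + (K * h\<^sup>2 + K * h * (\<Sum>p\<in>P. 2 / (1 + ((\<eta> s - p) / h)\<^sup>2)))"
            unfolding Yeq by (intro norm_triangle_mono u\<eta> x3b Dd sd)
          have fb1: "norm (?f1 + ?f2 - 2 *\<^sub>R ?fb) \<le> \<gamma>f * ((c2 * \<epsilon>)\<^sup>2 + (c3 * \<epsilon>)\<^sup>2)"
          proof -
            have "norm (?f1 + ?f2 - 2 *\<^sub>R ?fb)
                \<le> \<gamma>f * ((norm (x1 s - x2 s))\<^sup>2 + (norm (x1 (\<eta>1 s) - x2 (\<eta>2 s)))\<^sup>2)"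
              unfolding xb_def yb_def
              by (rule \<gamma>f(2)[OF st]) (use x1(1) x2(1) s' rng[OF s'(1)] in auto)
            also have "\<dots> \<le> \<gamma>f * ((c2 * \<epsilon>)\<^sup>2 + (c3 * \<epsilon>)\<^sup>2)"
              using \<gamma>f D[OF s'(2)] y12[OF s'(1)]
              by (intro mult_left_mono add_mono power_mono) (auto simp: D_def)
            finally show ?thesis .
          qed
          have fb2: "norm (2 *\<^sub>R ?fb - 2 *\<^sub>R ?f3) \<le> lf * (norm (u s) + norm Y)"
          proof -
            have "norm (2 *\<^sub>R ?fb - 2 *\<^sub>R ?f3) = 2 * norm (?fb - ?f3)"
              by (simp flip: scaleR_diff_right)
            also have "\<dots> \<le> 2 * (lf * (norm (xb - x3 s) + norm (yb - x3 (\<eta>3 s))))"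
              using lf(2)[OF st, of xb yb "x3 s" "x3 (\<eta>3 s)"] by simp
            also have "\<dots> = lf * (norm (2 *\<^sub>R (xb - x3 s)) + norm (2 *\<^sub>R (yb - x3 (\<eta>3 s))))" by simp
            also have "2 *\<^sub>R (xb - x3 s) = u s" by (simp add: u_def xb_def scaleR_diff_right)
            also have "2 *\<^sub>R (yb - x3 (\<eta>3 s)) = Y" by (simp add: Y_def yb_def scaleR_diff_right)
            finally show ?thesis .
          qed
          have "norm (?f1 + ?f2 - 2 *\<^sub>R ?f3) \<le> \<gamma>f * ((c2 * \<epsilon>)\<^sup>2 + (c3 * \<epsilon>)\<^sup>2) + lf * (norm (u s) + norm Y)"
            using norm_triangle_mono[OF fb1 fb2] by (simp only: add_diff_eq diff_add_cancel)
          also have "\<dots> \<le> \<gamma>f * ((c2 * \<epsilon>)\<^sup>2 + (c3 * \<epsilon>)\<^sup>2) + lf * (norm (u s) +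
              (norm (u \<sigma>) + M * (\<gamma>t * (c2 * \<epsilon>)\<^sup>2 + lt * norm (u s))
              + ((Vt (\<eta> s + h) - Vt (\<eta> s - h)) + c4 * \<epsilon> * h)
              + (K * h\<^sup>2 + K * h * (\<Sum>p\<in>P. 2 / (1 + ((\<eta> s - p) / h)\<^sup>2)))))"
            using lf by (intro add_left_mono mult_left_mono Yb) auto
          also have "\<dots> = lf * ((1 + M * lt) * norm (u s) + norm (u \<sigma>)) + c5 * \<epsilon>\<^sup>2 + \<phi> (\<eta> s)"
          proof -
            have hh: "c4 * \<epsilon> * h = c4 * (lt * c2) * \<epsilon>\<^sup>2" "K * h\<^sup>2 = K * (lt * c2)\<^sup>2 * \<epsilon>\<^sup>2"
              unfolding h_def by (simp_all add: power2_eq_square)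
            show ?thesis unfolding \<phi>_def c5_def hh power_mult_distrib[of _ \<epsilon>]
              by (simp add: algebra_simps)
          qed
          also have "\<dots> \<le> B * (norm (u s) + norm (u \<sigma>)) + c5 * \<epsilon>\<^sup>2 + \<phi> (\<eta> s)"
          proof -
            have "(1 + M * lt) * norm (u s) + norm (u \<sigma>) \<le> (1 + M * lt) * (norm (u s) + norm (u \<sigma>))"
              using RM lt by (simp add: algebra_simps)
            then have "lf * ((1 + M * lt) * norm (u s) + norm (u \<sigma>)) \<le> lf * ((1 + M * lt) * (norm (u s) + norm (u \<sigma>)))"
              using lf by (intro mult_left_mono) auto
            then show ?thesis by (simp only: B_def mult.assoc)
          qed
          finally show "\<exists>u' \<eta>' \<sigma>. (u has_vector_derivative u') (at s) \<and> (\<eta> has_real_derivative \<eta>') (at s) \<and>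
            d \<le> \<eta>' \<and> \<sigma> \<in> {tm..s} \<and> norm u' \<le> B * (norm (u s) + norm (u \<sigma>)) + c5 * \<epsilon>\<^sup>2 + \<phi> (\<eta> s)"
            using udv \<eta>' \<sigma> e12(1,3) by (intro exI[of _ "(e1 + e2) / 2"] exI[of _ \<sigma>] exI conjI) auto
        qed
      qed
    qed
    also have "norm (u tm) = 0" using u_hist[of tm] tb_pos by simp
    also have "2 * exp (4 * B * (tp - tm)) * (0 + c5 * \<epsilon>\<^sup>2 * (tp - tm) + c6 * \<epsilon>\<^sup>2 / d)
        \<le> 2 * exp (4 * B * (T - t0)) * (c5 * \<epsilon>\<^sup>2 * (T - t0) + c6 * \<epsilon>\<^sup>2 / d)"
    proof (rule mult_mono)
      show "2 * exp (4 * B * (tp - tm)) \<le> 2 * exp (4 * B * (T - t0))" using t B by simp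
      have "c5 * \<epsilon>\<^sup>2 * (tp - tm) \<le> c5 * \<epsilon>\<^sup>2 * (T - t0)" using t c5 by (intro mult_left_mono) auto
      then show "0 + c5 * \<epsilon>\<^sup>2 * (tp - tm) + c6 * \<epsilon>\<^sup>2 / d \<le> c5 * \<epsilon>\<^sup>2 * (T - t0) + c6 * \<epsilon>\<^sup>2 / d" by simp
    qed (use t c5 c6 d in auto)
    also have "\<dots> \<le> C * \<epsilon>\<^sup>2" by (simp add: C_def algebra_simps)
    finally show ?thesis by (simp add: u_def)
  qed
  then show ?thesis using C by blast
qed

text \<open>A positive norm is itself an admissible \<open>\<epsilon>\<close>. If the norm vanishes,
  every \<open>\<epsilon>\<close> is admissible and the left-hand side must be zero.\<close>

lemma trajectory_second_order_bound:
  assumes r: "0 < r" and l: "0 \<le> l"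
  shows "\<exists>C>0. \<forall>tm tp w1 w2 w3 \<alpha> x1 x2 x3. admissible tm tp \<alpha> \<and> l-lipschitz_on {tm<..tp} \<alpha> \<and>
    w1 \<in> WN_hist tb r N \<and> w2 \<in> WN_hist tb r N \<and> w3 = (\<lambda>\<theta>. (1/2) *\<^sub>R (w1 \<theta> + w2 \<theta>)) \<and>
    is_trajectory f tau tb tm tp w1 \<alpha> x1 \<and> is_trajectory f tau tb tm tp w2 \<alpha> x2 \<and>
    is_trajectory f tau tb tm tp w3 \<alpha> x3 \<longrightarrow>
    (\<forall>s\<in>{tm..tp}. norm (x1 s + x2 s - 2 *\<^sub>R x3 s) \<le> C * (H1_norm tb (\<lambda>\<theta>. w1 \<theta> - w2 \<theta>))\<^sup>2)"
proof -
  from trajectory_second_order_bound_aux[OF r l, of N] obtain C where C: "C > 0"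
    and aux: "\<forall>tm tp w1 w2 w3 \<alpha> x1 x2 x3 \<epsilon>. admissible tm tp \<alpha> \<and> l-lipschitz_on {tm<..tp} \<alpha> \<and>
    w1 \<in> WN_hist tb r N \<and> w2 \<in> WN_hist tb r N \<and> w3 = (\<lambda>\<theta>. (1/2) *\<^sub>R (w1 \<theta> + w2 \<theta>)) \<and>
    is_trajectory f tau tb tm tp w1 \<alpha> x1 \<and> is_trajectory f tau tb tm tp w2 \<alpha> x2 \<and>
    is_trajectory f tau tb tm tp w3 \<alpha> x3 \<and> 0 < \<epsilon> \<and> H1_norm tb (\<lambda>\<theta>. w1 \<theta> - w2 \<theta>) \<le> \<epsilon> \<longrightarrow>
    (\<forall>s\<in>{tm..tp}. norm (x1 s + x2 s - 2 *\<^sub>R x3 s) \<le> C * \<epsilon>\<^sup>2)"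
    by (elim exE conjE)
  have "norm (x1 s + x2 s - 2 *\<^sub>R x3 s) \<le> C * (H1_norm tb (\<lambda>\<theta>. w1 \<theta> - w2 \<theta>))\<^sup>2"
    if asm: "admissible tm tp \<alpha>" "l-lipschitz_on {tm<..tp} \<alpha>" "w1 \<in> WN_hist tb r N" "w2 \<in> WN_hist tb r N"
      "w3 = (\<lambda>\<theta>. (1/2) *\<^sub>R (w1 \<theta> + w2 \<theta>))" "is_trajectory f tau tb tm tp w1 \<alpha> x1"
      "is_trajectory f tau tb tm tp w2 \<alpha> x2" "is_trajectory f tau tb tm tp w3 \<alpha> x3"
      and s: "s \<in> {tm..tp}" for tm tp w1 w2 w3 \<alpha> x1 x2 x3 s
  proof (cases "H1_norm tb (\<lambda>\<theta>. w1 \<theta> - w2 \<theta>) = 0")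
    case False
    then have pos: "0 < H1_norm tb (\<lambda>\<theta>. w1 \<theta> - w2 \<theta>)" by (simp add: H1_norm_def less_le)
    show ?thesis
      by (rule aux[rule_format, of tm tp \<alpha> w1 w2 w3, OF _ s]) (intro conjI asm pos order_refl)
  next
    case True
    have "norm (x1 s + x2 s - 2 *\<^sub>R x3 s) \<le> 0"
    proof (rule field_le_epsilon)
      fix e :: real assume e: "0 < e"
      \<comment> \<open>The choice \<open>sqrt (e / C)\<close> turns the quadratic bound into
        exactly \<open>e\<close>.\<close>
      have "norm (x1 s + x2 s - 2 *\<^sub>R x3 s) \<le> C * (sqrt (e / C))\<^sup>2"
        by (rule aux[rule_format, of tm tp \<alpha> w1 w2 w3, OF _ s], intro conjI asm) (use True e C in simp_all)
      also have "\<dots> = e" using e C by simp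
      finally show "norm (x1 s + x2 s - 2 *\<^sub>R x3 s) \<le> 0 + e" by simp
    qed
    then show ?thesis using True by simp
  qed
  then show ?thesis using C by blast
qed

end

theorem lemma6p3:
  fixes t0 T tb :: real
    and A :: "(real^'m) set"
    and f :: "real \<times> (real^'n) \<times> (real^'n) \<times> (real^'m) \<Rightarrow> real^'n"
    and L :: "real \<times> (real^'n) \<times> (real^'n) \<times> (real^'m) \<Rightarrow> real"
    and g :: "(real^'n) \<times> (real \<Rightarrow> real^'n) \<Rightarrow> real"
    and tau :: "real \<times> (real^'n) \<Rightarrow> real"
    and Dtau :: "real \<times> (real^'n) \<Rightarrow> (real \<times> (real^'n)) \<Rightarrow>\<^sub>L real"
  assumes "delay_control_problem t0 T A f L g tau Dtau tb"
  shows
    "(\<forall>r>0. \<exists>C>0. \<forall>tm tp N w1 w2 \<alpha> x1 x2.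
       t0 \<le> tm \<and> tm < tp \<and> tp \<le> T \<and>
       w1 \<in> WN_hist tb r N \<and> w2 \<in> WN_hist tb r N \<and>
       \<alpha> \<in> Lip_controls {tm..tp} A \<and>
       is_trajectory f tau tb tm tp w1 \<alpha> x1 \<and> is_trajectory f tau tb tm tp w2 \<alpha> x2 \<longrightarrow>
       (\<forall>s\<in>{tm..tp}.
          norm (x1 s - x2 s) \<le> C * (norm (w1 0 - w2 0) + L1_norm tb (\<lambda>\<theta>. w1 \<theta> - w2 \<theta>)))) \<and>
     (\<forall>r>0. \<forall>N. \<forall>l\<ge>0. \<exists>C>0. \<forall>tm tp J w1 w2 w3 \<alpha> x1 x2 x3.
       t0 \<le> tm \<and> tm < tp \<and> tp \<le> T \<and>
       w1 \<in> WN_hist tb r N \<and> w2 \<in> WN_hist tb r N \<and> w3 = (\<lambda>\<theta>. (1/2) *\<^sub>R (w1 \<theta> + w2 \<theta>)) \<and>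
       (J = {tm..tp} \<or> J = {tm<..tp}) \<and> \<alpha> \<in> Lip_controls J A \<and> lip_const J \<alpha> = l \<and>
       is_trajectory f tau tb tm tp w1 \<alpha> x1 \<and> is_trajectory f tau tb tm tp w2 \<alpha> x2 \<and>
       is_trajectory f tau tb tm tp w3 \<alpha> x3 \<longrightarrow>
       (\<forall>s\<in>{tm..tp}.
          norm (x1 s + x2 s - 2 *\<^sub>R x3 s) \<le> C * (H1_norm tb (\<lambda>\<theta>. w1 \<theta> - w2 \<theta>))\<^sup>2))"
proof (intro conjI allI impI)
  interpret delay_control_problem t0 T A f L g tau Dtau tb by fact
  fix r :: real assume r: "0 < r"
  obtain C where "0 < C" and C: "\<And>tm tp w1 w2 \<alpha> x1 x2 s. \<lbrakk>admissible tm tp \<alpha>; bounded_hist r w1;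
      bounded_hist r w2; is_trajectory f tau tb tm tp w1 \<alpha> x1; is_trajectory f tau tb tm tp w2 \<alpha> x2;
      s \<in> {tm..tp}\<rbrakk> \<Longrightarrow>
      norm (x1 s - x2 s) \<le> C * (norm (w1 0 - w2 0) + L1_norm tb (\<lambda>\<theta>. w1 \<theta> - w2 \<theta>))"
    using trajectory_difference_bound[OF r] by blast
  show "\<exists>C>0. \<forall>tm tp N w1 w2 \<alpha> x1 x2.
       t0 \<le> tm \<and> tm < tp \<and> tp \<le> T \<and>
       w1 \<in> WN_hist tb r N \<and> w2 \<in> WN_hist tb r N \<and>
       \<alpha> \<in> Lip_controls {tm..tp} A \<and>
       is_trajectory f tau tb tm tp w1 \<alpha> x1 \<and> is_trajectory f tau tb tm tp w2 \<alpha> x2 \<longrightarrow>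
       (\<forall>s\<in>{tm..tp}.
          norm (x1 s - x2 s) \<le> C * (norm (w1 0 - w2 0) + L1_norm tb (\<lambda>\<theta>. w1 \<theta> - w2 \<theta>)))"
  proof (intro exI[of _ C] conjI allI impI ballI \<open>0 < C\<close>; elim conjE)
    fix tm tp N w1 w2 \<alpha> x1 x2 s
    assume t: "t0 \<le> tm" "tm < tp" "tp \<le> T" and w: "w1 \<in> WN_hist tb r N" "w2 \<in> WN_hist tb r N"
      and \<alpha>: "\<alpha> \<in> Lip_controls {tm..tp} A" and s: "s \<in> {tm..tp}"
      and traj: "is_trajectory f tau tb tm tp w1 \<alpha> x1" "is_trajectory f tau tb tm tp w2 \<alpha> x2"
    have "bounded_hist r w1" "bounded_hist r w2"
      using w r by (auto simp: WN_hist_def intro: W_hist_imp_bounded_hist)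
    then show "norm (x1 s - x2 s) \<le> C * (norm (w1 0 - w2 0) + L1_norm tb (\<lambda>\<theta>. w1 \<theta> - w2 \<theta>))"
      by (rule C[OF Lip_controls_imp_admissible(1)[OF t disjI1[OF refl] \<alpha>] _ _ traj s])
  qed
next
  interpret delay_control_problem t0 T A f L g tau Dtau tb by fact
  fix r l :: real and N :: nat assume "0 < r" "0 \<le> l"
  from trajectory_second_order_bound[OF this, of N]
  obtain C where "0 < C" and C: "\<forall>tm tp w1 w2 w3 \<alpha> x1 x2 x3. admissible tm tp \<alpha> \<and> l-lipschitz_on {tm<..tp} \<alpha> \<and>
    w1 \<in> WN_hist tb r N \<and> w2 \<in> WN_hist tb r N \<and> w3 = (\<lambda>\<theta>. (1/2) *\<^sub>R (w1 \<theta> + w2 \<theta>)) \<and>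
    is_trajectory f tau tb tm tp w1 \<alpha> x1 \<and> is_trajectory f tau tb tm tp w2 \<alpha> x2 \<and>
    is_trajectory f tau tb tm tp w3 \<alpha> x3 \<longrightarrow>
    (\<forall>s\<in>{tm..tp}. norm (x1 s + x2 s - 2 *\<^sub>R x3 s) \<le> C * (H1_norm tb (\<lambda>\<theta>. w1 \<theta> - w2 \<theta>))\<^sup>2)"
    by (elim exE conjE)
  show "\<exists>C>0. \<forall>tm tp J w1 w2 w3 \<alpha> x1 x2 x3.
       t0 \<le> tm \<and> tm < tp \<and> tp \<le> T \<and>
       w1 \<in> WN_hist tb r N \<and> w2 \<in> WN_hist tb r N \<and> w3 = (\<lambda>\<theta>. (1/2) *\<^sub>R (w1 \<theta> + w2 \<theta>)) \<and>
       (J = {tm..tp} \<or> J = {tm<..tp}) \<and> \<alpha> \<in> Lip_controls J A \<and> lip_const J \<alpha> = l \<and>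
       is_trajectory f tau tb tm tp w1 \<alpha> x1 \<and> is_trajectory f tau tb tm tp w2 \<alpha> x2 \<and>
       is_trajectory f tau tb tm tp w3 \<alpha> x3 \<longrightarrow>
       (\<forall>s\<in>{tm..tp}.
          norm (x1 s + x2 s - 2 *\<^sub>R x3 s) \<le> C * (H1_norm tb (\<lambda>\<theta>. w1 \<theta> - w2 \<theta>))\<^sup>2)"
  proof (intro exI[of _ C] conjI allI impI \<open>0 < C\<close>; elim conjE)
    fix tm tp J w1 w2 w3 \<alpha> x1 x2 x3
    assume t: "t0 \<le> tm" "tm < tp" "tp \<le> T" and J: "J = {tm..tp} \<or> J = {tm<..tp}"
      and \<alpha>: "\<alpha> \<in> Lip_controls J A" "lip_const J \<alpha> = l"
      and rest: "w1 \<in> WN_hist tb r N" "w2 \<in> WN_hist tb r N" "w3 = (\<lambda>\<theta>. (1/2) *\<^sub>R (w1 \<theta> + w2 \<theta>))"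
        "is_trajectory f tau tb tm tp w1 \<alpha> x1" "is_trajectory f tau tb tm tp w2 \<alpha> x2"
        "is_trajectory f tau tb tm tp w3 \<alpha> x3"
    show "\<forall>s\<in>{tm..tp}. norm (x1 s + x2 s - 2 *\<^sub>R x3 s) \<le> C * (H1_norm tb (\<lambda>\<theta>. w1 \<theta> - w2 \<theta>))\<^sup>2"
    proof
      fix s assume s: "s \<in> {tm..tp}"
      show "norm (x1 s + x2 s - 2 *\<^sub>R x3 s) \<le> C * (H1_norm tb (\<lambda>\<theta>. w1 \<theta> - w2 \<theta>))\<^sup>2"
        by (rule C[rule_format, of tm tp \<alpha> w1 w2 w3, OF _ s])
          (intro conjI rest Lip_controls_imp_admissible(1)[OF t J \<alpha>(1)]
            Lip_controls_imp_admissible(2)[OF t J \<alpha>(1), unfolded \<alpha>(2)])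
    qed
  qed
qed

end
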